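(* Let $\boldsymbol{S}$ be a regular $m$-tier strip of length $n$ having at least one Kekulé structure, with associated poset $\mathcal{S}$, and consider an integer $k$. Then the number $a(\boldsymbol{S},k)$ of Kekulé structures of $\boldsymbol{S}$ with exactly $k$ proper sextets is given by $$a(\boldsymbol{S},k)=\sum_{\substack{\mathcal{A}\subset\mathcal{S}\\ |\mathcal{A}|=k}}\Omega_{\mathcal{A}}^{\circ}(n),$$ where the sum runs over the induced subposets $\mathcal{A}$ of $\mathcal{S}$ with $k$ elements, and the Zhang-Zhang polynomial of $\boldsymbol{S}$ is given by the extended strict order polynomial of $\mathcal{S}$: $$\mathrm{ZZ}(\boldsymbol{S},x)=\mathrm{E}_{\mathcal{S}}^{\circ}(n,x+1).$$
   Context: Geometry. Let $L$ be the infinite hexagonal lattice, drawn so that some of its edges are vertical. A benzenoid is a finite subgraph of $L$ consisting of all vertices and edges lying on or inside a cycle of $L$. A regular 1-tier strip of length $n$ consists of $n$ adjacent hexagons in the same horizontal row of $L$. A regular $m$-tier strip $\boldsymbol{S}$ of length $n$ is obtained by merging $m$ consecutive regular 1-tier strips located in adjacent rows of $L$ (numbered $1,\dots,m$ from top to bottom) such that (i) adjacent strips differ at each end (left and right) by $\pm\frac12$ hexagon unit, and (ii) the top and bottom 1-tier strips both have length $n$. Interfaces and fragments. For $k=1,\dots,m$ the interface $i_k$ is the set of vertical edges of the hexagons in row $k$; put $i_0=i_{m+1}=\varnothing$. The fragment $f_k$ ($1\le k\le m+1$) is the set of edges (and vertices) lying at least partially between the horizontal lines $P_{k-1}$ and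 $P_k$, where $P_k$ ($1\le k\le m$) is the horizontal line through the midpoints of the edges of $i_k$, $P_0$ lies above $\boldsymbol{S}$ and $P_{m+1}$ below $\boldsymbol{S}$. The interface bonds of $f_k$ are the elements of $i_{k-1}\cup i_k$, ordered from left to right by horizontal position; the first one is the leftmost. Poset $\mathcal{S}$. Put $\mathrm{ord}(i_k)=|i_k|-n$ (non-negative when $\boldsymbol{S}$ has a Kekulé structure). The poset is $\mathcal{S}=\{s_{k,j}: 1\le k\le m,\ 1\le j\le \mathrm{ord}(i_k)\}$ with strict order $<_{\mathcal{S}}$ generated (by transitive closure) by the cover relations: $s_{k,j}\lessdot_{\mathcal{S}}s_{k',j'}$ if and only if $|k'-k|=1$ and, with $\kappa=\max(k,k')$, $j'-j=0$ when the first interface bond of $f_\kappa$ belongs to $i_k$, and $j'-j=1$ when the first interface bond of $f_\kappa$ belongs to $i_{k'}$. Kekulé structures, Clar covers. A Clar cover of $\boldsymbol{S}$ is a spanning subgraph every connected component of which is isomorphic to $K_2$ or to the cycle $C_6$; its order is the number of $C_6$ components. A Kekulé structure is a Clar cover of order $0$ (a perfect matching). A proper sextet of a Kekulé structure $K$ is a hexagon of $\boldsymbol{S}$ whose right vertical edge, upper-left slanted edge and lower-left slanted edge all belong to $K$. If $c_k$ is the number of Clar covers of order $k$ and $Cl$ is the maximal order, the Zhang-Zhang polynomial is $\mathrm{ZZ}(\boldsymbol{S},x)=\sum_{k=0}^{Cl}c_kx^k$. Order polynomials. An induced subposet $Q\subset P$ is a (possibly empty) subset with the inherited order. $\Omega_P^{\circ}(n)$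 is the number of maps $\phi:P\to\{1,\dots,n\}$ with $s<_Pt\Rightarrow\phi(s)<\phi(t)$. The extended strict order polynomial is $\mathrm{E}_P^{\circ}(n,z)=\sum_{Q\subset P}\Omega_Q^{\circ}(n)\,z^{|Q|}$, the sum running over all induced subposets $Q$ of $P$. *)

theory Defs
  imports "HOL-Library.FuncSet" "HOL-Computational_Algebra.Polynomial"
begin

section \<open>Finite simple graphs\<close>

text \<open>A graph is a pair of a vertex set and a set of edges, each edge being a two-element set.\<close>

type_synonym 'v graph = "'v set \<times> 'v set set"

abbreviation verts :: "'v graph \<Rightarrow> 'v set" where "verts \<equiv> fst"
abbreviation edges :: "'v graph \<Rightarrow> 'v set set" where "edges \<equiv> snd"

definition spanning_subgraph :: "'v graph \<Rightarrow> 'v graph \<Rightarrow> bool" where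
  "spanning_subgraph H G \<longleftrightarrow> verts H = verts G \<and> edges H \<subseteq> edges G"

definition graph_iso :: "'v graph \<Rightarrow> 'w graph \<Rightarrow> bool" where
  "graph_iso G H \<longleftrightarrow>
     (\<exists>f. bij_betw f (verts G) (verts H) \<and> (\<lambda>e. f ` e) ` edges G = edges H)"

definition connected_component :: "'v graph \<Rightarrow> 'v \<Rightarrow> 'v graph" where
  "connected_component G v =
     (let W = {w. (v, w) \<in> {(x, y). {x, y} \<in> edges G}\<^sup>*} in (W, {e \<in> edges G. e \<subseteq> W}))"

definition connected_components :: "'v graph \<Rightarrow> 'v graph set" where
  "connected_components G = connected_component G ` verts G"

definition K2 :: "nat graph" where
  "K2 = ({0, 1}, {{0, 1}})"

definition C6 :: "nat graph" where
  "C6 = ({..<6}, {{i, (i + 1) mod 6} | i. i < 6})"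

section \<open>The hexagonal lattice\<close>

text \<open>
  Rows of hexagons are numbered from top to bottom by integers, and horizontal positions are
  measured in half hexagon units. The hexagon in row \<open>r\<close> whose centre has horizontal position
  \<open>x\<close> is \<open>(r, x)\<close>; since consecutive rows are shifted by half a unit, such a hexagon exists
  iff \<open>r + x\<close> is even. Its vertical edges lie at the positions \<open>x - 1\<close> and \<open>x + 1\<close>.
  Every vertex of the lattice is the upper or the lower end of exactly one vertical edge, so
  \<open>Upper r p\<close> and \<open>Lower r p\<close> (for odd \<open>r + p\<close>) name all vertices: they are the ends of the
  vertical edge in row \<open>r\<close> at position \<open>p\<close>. In particular the topmost vertex of hexagon \<open>(r, x)\<close>
  is \<open>Lower (r - 1) x\<close> and its bottommost vertex is \<open>Upper (r + 1) x\<close>.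
\<close>

datatype vertex = Upper int int | Lower int int

fun xpos :: "vertex \<Rightarrow> int" where
  "xpos (Upper r p) = p"
| "xpos (Lower r p) = p"

type_synonym hexagon = "int \<times> int"

definition lattice_hexagons :: "hexagon set" where
  "lattice_hexagons = {(r, x). even (r + x)}"

fun left_edge right_edge upper_left_edge upper_right_edge lower_left_edge lower_right_edge
  :: "hexagon \<Rightarrow> vertex set"
where
  "left_edge (r, x) = {Upper r (x - 1), Lower r (x - 1)}"
| "right_edge (r, x) = {Upper r (x + 1), Lower r (x + 1)}"
| "upper_left_edge (r, x) = {Upper r (x - 1), Lower (r - 1) x}"
| "upper_right_edge (r, x) = {Upper r (x + 1), Lower (r - 1) x}"
| "lower_left_edge (r, x) = {Lower r (x - 1), Upper (r + 1) x}"
| "lower_right_edge (r, x) = {Lower r (x + 1), Upper (r + 1) x}"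

definition hexagon_edges :: "hexagon \<Rightarrow> vertex set set" where
  "hexagon_edges h = {left_edge h, right_edge h, upper_left_edge h, upper_right_edge h,
     lower_left_edge h, lower_right_edge h}"

text \<open>The subgraph of the lattice formed by a set of hexagons.\<close>

definition hex_graph :: "hexagon set \<Rightarrow> vertex graph" where
  "hex_graph S = (\<Union> (\<Union> (hexagon_edges ` S)), \<Union> (hexagon_edges ` S))"

section \<open>Regular strips\<close>

text \<open>\<open>len\<close> adjacent hexagons of row \<open>r\<close>, the leftmost one being \<open>(r, l)\<close>.\<close>

definition tier :: "int \<Rightarrow> int \<Rightarrow> nat \<Rightarrow> hexagon set" where
  "tier r l len = {(r, l + 2 * int i) | i. i < len}"

text \<open>
  A strip is given by its set of hexagons. It may lie anywhere in the lattice: its row \<open>k\<close>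
  is row \<open>r0 + k\<close> of the lattice. The length \<open>len k\<close> of each tier is the number of its hexagons;
  \<open>l k\<close> and \<open>l k + 2 * (len k - 1)\<close> are the positions of its first and last hexagon.
\<close>

definition regular_strip :: "nat \<Rightarrow> nat \<Rightarrow> hexagon set \<Rightarrow> bool" where
  "regular_strip m n S \<longleftrightarrow> m \<ge> 1 \<and>
     (\<exists>(r0 :: int) (l :: nat \<Rightarrow> int) (len :: nat \<Rightarrow> nat).
        (\<forall>k\<in>{1..m}. len k \<ge> 1 \<and> tier (r0 + int k) (l k) (len k) \<subseteq> lattice_hexagons) \<and>
        (\<forall>k\<in>{1..<m}.
           \<bar>l (k + 1) - l k\<bar> = 1 \<and>
           \<bar>(l (k + 1) + 2 * (int (len (k + 1)) - 1)) - (l k + 2 * (int (len k) - 1))\<bar> = 1) \<and>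
        len 1 = n \<and> len m = n \<and>
        S = (\<Union>k\<in>{1..m}. tier (r0 + int k) (l k) (len k)))"

definition row :: "hexagon set \<Rightarrow> nat \<Rightarrow> hexagon set" where
  "row S k = {h \<in> S. fst h = Min (fst ` S) + int k - 1}"

definition iface :: "hexagon set \<Rightarrow> nat \<Rightarrow> vertex set set" where
  "iface S k = left_edge ` row S k \<union> right_edge ` row S k"

text \<open>The interface bonds of the fragment between the interfaces \<open>k - 1\<close> and \<open>k\<close>.\<close>

definition interface_bonds :: "hexagon set \<Rightarrow> nat \<Rightarrow> vertex set set" where
  "interface_bonds S k = iface S (k - 1) \<union> iface S k"

definition hpos :: "vertex set \<Rightarrow> int" where
  "hpos e = (THE p. xpos ` e = {p})"

definition first_bond :: "hexagon set \<Rightarrow> nat \<Rightarrow> vertex set" where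
  "first_bond S k = (ARG_MIN hpos e. e \<in> interface_bonds S k)"

section \<open>The poset of a strip\<close>

definition iface_ord :: "nat \<Rightarrow> hexagon set \<Rightarrow> nat \<Rightarrow> int" where
  "iface_ord n S k = int (card (iface S k)) - int n"

text \<open>The pair \<open>(k, j)\<close> stands for the element $s_{k,j}$.\<close>

definition strip_poset :: "nat \<Rightarrow> nat \<Rightarrow> hexagon set \<Rightarrow> (nat \<times> nat) set" where
  "strip_poset m n S = {(k, j). 1 \<le> k \<and> k \<le> m \<and> 1 \<le> j \<and> int j \<le> iface_ord n S k}"

definition strip_covers :: "nat \<Rightarrow> nat \<Rightarrow> hexagon set \<Rightarrow> ((nat \<times> nat) \<times> (nat \<times> nat)) set" where
  "strip_covers m n S = {((k, j), (k', j')).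
     (k, j) \<in> strip_poset m n S \<and> (k', j') \<in> strip_poset m n S \<and>
     \<bar>int k' - int k\<bar> = 1 \<and>
     (let b = first_bond S (max k k') in
        (b \<in> iface S k \<and> int j' - int j = 0) \<or> (b \<in> iface S k' \<and> int j' - int j = 1))}"

definition strip_less :: "nat \<Rightarrow> nat \<Rightarrow> hexagon set \<Rightarrow> ((nat \<times> nat) \<times> (nat \<times> nat)) set" where
  "strip_less m n S = (strip_covers m n S)\<^sup>+"

section \<open>Kekule structures, Clar covers and the Zhang-Zhang polynomial\<close>

definition clar_cover :: "hexagon set \<Rightarrow> vertex graph \<Rightarrow> bool" where
  "clar_cover S C \<longleftrightarrow> spanning_subgraph C (hex_graph S) \<and>
     (\<forall>X \<in> connected_components C. graph_iso X K2 \<or> graph_iso X C6)"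

definition clar_order :: "vertex graph \<Rightarrow> nat" where
  "clar_order C = card {X \<in> connected_components C. graph_iso X C6}"

definition kekule :: "hexagon set \<Rightarrow> vertex graph \<Rightarrow> bool" where
  "kekule S K \<longleftrightarrow> clar_cover S K \<and> clar_order K = 0"

definition proper_sextet :: "hexagon set \<Rightarrow> vertex graph \<Rightarrow> hexagon \<Rightarrow> bool" where
  "proper_sextet S K h \<longleftrightarrow> h \<in> S \<and>
     right_edge h \<in> edges K \<and> upper_left_edge h \<in> edges K \<and> lower_left_edge h \<in> edges K"

definition num_kekule :: "hexagon set \<Rightarrow> int \<Rightarrow> nat" where
  "num_kekule S k = card {K. kekule S K \<and> int (card {h. proper_sextet S K h}) = k}"

definition max_clar_order :: "hexagon set \<Rightarrow> nat" where
  "max_clar_order S = Max (clar_order ` {C. clar_cover S C})"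

definition num_clar_covers :: "hexagon set \<Rightarrow> nat \<Rightarrow> nat" where
  "num_clar_covers S k = card {C. clar_cover S C \<and> clar_order C = k}"

definition ZZ :: "hexagon set \<Rightarrow> int poly" where
  "ZZ S = (\<Sum>k = 0..max_clar_order S. monom (int (num_clar_covers S k)) k)"

section \<open>Order polynomials\<close>

text \<open>
  A poset is given by its carrier \<open>P\<close> and its strict order \<open>r\<close>. Only pairs within \<open>P\<close> matter,
  so for \<open>Q \<subseteq> P\<close> the induced subposet is represented by \<open>Q\<close> and the same relation \<open>r\<close>.
\<close>

definition strict_order_poly :: "'a set \<Rightarrow> ('a \<times> 'a) set \<Rightarrow> nat \<Rightarrow> nat" where
  "strict_order_poly P r n =
     card {\<phi> \<in> P \<rightarrow>\<^sub>E {1..n}. \<forall>s\<in>P. \<forall>t\<in>P. (s, t) \<in> r \<longrightarrow> \<phi> s < \<phi> t}"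

text \<open>For a fixed \<open>n\<close>, as a polynomial in the second argument \<open>z\<close>.\<close>

definition ext_strict_order_poly :: "'a set \<Rightarrow> ('a \<times> 'a) set \<Rightarrow> nat \<Rightarrow> int poly" where
  "ext_strict_order_poly P r n =
     (\<Sum>Q\<in>Pow P. monom (int (strict_order_poly Q r n)) (card Q))"

end

theory Submission
  imports Defs "HOL-Library.Disjoint_Sets"
begin

text \<open>
  Cut the strip along the lines through the midpoints of the vertical bonds. Every fragment that
  is left over is a zigzag path, and a path from which some vertices have been removed has at most
  one perfect matching. A perfect matching of the strip is therefore determined by the sets
  \<open>D k\<close> of vertical bonds that it uses in the rows \<open>k\<close>. Conversely such a family comes
  from a perfect matching iff in every fragment the bonds of the two adjacent rows alternate from
  left to right, beginning and ending with the type of the first and of the last bond of the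
  fragment (\<open>path_matching_iff\<close>, \<open>bij_betw_matching\<close>). Counting the two kinds of
  bonds from the top down gives \<open>card (D k) = ord(i_k)\<close> (\<open>card_if_balanced\<close>), and the
  alternation says exactly that sending the poset element \<open>(k, j)\<close> to the position of the
  \<open>j\<close>-th bond of \<open>D k\<close> is strictly increasing along the covers of the poset.

  The leftmost position that the \<open>j\<close>-th bond of row \<open>k\<close> can have, measured in half hexagon
  units, is a rank function of the poset: it grows by exactly 1 along a cover
  (\<open>strip_covers_hexes\<close>). Positions within a row vary in steps of 2. Hence
  \<open>position = rank + 2 * \<psi>\<close> turns strictly increasing positions into weakly order-preserving
  maps \<open>\<psi>\<close> from the poset to \<open>{0..n}\<close>, and the perfect matchings correspond to these maps
  (\<open>bij_betw_bonds_at\<close>).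

  A hexagon is a proper sextet iff its right vertical bond is used and could be moved one hexagon
  to the left, which happens iff \<open>\<psi>\<close> is positive at the corresponding element and is
  strictly larger there than at all smaller elements. These elements are the jumps of \<open>\<psi>\<close>
  (\<open>jump_iff\<close>). A weakly order-preserving map is recovered from its restriction to its jumps by
  taking maxima, and every strict map from a subset \<open>A\<close> to \<open>{1..n}\<close> arises in this way
  (\<open>bij_betw_weak_maps_strict_maps\<close>). So the matchings with \<open>k\<close> proper sextets are counted by
  the strict order polynomials of the subposets with \<open>k\<close> elements.

  For the Zhang-Zhang polynomial, replace every hexagon of a Clar cover by its three
  proper-sextet edges. This is a bijection between Clar covers and pairs consisting of a perfect
  matching and a set of proper sextets of it (\<open>bij_betw_exact_covers\<close>), so a matching
  with \<open>p\<close> proper sextets contributes \<open>(1 + x) ^ p\<close>.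
\<close>

section \<open>Order-preserving maps and their jumps\<close>

definition weak_maps :: "'a set \<Rightarrow> ('a \<times> 'a) set \<Rightarrow> nat \<Rightarrow> ('a \<Rightarrow> nat) set" where
  "weak_maps P r n = {\<psi> \<in> P \<rightarrow>\<^sub>E {0..n}. \<forall>s\<in>P. \<forall>t\<in>P. (s, t) \<in> r \<longrightarrow> \<psi> s \<le> \<psi> t}"

definition strict_maps :: "'a set \<Rightarrow> ('a \<times> 'a) set \<Rightarrow> nat \<Rightarrow> ('a \<Rightarrow> nat) set" where
  "strict_maps P r n = {\<phi> \<in> P \<rightarrow>\<^sub>E {1..n}. \<forall>s\<in>P. \<forall>t\<in>P. (s, t) \<in> r \<longrightarrow> \<phi> s < \<phi> t}"

text \<open>
  The elements where the value is not forced from below: for a weakly order-preserving map to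
  \<open>{0..n}\<close>, the smallest admissible value at \<open>t\<close> is the maximum of 0 and of the values
  at the smaller elements.
\<close>

definition jumps :: "'a set \<Rightarrow> ('a \<times> 'a) set \<Rightarrow> ('a \<Rightarrow> nat) \<Rightarrow> 'a set" where
  "jumps P r \<psi> = {t \<in> P. 0 < \<psi> t \<and> (\<forall>s\<in>P. (s, t) \<in> r \<longrightarrow> \<psi> s < \<psi> t)}"

text \<open>
  The least weakly order-preserving extension of \<open>\<phi>\<close> from \<open>A\<close> to \<open>P\<close>. The
  inserted 0 is the value at the elements that are neither in \<open>A\<close> nor above an element of \<open>A\<close>.
\<close>

definition extend_map :: "'a set \<Rightarrow> ('a \<times> 'a) set \<Rightarrow> 'a set \<Rightarrow> ('a \<Rightarrow> nat) \<Rightarrow> 'a \<Rightarrow> nat" where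
  "extend_map P r A \<phi> = (\<lambda>t\<in>P. Max (insert 0 (\<phi> ` {a \<in> A. a = t \<or> (a, t) \<in> r})))"

text \<open>
  If \<open>t\<close> is not a jump itself, then the same value is taken at a smaller element; descending
  as long as possible ends in a jump.
\<close>

lemma jump_below:
  assumes fin: "finite P" and tr: "trans r" and ir: "irrefl r"
    and \<psi>: "\<psi> \<in> weak_maps P r n" and t: "t \<in> P" and pos: "0 < \<psi> t"
  shows "\<exists>a\<in>jumps P r \<psi>. (a = t \<or> (a, t) \<in> r) \<and> \<psi> a = \<psi> t"
proof -
  have "acyclic (r \<inter> P \<times> P)"
    using acyclic_subset[of r "r \<inter> P \<times> P"] tr ir by (auto simp: acyclic_irrefl)
  then have wf: "wf (r \<inter> P \<times> P)"
    by (simp add: fin finite_acyclic_wf)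
  show ?thesis using t pos
  proof (induction t rule: wf_induct_rule[OF wf])
    case (1 t)
    show ?case
    proof (cases "t \<in> jumps P r \<psi>")
      case False
      with 1 obtain s where s: "s \<in> P" "(s, t) \<in> r" "\<not> \<psi> s < \<psi> t"
        by (auto simp: jumps_def)
      then have eq: "\<psi> s = \<psi> t"
        using \<psi> 1 by (force simp: weak_maps_def)
      with 1 s obtain a where "a \<in> jumps P r \<psi>" "a = s \<or> (a, s) \<in> r" "\<psi> a = \<psi> s"
        by (metis IntI SigmaI)
      then show ?thesis
        using s tr eq by (metis transD)
    qed auto
  qed
qed

text \<open>
  The inverse map is \<open>extend_map\<close>. A weak map is the least extension of its restriction to
  its jumps because every positive value is taken at a jump below. Conversely the least extension
  of a strict map has no jumps outside \<open>A\<close>, where its values are copied from below, and it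
  jumps everywhere on \<open>A\<close> because the map is strict.
\<close>

lemma bij_betw_weak_maps_strict_maps:
  assumes fin: "finite P" and tr: "trans r" and ir: "irrefl r"
  shows "bij_betw (\<lambda>\<psi>. (jumps P r \<psi>, restrict \<psi> (jumps P r \<psi>)))
           (weak_maps P r n) (SIGMA A:Pow P. strict_maps A r n)"
proof -
  have ext_le: "finite (\<phi> ` {a \<in> A. a = t \<or> (a, t) \<in> r})" if "A \<subseteq> P" for A t and \<phi> :: "'a \<Rightarrow> nat"
    using fin that by (auto intro: finite_subset)
  have round1: "extend_map P r (jumps P r \<psi>) (restrict \<psi> (jumps P r \<psi>)) = \<psi>"
    if \<psi>: "\<psi> \<in> weak_maps P r n" for \<psi>
  proof
    fix t
    show "extend_map P r (jumps P r \<psi>) (restrict \<psi> (jumps P r \<psi>)) t = \<psi> t"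
    proof (cases "t \<in> P")
      case True
      have "Max (insert 0 (restrict \<psi> (jumps P r \<psi>) ` {a \<in> jumps P r \<psi>. a = t \<or> (a, t) \<in> r})) = \<psi> t"
      proof (rule Max_eqI)
        show "finite (insert 0 (restrict \<psi> (jumps P r \<psi>) ` {a \<in> jumps P r \<psi>. a = t \<or> (a, t) \<in> r}))"
          using ext_le[of "jumps P r \<psi>"] by (auto simp: jumps_def)
        show "y \<le> \<psi> t" if "y \<in> insert 0 (restrict \<psi> (jumps P r \<psi>) ` {a \<in> jumps P r \<psi>. a = t \<or> (a, t) \<in> r})" for y
          using that \<psi> True by (auto simp: weak_maps_def jumps_def)
        show "\<psi> t \<in> insert 0 (restrict \<psi> (jumps P r \<psi>) ` {a \<in> jumps P r \<psi>. a = t \<or> (a, t) \<in> r})"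
          using jump_below[OF fin tr ir \<psi> True] by (cases "\<psi> t = 0") (force simp: image_iff)+
      qed
      then show ?thesis using True by (simp add: extend_map_def)
    next
      case False
      then show ?thesis using \<psi> by (auto simp: extend_map_def weak_maps_def PiE_def extensional_def)
    qed
  qed
  have ext_A: "extend_map P r A \<phi> t = \<phi> t"
    if A: "A \<subseteq> P" and \<phi>: "\<phi> \<in> strict_maps A r n" and t: "t \<in> A" for A \<phi> t
  proof -
    have "Max (insert 0 (\<phi> ` {a \<in> A. a = t \<or> (a, t) \<in> r})) = \<phi> t"
      by (rule Max_eqI) (use \<phi> t ext_le[OF A] in \<open>auto simp: strict_maps_def intro: less_imp_le\<close>)
    then show ?thesis using A t by (auto simp: extend_map_def)
  qed
  have ext_cases: "extend_map P r A \<phi> t = 0 \<or>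
      (\<exists>a\<in>A. (a = t \<or> (a, t) \<in> r) \<and> extend_map P r A \<phi> t = \<phi> a)" if A: "A \<subseteq> P" and t: "t \<in> P" for A \<phi> t
    using Max_in[of "insert 0 (\<phi> ` {a \<in> A. a = t \<or> (a, t) \<in> r})"] ext_le[OF A] t
    by (auto simp: extend_map_def)
  have ext_ge: "\<phi> a \<le> extend_map P r A \<phi> t"
    if A: "A \<subseteq> P" and t: "t \<in> P" and a: "a \<in> A" "a = t \<or> (a, t) \<in> r" for A \<phi> t a
    using Max_ge[of "insert 0 (\<phi> ` {a \<in> A. a = t \<or> (a, t) \<in> r})" "\<phi> a"] ext_le[OF A] t a
    by (auto simp: extend_map_def)
  have ext_weak: "extend_map P r A \<phi> \<in> weak_maps P r n"
    if A: "A \<subseteq> P" and \<phi>: "\<phi> \<in> strict_maps A r n" for A \<phi>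
  proof -
    have 1: "extend_map P r A \<phi> t \<le> n" if "t \<in> P" for t
      using ext_cases[OF A that, of \<phi>] \<phi> by (auto simp: strict_maps_def)
    have 2: "extend_map P r A \<phi> s \<le> extend_map P r A \<phi> t" if "s \<in> P" "t \<in> P" "(s, t) \<in> r" for s t
      using ext_cases[OF A that(1), of \<phi>] ext_ge[OF A that(2), of _ \<phi>] that tr
      by (metis le0 transD)
    show ?thesis using 1 2 by (auto simp: weak_maps_def extend_map_def)
  qed
  have jumps_ext: "jumps P r (extend_map P r A \<phi>) = A"
    if A: "A \<subseteq> P" and \<phi>: "\<phi> \<in> strict_maps A r n" for A \<phi>
  proof (intro equalityI subsetI)
    fix t assume t: "t \<in> jumps P r (extend_map P r A \<phi>)"
    then have tP: "t \<in> P" and pos: "0 < extend_map P r A \<phi> t" by (auto simp: jumps_def)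
    then obtain a where a: "a \<in> A" "a = t \<or> (a, t) \<in> r" "extend_map P r A \<phi> t = \<phi> a"
      using ext_cases[OF A tP, of \<phi>] by auto
    then show "t \<in> A"
      using t ext_A[OF A \<phi> a(1)] A by (force simp: jumps_def)
  next
    fix t assume t: "t \<in> A"
    then have tP: "t \<in> P" using A by auto
    have "0 < \<phi> t" using \<phi> t by (force simp: strict_maps_def)
    moreover have "extend_map P r A \<phi> s < \<phi> t" if s: "s \<in> P" "(s, t) \<in> r" for s
      using ext_cases[OF A s(1), of \<phi>]
    proof
      assume "\<exists>a\<in>A. (a = s \<or> (a, s) \<in> r) \<and> extend_map P r A \<phi> s = \<phi> a"
      then obtain a where a: "a \<in> A" "a = s \<or> (a, s) \<in> r" "extend_map P r A \<phi> s = \<phi> a" by auto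
      then have "(a, t) \<in> r" using s tr by (metis transD)
      then show ?thesis using a t \<phi> by (auto simp: strict_maps_def)
    qed (use calculation in auto)
    ultimately show "t \<in> jumps P r (extend_map P r A \<phi>)"
      using ext_A[OF A \<phi> t] tP by (simp add: jumps_def)
  qed
  show ?thesis
  proof (rule bij_betw_byWitness[where f' = "\<lambda>(A, \<phi>). extend_map P r A \<phi>"])
    show "\<forall>\<psi>\<in>weak_maps P r n. (\<lambda>(A, \<phi>). extend_map P r A \<phi>) (jumps P r \<psi>, restrict \<psi> (jumps P r \<psi>)) = \<psi>"
      using round1 by simp
    show "\<forall>A\<phi>\<in>SIGMA A:Pow P. strict_maps A r n.
        (jumps P r ((\<lambda>(A, \<phi>). extend_map P r A \<phi>) A\<phi>),
         restrict ((\<lambda>(A, \<phi>). extend_map P r A \<phi>) A\<phi>) (jumps P r ((\<lambda>(A, \<phi>). extend_map P r A \<phi>) A\<phi>))) = A\<phi>"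
    proof clarify
      fix A \<phi> assume A: "A \<subseteq> P" and \<phi>: "\<phi> \<in> strict_maps A r n"
      have "restrict (extend_map P r A \<phi>) A = \<phi>"
        using ext_A[OF A \<phi>] \<phi> by (auto simp: strict_maps_def PiE_def intro!: extensionalityI[of _ A])
      then show "jumps P r (extend_map P r A \<phi>) = A \<and>
          restrict (extend_map P r A \<phi>) (jumps P r (extend_map P r A \<phi>)) = \<phi>"
        by (simp add: jumps_ext[OF A \<phi>])
    qed
    show "(\<lambda>\<psi>. (jumps P r \<psi>, restrict \<psi> (jumps P r \<psi>))) ` weak_maps P r n \<subseteq> (SIGMA A:Pow P. strict_maps A r n)"
      by (auto simp: jumps_def weak_maps_def strict_maps_def PiE_iff Pi_iff Suc_le_eq)
    show "(\<lambda>(A, \<phi>). extend_map P r A \<phi>) ` (SIGMA A:Pow P. strict_maps A r n) \<subseteq> weak_maps P r n"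
      using ext_weak by auto
  qed
qed

lemma sum_weak_maps:
  fixes g :: "nat \<Rightarrow> 'b::comm_semiring_1"
  assumes fin: "finite P" and "trans r" and "irrefl r"
  shows "(\<Sum>\<psi>\<in>weak_maps P r n. g (card (jumps P r \<psi>))) =
         (\<Sum>A\<in>Pow P. of_nat (strict_order_poly A r n) * g (card A))"
proof -
  have fs: "finite (strict_maps A r n)" if "A \<subseteq> P" for A
    unfolding strict_maps_def
    by (rule finite_subset[of _ "A \<rightarrow>\<^sub>E {1..n}"]) (use fin that in \<open>auto intro: finite_PiE finite_subset\<close>)
  have "(\<Sum>\<psi>\<in>weak_maps P r n. g (card (jumps P r \<psi>))) =
        (\<Sum>x\<in>(SIGMA A:Pow P. strict_maps A r n). g (card (fst x)))"
    by (rule sum.reindex_bij_betw[OF bij_betw_weak_maps_strict_maps[OF assms], of "\<lambda>x. g (card (fst x))", simplified])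
  also have "\<dots> = (\<Sum>A\<in>Pow P. \<Sum>\<phi>\<in>strict_maps A r n. g (card A))"
    using fin fs by (subst sum.Sigma) (auto simp: split_def)
  also have "\<dots> = (\<Sum>A\<in>Pow P. of_nat (strict_order_poly A r n) * g (card A))"
    by (simp add: strict_maps_def strict_order_poly_def)
  finally show ?thesis .
qed

section \<open>Perfect matchings of a path\<close>

text \<open>
  In a path with vertices \<open>a..b\<close>, \<open>C\<close> is the set of removed vertices; those of the
  parity of \<open>a\<close> are counted positively up to \<open>p\<close>, the others negatively.
\<close>

definition excess :: "int \<Rightarrow> int set \<Rightarrow> int \<Rightarrow> int" where
  "excess a C p = int (card {q \<in> C. q \<le> p \<and> even (q - a)}) - int (card {q \<in> C. q \<le> p \<and> odd (q - a)})"

text \<open>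
  An edge is represented by its left end: \<open>p \<in> E\<close> stands for the edge between \<open>p\<close> and
  \<open>p + 1\<close>. Every vertex is either removed or matched by exactly one edge.
\<close>

definition path_matching :: "int \<Rightarrow> int \<Rightarrow> int set \<Rightarrow> int set \<Rightarrow> bool" where
  "path_matching a b C E \<longleftrightarrow> E \<subseteq> {a..<b} \<and>
     (\<forall>p\<in>{a..b}. of_bool (p \<in> C) + of_bool (p \<in> E) + of_bool (p - 1 \<in> E) = (1 :: nat))"

definition path_edges :: "int \<Rightarrow> int \<Rightarrow> int set \<Rightarrow> int set" where
  "path_edges a b C = {p \<in> {a..<b}. excess a C p = (if even (p - a) then 0 else 1)}"

lemma excess_step:
  assumes "finite C"
  shows "excess a C p = excess a C (p - 1) + (if p \<in> C then if even (p - a) then 1 else - 1 else 0)"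
proof -
  have "{q \<in> C. q \<le> p \<and> even (q - a)} =
      (if p \<in> C \<and> even (p - a) then insert p {q \<in> C. q \<le> p - 1 \<and> even (q - a)}
       else {q \<in> C. q \<le> p - 1 \<and> even (q - a)})" (is "_ = ?A")
    by (auto simp: order_le_less split: if_splits)
  moreover have "{q \<in> C. q \<le> p \<and> odd (q - a)} =
      (if p \<in> C \<and> odd (p - a) then insert p {q \<in> C. q \<le> p - 1 \<and> odd (q - a)}
       else {q \<in> C. q \<le> p - 1 \<and> odd (q - a)})" (is "_ = ?B")
    by (auto simp: order_le_less split: if_splits)
  ultimately have "excess a C p = int (card ?A) - int (card ?B)"
    unfolding excess_def by simp
  then show ?thesis
    using assms by (simp add: excess_def card_insert_if)
qed

lemma excess_before:
  assumes "C \<subseteq> {a..b}" and "p < a"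
  shows "excess a C p = 0"
proof -
  have "{q \<in> C. q \<le> p \<and> even (q - a)} = {}" "{q \<in> C. q \<le> p \<and> odd (q - a)} = {}"
    using assms by auto
  then show ?thesis by (simp only: excess_def card.empty)
qed

lemma excess_after:
  assumes "C \<subseteq> {a..b}" and "b \<le> p"
  shows "excess a C p = excess a C b"
proof -
  have "{q \<in> C. q \<le> p \<and> even (q - a)} = {q \<in> C. q \<le> b \<and> even (q - a)}"
    "{q \<in> C. q \<le> p \<and> odd (q - a)} = {q \<in> C. q \<le> b \<and> odd (q - a)}"
    using assms by auto
  then show ?thesis by (simp only: excess_def)
qed

text \<open>
  Going from left to right, whether the edge at \<open>p\<close> is used is decided by the edge at
  \<open>p - 1\<close> and by whether \<open>p\<close> is removed, and this recursion is the one of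
  \<open>excess\<close>: an edge at a position of the parity of \<open>a\<close> is used iff the excess there is 0,
  an edge at any other position iff the excess is 1. That the excess stays in \<open>{0, 1}\<close> says
  that removed vertices alternate in parity and begin with the parity of \<open>a\<close>; its value at
  \<open>b\<close> says that they end with the parity of \<open>b\<close>.
\<close>

lemma path_matching_iff:
  assumes C: "C \<subseteq> {a..b}" and ab: "a \<le> b"
  shows "path_matching a b C E \<longleftrightarrow>
    (\<forall>p. excess a C p \<in> {0, 1}) \<and> excess a C b = (if even (b - a) then 1 else 0) \<and>
    E = path_edges a b C"
proof
  have fin: "finite C" using C finite_subset by blast
  assume pm: "path_matching a b C E"
  have E: "E \<subseteq> {a..<b}" using pm by (simp add: path_matching_def)
  have exact: "of_bool (p \<in> C) + of_bool (p \<in> E) + of_bool (p - 1 \<in> E) = (1 :: nat)"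
    if "p \<in> {a..b}" for p
    using pm that by (simp add: path_matching_def)
  have key: "of_bool (p \<in> E) = (if even (p - a) then 1 - excess a C p else excess a C p)"
    if "a - 1 \<le> p" "p \<le> b" for p
    using that
  proof (induction p rule: int_ge_induct)
    case base
    then show ?case using E excess_before[OF C, of "a - 1"] by auto
  next
    case (step p)
    have "of_bool (p + 1 \<in> C) + of_bool (p + 1 \<in> E) + of_bool (p \<in> E) = (1 :: nat)"
      using exact[of "p + 1"] step by simp
    then show ?case
      using step excess_step[OF fin, of a "p + 1"] by (auto simp: of_bool_def split: if_splits)
  qed
  have "excess a C p \<in> {0, 1}" if "a - 1 \<le> p" "p \<le> b" for p
    using key[OF that] by (auto simp: of_bool_def split: if_splits)
  note within = this
  have "excess a C p \<in> {0, 1}" for p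
  proof (cases "p < a \<or> p \<le> b")
    case True
    then show ?thesis using excess_before[OF C, of p] within[of p] by (cases "p < a") auto
  next
    case False
    then have "excess a C p = excess a C b" by (intro excess_after[OF C]) simp
    then show ?thesis using within[of b] ab by simp
  qed
  moreover have "excess a C b = (if even (b - a) then 1 else 0)"
    using key[of b] E ab by (auto simp: of_bool_def split: if_splits)
  moreover have "E = path_edges a b C"
  proof -
    have "p \<in> E \<longleftrightarrow> excess a C p = (if even (p - a) then 0 else 1)" if "p \<in> {a..<b}" for p
      using key[of p] that by (cases "p \<in> E") auto
    then show ?thesis using E unfolding path_edges_def by blast
  qed
  ultimately show "(\<forall>p. excess a C p \<in> {0, 1}) \<and> excess a C b = (if even (b - a) then 1 else 0) \<and>
    E = path_edges a b C" by blast
next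
  have fin: "finite C" using C finite_subset by blast
  assume asm: "(\<forall>p. excess a C p \<in> {0, 1}) \<and> excess a C b = (if even (b - a) then 1 else 0) \<and>
    E = path_edges a b C"
  then have end_b: "excess a C b = (if even (b - a) then 1 else 0)"
    and E: "E = path_edges a b C"
    by blast+
  have exc: "excess a C p = 0 \<or> excess a C p = 1" for p using asm by blast
  have key: "of_bool (p \<in> E) = (if even (p - a) then 1 - excess a C p else excess a C p)"
    if p: "a - 1 \<le> p" "p \<le> b" for p
  proof -
    consider "p = a - 1" | "p = b" | "p \<in> {a..<b}" using p by force
    then show ?thesis
    proof cases
      case 1
      then show ?thesis using excess_before[OF C, of "a - 1"] by (simp add: E path_edges_def)
    next
      case 2
      then show ?thesis using end_b by (simp add: E path_edges_def)
    next
      case 3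
      then show ?thesis using exc[of p] by (auto simp add: E path_edges_def)
    qed
  qed
  have "of_bool (p \<in> C) + of_bool (p \<in> E) + of_bool (p - 1 \<in> E) = (1 :: int)" if "p \<in> {a..b}" for p
  proof -
    have "of_bool (p \<in> E) = (if even (p - a) then 1 - excess a C p else excess a C p)"
      using key[of p] that by simp
    moreover have "of_bool (p - 1 \<in> E) = (if even (p - a) then excess a C (p - 1) else 1 - excess a C (p - 1))"
      using key[of "p - 1"] that by simp
    ultimately show ?thesis
      using excess_step[OF fin, of a p] by simp
  qed
  note sum1 = this
  have "of_bool (p \<in> C) + of_bool (p \<in> E) + of_bool (p - 1 \<in> E) = (1 :: nat)" if "p \<in> {a..b}" for p
    using sum1[OF that] by (auto simp: of_bool_def split: if_splits)
  then show "path_matching a b C E"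
    using asm by (auto simp: path_matching_def path_edges_def)
qed

section \<open>Six-cycles of the hexagonal lattice\<close>

definition hex_verts :: "hexagon \<Rightarrow> vertex set" where
  "hex_verts h = \<Union> (hexagon_edges h)"

fun neighbours :: "vertex \<Rightarrow> vertex set" where
  "neighbours (Upper r p) = {Lower r p, Lower (r - 1) (p - 1), Lower (r - 1) (p + 1)}"
| "neighbours (Lower r p) = {Upper r p, Upper (r + 1) (p - 1), Upper (r + 1) (p + 1)}"

lemma hex_verts_eq:
  "hex_verts (r, x) = {Upper r (x - 1), Lower r (x - 1), Upper r (x + 1), Lower r (x + 1),
     Lower (r - 1) x, Upper (r + 1) x}"
  by (auto simp: hex_verts_def hexagon_edges_def)

lemma neighbours_if_edge: "{u, v} \<in> hexagon_edges h \<Longrightarrow> v \<in> neighbours u"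
  by (cases h) (auto simp: hexagon_edges_def doubleton_eq_iff)

text \<open>
  A vertex \<open>Upper r p\<close> lies on three hexagons, one for each pair of its neighbours. The
  number \<open>e\<close> covers the hexagon to the right (1) and the one to the left (-1) at once;
  \<open>lattice_six_cycle_top\<close> is the case of the hexagon above.
\<close>

lemma lattice_six_cycle_sym:
  assumes e: "e = 1 \<or> e = (-1 :: int)"
    and "distinct [Upper r p, Lower r p, u2, u3, u4, Lower (r - 1) (p + e)]"
    and u2: "u2 \<in> neighbours (Lower r p)" and "u3 \<in> neighbours u2"
    and u4: "u4 \<in> neighbours (Lower (r - 1) (p + e))" and "u3 \<in> neighbours u4"
  shows "u2 = Upper (r + 1) (p + e) \<and> u3 = Lower r (p + 2 * e) \<and> u4 = Upper r (p + 2 * e)"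
proof -
  have u2: "u2 = Upper (r + 1) (p - 1) \<or> u2 = Upper (r + 1) (p + 1)" using assms by auto
  have u4: "u4 = Upper (r - 1) (p + e) \<or> u4 = Upper r (p + 2 * e)" using assms by auto
  show ?thesis using assms(1,2,4,6) u2 u4
    by (elim disjE) auto
qed

lemma lattice_six_cycle_top:
  assumes "distinct [Upper r p, Lower (r - 1) (p - 1), u2, u3, u4, Lower (r - 1) (p + 1)]"
    and u2: "u2 \<in> neighbours (Lower (r - 1) (p - 1))" and "u3 \<in> neighbours u2"
    and u4: "u4 \<in> neighbours (Lower (r - 1) (p + 1))" and "u3 \<in> neighbours u4"
  shows "u2 = Upper (r - 1) (p - 1) \<and> u3 = Lower (r - 2) p \<and> u4 = Upper (r - 1) (p + 1)"
proof -
  have u2: "u2 = Upper r (p - 2) \<or> u2 = Upper (r - 1) (p - 1)" using assms by auto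
  have u4: "u4 = Upper (r - 1) (p + 1) \<or> u4 = Upper r (p + 2)" using assms by auto
  show ?thesis using assms(1,3,5) u2 u4
    by (elim disjE) auto
qed

lemma lattice_six_cycle_upper:
  assumes dist: "distinct [Upper r p, u1, u2, u3, u4, u5]"
    and nb: "u1 \<in> neighbours (Upper r p)" "u2 \<in> neighbours u1" "u3 \<in> neighbours u2"
      "u3 \<in> neighbours u4" "u4 \<in> neighbours u5" "u5 \<in> neighbours (Upper r p)"
  shows "\<exists>h. {{Upper r p, u1}, {u1, u2}, {u2, u3}, {u3, u4}, {u4, u5}, {u5, Upper r p}} = hexagon_edges h"
proof -
  have dist': "distinct [Upper r p, u5, u4, u3, u2, u1]" using dist by auto
  have "(u1 = Lower r p \<or> u1 = Lower (r - 1) (p + -1) \<or> u1 = Lower (r - 1) (p + 1)) \<and>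
        (u5 = Lower r p \<or> u5 = Lower (r - 1) (p + -1) \<or> u5 = Lower (r - 1) (p + 1)) \<and> u1 \<noteq> u5"
    using dist nb by auto
  then consider
      (R) e where "e = 1 \<or> e = (-1 :: int)" "u1 = Lower r p" "u5 = Lower (r - 1) (p + e)"
    | (L) e where "e = 1 \<or> e = (-1 :: int)" "u5 = Lower r p" "u1 = Lower (r - 1) (p + e)"
    | (T) "u1 = Lower (r - 1) (p - 1)" "u5 = Lower (r - 1) (p + 1)"
    | (U) "u5 = Lower (r - 1) (p - 1)" "u1 = Lower (r - 1) (p + 1)"
    by force
  then show ?thesis
  proof cases
    case R
    have "u2 = Upper (r + 1) (p + e) \<and> u3 = Lower r (p + 2 * e) \<and> u4 = Upper r (p + 2 * e)"
      by (rule lattice_six_cycle_sym[of e r p u2 u3 u4, folded R(2,3), OF R(1) dist nb(2,3,5,4)])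
    then have "{{Upper r p, u1}, {u1, u2}, {u2, u3}, {u3, u4}, {u4, u5}, {u5, Upper r p}} = hexagon_edges (r, p + e)"
      using R by (elim disjE) (simp_all add: hexagon_edges_def insert_commute add.commute)
    then show ?thesis by blast
  next
    case L
    have "u4 = Upper (r + 1) (p + e) \<and> u3 = Lower r (p + 2 * e) \<and> u2 = Upper r (p + 2 * e)"
      by (rule lattice_six_cycle_sym[of e r p u4 u3 u2, folded L(2,3), OF L(1) dist' nb(5,4,2,3)])
    then have "{{Upper r p, u1}, {u1, u2}, {u2, u3}, {u3, u4}, {u4, u5}, {u5, Upper r p}} = hexagon_edges (r, p + e)"
      using L by (elim disjE) (simp_all add: hexagon_edges_def insert_commute add.commute)
    then show ?thesis by blast
  next
    case T
    have "u2 = Upper (r - 1) (p - 1) \<and> u3 = Lower (r - 2) p \<and> u4 = Upper (r - 1) (p + 1)"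
      by (rule lattice_six_cycle_top[of r p u2 u3 u4, folded T, OF dist nb(2,3,5,4)])
    then have "{{Upper r p, u1}, {u1, u2}, {u2, u3}, {u3, u4}, {u4, u5}, {u5, Upper r p}} = hexagon_edges (r - 1, p)"
      using T by (simp add: hexagon_edges_def insert_commute add.commute)
    then show ?thesis by blast
  next
    case U
    have "u4 = Upper (r - 1) (p - 1) \<and> u3 = Lower (r - 2) p \<and> u2 = Upper (r - 1) (p + 1)"
      by (rule lattice_six_cycle_top[of r p u4 u3 u2, folded U, OF dist' nb(5,4,2,3)])
    then have "{{Upper r p, u1}, {u1, u2}, {u2, u3}, {u3, u4}, {u4, u5}, {u5, Upper r p}} = hexagon_edges (r - 1, p)"
      using U by (simp add: hexagon_edges_def insert_commute add.commute)
    then show ?thesis by blast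
  qed
qed

lemma neighbours_sym: "v \<in> neighbours u \<longleftrightarrow> u \<in> neighbours v"
  by (cases u; cases v) auto

lemma lattice_six_cycle:
  assumes dist: "distinct [u0, u1, u2, u3, u4, u5]"
    and nb: "u1 \<in> neighbours u0" "u2 \<in> neighbours u1" "u3 \<in> neighbours u2"
      "u4 \<in> neighbours u3" "u5 \<in> neighbours u4" "u0 \<in> neighbours u5"
  shows "\<exists>h. {{u0, u1}, {u1, u2}, {u2, u3}, {u3, u4}, {u4, u5}, {u5, u0}} = hexagon_edges h"
proof (cases u0)
  case (Upper r p)
  then show ?thesis
    using lattice_six_cycle_upper[of r p u1 u2 u3 u4 u5] dist nb neighbours_sym by blast
next
  case (Lower r p)
  then obtain r' p' where u1: "u1 = Upper r' p'" using nb(1) by auto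
  have "\<exists>h. {{u1, u2}, {u2, u3}, {u3, u4}, {u4, u5}, {u5, u0}, {u0, u1}} = hexagon_edges h"
    unfolding u1
    by (rule lattice_six_cycle_upper) (use dist nb neighbours_sym u1 in auto)
  then show ?thesis by (metis insert_commute)
qed

lemma edges_C6: "edges C6 = {{0, 1}, {1, 2}, {2, 3}, {3, 4}, {4, 5}, {5, 0}}"
proof -
  have "edges C6 = (\<lambda>i. {i, (i + 1) mod 6}) ` {..<6}"
    by (auto simp: C6_def)
  moreover have "{..<6} = {0, 1, 2, 3, 4, 5 :: nat}" by auto
  ultimately show ?thesis by (simp del: One_nat_def)
qed

text \<open>
  The only six-cycles of the hexagonal lattice are the boundaries of hexagons, so a component of
  type \<open>C6\<close> of a Clar cover is a hexagon.
\<close>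

lemma hexagon_if_graph_iso_C6:
  assumes iso: "graph_iso X C6" and wf: "\<And>e. e \<in> edges X \<Longrightarrow> e \<subseteq> verts X"
    and lat: "edges X \<subseteq> \<Union> (range hexagon_edges)"
  shows "\<exists>h. X = (hex_verts h, hexagon_edges h)"
proof -
  obtain f where f: "bij_betw f (verts X) {..<6}" and fE: "(\<lambda>e. f ` e) ` edges X = edges C6"
    using iso by (auto simp: graph_iso_def C6_def)
  define u where "u = inv_into (verts X) f"
  have u: "bij_betw u {..<6} (verts X)" unfolding u_def by (rule bij_betw_inv_into[OF f])
  have uf: "u ` f ` e = e" if "e \<subseteq> verts X" for e
    unfolding u_def using that f by (simp add: bij_betw_def inv_into_image_cancel)
  have "edges X = (\<lambda>e. u ` e) ` edges C6"
    unfolding fE[symmetric] using uf wf by (force simp: image_image)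
  then have E: "edges X = {{u 0, u 1}, {u 1, u 2}, {u 2, u 3}, {u 3, u 4}, {u 4, u 5}, {u 5, u 0}}"
    unfolding edges_C6 by simp
  have six: "{..<6} = {0, 1, 2, 3, 4, 5 :: nat}" by auto
  have inj: "inj_on u {0, 1, 2, 3, 4, 5}" and V: "verts X = {u 0, u 1, u 2, u 3, u 4, u 5}"
    using u unfolding six by (auto simp: bij_betw_def)
  have "v \<in> neighbours w" if "{w, v} \<in> edges X" for v w
    using that lat neighbours_if_edge by blast
  then have "\<exists>h. {{u 0, u 1}, {u 1, u 2}, {u 2, u 3}, {u 3, u 4}, {u 4, u 5}, {u 5, u 0}} = hexagon_edges h"
    by (intro lattice_six_cycle) (use inj in \<open>auto simp: inj_on_def E\<close>)
  then obtain h where h: "edges X = hexagon_edges h" using E by auto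
  have "verts X = \<Union> (edges X)" unfolding E V by auto
  then show ?thesis using h by (metis hex_verts_def prod.collapse)
qed

lemma graph_iso_C6_hexagon: "graph_iso (hex_verts h, hexagon_edges h) C6"
proof (cases h)
  case (Pair r x)
  define f where "f = (\<lambda>_. 0 :: nat)(Lower (r - 1) x := 1, Upper r (x + 1) := 2, Lower r (x + 1) := 3,
    Upper (r + 1) x := 4, Lower r (x - 1) := 5)"
  have six: "{..<6} = {0, 1, 2, 3, 4, 5 :: nat}" by auto
  have "bij_betw f (hex_verts h) {..<6}"
    by (auto simp: bij_betw_def inj_on_def Pair hex_verts_eq six f_def)
  moreover have "(\<lambda>e. f ` e) ` hexagon_edges h = edges C6"
    unfolding edges_C6 by (auto simp: Pair hexagon_edges_def f_def insert_commute)
  ultimately show ?thesis by (auto simp: graph_iso_def C6_def)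
qed

lemma graph_iso_K2_iff:
  assumes wf: "\<And>e. e \<in> edges X \<Longrightarrow> e \<subseteq> verts X"
  shows "graph_iso X K2 \<longleftrightarrow> (\<exists>e. card e = 2 \<and> X = (e, {e}))"
proof
  assume "graph_iso X K2"
  then obtain f where f: "bij_betw f (verts X) {0, 1}" and fE: "(\<lambda>e. f ` e) ` edges X = {{0, 1 :: nat}}"
    by (auto simp: graph_iso_def K2_def)
  have "e = verts X" if "e \<in> edges X" for e
  proof -
    have "f ` e \<in> {{0, 1}}" unfolding fE[symmetric] using that by (rule imageI)
    then have "f ` e = f ` verts X" using f by (simp add: bij_betw_def)
    then show ?thesis
      using inj_on_image_eq_iff[of f "verts X" e "verts X"] f wf[OF that] by (simp add: bij_betw_def)
  qed
  moreover have "edges X \<noteq> {}" using fE by (metis image_is_empty insert_not_empty)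
  ultimately have "edges X = {verts X}" by blast
  moreover have "card (verts X) = 2" using bij_betw_same_card[OF f] by simp
  ultimately show "\<exists>e. card e = 2 \<and> X = (e, {e})" by (metis prod.collapse)
next
  assume "\<exists>e. card e = 2 \<and> X = (e, {e})"
  then obtain u v where uv: "u \<noteq> v" "X = ({u, v}, {{u, v}})" by (auto simp: card_2_iff)
  have "bij_betw (\<lambda>z. if z = u then 0 else 1 :: nat) {u, v} {0, 1}"
    using uv(1) by (auto simp: bij_betw_def)
  then show "graph_iso X K2"
    using uv by (auto simp: graph_iso_def K2_def)
qed

section \<open>Clar covers as exact covers by edges and hexagons\<close>

text \<open>
  The components of a disjoint union of connected graphs are these graphs. It is applied to the
  edges and hexagons of a Clar cover.
\<close>

lemma connected_components_disjoint_union: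
  assumes edge: "\<And>X e. X \<in> P \<Longrightarrow> e \<in> edges X \<Longrightarrow> e \<subseteq> verts X \<and> e \<noteq> {}"
    and conn: "\<And>X u v. X \<in> P \<Longrightarrow> u \<in> verts X \<Longrightarrow> v \<in> verts X \<Longrightarrow> (u, v) \<in> {(x, y). {x, y} \<in> edges X}\<^sup>*"
    and disj: "\<And>X Y v. X \<in> P \<Longrightarrow> Y \<in> P \<Longrightarrow> v \<in> verts X \<Longrightarrow> v \<in> verts Y \<Longrightarrow> X = Y"
    and nonempty: "\<And>X. X \<in> P \<Longrightarrow> verts X \<noteq> {}"
  shows "connected_components (\<Union> (verts ` P), \<Union> (edges ` P)) = P"
proof -
  let ?G = "(\<Union> (verts ` P), \<Union> (edges ` P))"
  have comp: "connected_component ?G v = X" if X: "X \<in> P" and v: "v \<in> verts X" for X v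
  proof -
    have sub: "{(x, y). {x, y} \<in> edges X} \<subseteq> {(x, y). {x, y} \<in> edges ?G}"
      using X by auto
    have "w \<in> verts X" if "(v, w) \<in> {(x, y). {x, y} \<in> edges ?G}\<^sup>*" for w
      using that
    proof induction
      case base
      show ?case by (rule v)
    next
      case (step y z)
      then obtain Y where Y: "Y \<in> P" "{y, z} \<in> edges Y" by auto
      with edge have "y \<in> verts Y" "z \<in> verts Y" by blast+
      then show ?case using disj[OF X Y(1)] step by blast
    qed
    moreover have "(v, w) \<in> {(x, y). {x, y} \<in> edges ?G}\<^sup>*" if "w \<in> verts X" for w
      using conn[OF X v that] rtrancl_mono[OF sub] by blast
    ultimately have W: "{w. (v, w) \<in> {(x, y). {x, y} \<in> edges ?G}\<^sup>*} = verts X" by blast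
    have "{e \<in> edges ?G. e \<subseteq> verts X} = edges X"
    proof (intro equalityI subsetI)
      fix e assume "e \<in> {e \<in> edges ?G. e \<subseteq> verts X}"
      then obtain Y where Y: "Y \<in> P" "e \<in> edges Y" and e: "e \<subseteq> verts X" by auto
      then obtain y where "y \<in> e" "y \<in> verts Y" using edge[OF Y] by blast
      then show "e \<in> edges X" using disj[OF X Y(1)] Y e by blast
    qed (use X edge in auto)
    then show ?thesis
      unfolding connected_component_def Let_def W by (metis prod.collapse)
  qed
  show ?thesis
  proof (intro equalityI subsetI)
    fix X assume "X \<in> connected_components ?G"
    then show "X \<in> P" using comp by (auto simp: connected_components_def)
  next
    fix X assume X: "X \<in> P"
    then obtain v where v: "v \<in> verts X" using nonempty by blast
    then have "v \<in> verts ?G" using X by auto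
    then show "X \<in> connected_components ?G"
      using comp[OF X v] unfolding connected_components_def by (metis imageI)
  qed
qed

lemma connected_component_subset:
  assumes "\<Union> (edges G) \<subseteq> verts G" and "v \<in> verts G"
  shows "verts (connected_component G v) \<subseteq> verts G"
proof -
  have "w \<in> verts G" if "(v, w) \<in> {(x, y). {x, y} \<in> edges G}\<^sup>*" for w
    using that by induction (use assms in auto)
  then show ?thesis by (auto simp: connected_component_def Let_def)
qed

lemma self_in_connected_component: "v \<in> verts (connected_component G v)"
  by (simp add: connected_component_def Let_def)

lemma connected_component_eq:
  assumes "w \<in> verts (connected_component G v)"
  shows "connected_component G w = connected_component G v"
proof -
  let ?R = "{(x, y). {x, y} \<in> edges G}"
  have "sym ?R" by (auto simp: sym_def insert_commute)
  then have "sym (?R\<^sup>*)" by (rule sym_rtrancl)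
  moreover have "(v, w) \<in> ?R\<^sup>*"
    using assms by (simp add: connected_component_def Let_def)
  ultimately have "{x. (w, x) \<in> ?R\<^sup>*} = {x. (v, x) \<in> ?R\<^sup>*}"
    by (auto dest: symD intro: rtrancl_trans)
  then show ?thesis by (simp add: connected_component_def Let_def)
qed

lemma card_hexagon_edge: "e \<in> hexagon_edges h \<Longrightarrow> card e = 2"
  by (cases h) (auto simp: hexagon_edges_def)

lemma card_edge_hex_graph: "e \<in> edges (hex_graph S) \<Longrightarrow> card e = 2"
  by (auto simp: hex_graph_def card_hexagon_edge)

lemma card_hex_verts: "card (hex_verts h) = 6"
  by (cases h) (simp add: hex_verts_eq)

lemma inj_hex_verts: "inj hex_verts"
proof (rule injI)
  fix h h' assume eq: "hex_verts h = hex_verts h'"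
  obtain r x r' x' where h: "h = (r, x)" "h' = (r', x')" by (cases h; cases h')
  have "Lower (r - 1) x \<in> hex_verts h'" "Upper (r + 1) x \<in> hex_verts h'" "Lower r (x - 1) \<in> hex_verts h'"
    unfolding eq[symmetric] by (simp_all add: h hex_verts_eq)
  then show "h = h'" by (auto simp: h hex_verts_eq)
qed

text \<open>
  A Clar cover, seen as the set \<open>M\<close> of its isolated edges and the set \<open>T\<close> of its
  hexagons. For \<open>T = {}\<close> this is a perfect matching.
\<close>

definition exact_cover :: "hexagon set \<Rightarrow> vertex set set \<Rightarrow> hexagon set \<Rightarrow> bool" where
  "exact_cover S M T \<longleftrightarrow> M \<subseteq> edges (hex_graph S) \<and> T \<subseteq> S \<and>
     partition_on (verts (hex_graph S)) (M \<union> hex_verts ` T)"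

definition cover_graph :: "hexagon set \<Rightarrow> vertex set set \<Rightarrow> hexagon set \<Rightarrow> vertex graph" where
  "cover_graph S M T = (verts (hex_graph S), M \<union> \<Union> (hexagon_edges ` T))"

lemma hexagon_connected:
  assumes "u \<in> hex_verts h" "v \<in> hex_verts h"
  shows "(u, v) \<in> {(x, y). {x, y} \<in> hexagon_edges h}\<^sup>*"
proof -
  let ?R = "{(x, y). {x, y} \<in> hexagon_edges h}"
  obtain r x where h: "h = (r, x)" by (cases h)
  have "sym ?R" by (auto simp: sym_def insert_commute)
  then have sym: "sym (?R\<^sup>*)" by (rule sym_rtrancl)
  let ?t = "Upper r (x - 1)"
  have 1: "(?t, Lower (r - 1) x) \<in> ?R\<^sup>*" "(?t, Lower r (x - 1)) \<in> ?R\<^sup>*"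
    by (auto simp: h hexagon_edges_def)
  have "(Lower (r - 1) x, Upper r (x + 1)) \<in> ?R" "(Lower r (x - 1), Upper (r + 1) x) \<in> ?R"
    by (auto simp: h hexagon_edges_def)
  with 1 have 2: "(?t, Upper r (x + 1)) \<in> ?R\<^sup>*" "(?t, Upper (r + 1) x) \<in> ?R\<^sup>*"
    by (meson rtrancl.rtrancl_into_rtrancl)+
  have "(Upper r (x + 1), Lower r (x + 1)) \<in> ?R"
    by (auto simp: h hexagon_edges_def)
  with 2 have 3: "(?t, Lower r (x + 1)) \<in> ?R\<^sup>*"
    by (meson rtrancl.rtrancl_into_rtrancl)
  have "(?t, w) \<in> ?R\<^sup>*" if "w \<in> hex_verts h" for w
    using that 1 2 3 by (auto simp: h hex_verts_eq)
  then show ?thesis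
    using assms sym by (meson rtrancl_trans symD)
qed

lemma connected_components_cover_graph:
  assumes ec: "exact_cover S M T"
  shows "connected_components (cover_graph S M T) =
    (\<lambda>e. (e, {e})) ` M \<union> (\<lambda>h. (hex_verts h, hexagon_edges h)) ` T" (is "_ = ?P")
proof -
  have part: "partition_on (verts (hex_graph S)) (M \<union> hex_verts ` T)"
    using ec by (simp add: exact_cover_def)
  have card2: "card e = 2" if "e \<in> M" for e
    using ec that card_edge_hex_graph by (auto simp: exact_cover_def)
  have V: "\<Union> (verts ` ?P) = verts (hex_graph S)"
    using partition_onD1[OF part] by (simp add: image_Un image_image)
  have E: "\<Union> (edges ` ?P) = M \<union> \<Union> (hexagon_edges ` T)"
    by (auto simp: image_Un image_image)
  have "connected_components (\<Union> (verts ` ?P), \<Union> (edges ` ?P)) = ?P"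
  proof (rule connected_components_disjoint_union)
    show "e \<subseteq> verts X \<and> e \<noteq> {}" if "X \<in> ?P" "e \<in> edges X" for X e
      using that card2 card_hexagon_edge by (force simp: hex_verts_def)
    show "(u, v) \<in> {(x, y). {x, y} \<in> edges X}\<^sup>*" if X: "X \<in> ?P" and uv: "u \<in> verts X" "v \<in> verts X" for X u v
    proof (cases "X \<in> (\<lambda>e. (e, {e})) ` M")
      case True
      then obtain e where e: "X = (e, {e})" "card e = 2" using card2 by auto
      then show ?thesis using uv
        by (cases "u = v") (auto simp: card_2_iff insert_commute doubleton_eq_iff)
    next
      case False
      then show ?thesis using X uv hexagon_connected by auto
    qed
    have mem: "verts X \<in> M \<union> hex_verts ` T" if "X \<in> ?P" for X
      using that by auto
    show "verts X \<noteq> {}" if "X \<in> ?P" for X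
    proof
      assume "verts X = {}"
      then show False using mem[OF that] partition_onD3[OF part] by argo
    qed
    fix X Y v assume X: "X \<in> ?P" and Y: "Y \<in> ?P" and v: "v \<in> verts X" "v \<in> verts Y"
    have eq: "verts X = verts Y"
      using partition_onD2[OF part] mem[OF X] mem[OF Y] v unfolding disjoint_def by blast
    have ne: "hex_verts h \<notin> M" for h using card2[of "hex_verts h"] card_hex_verts[of h] by auto
    show "X = Y"
      using X Y eq ne by (elim UnE imageE) (simp_all add: inj_eq[OF inj_hex_verts], metis+)
  qed
  then show ?thesis unfolding V E cover_graph_def .
qed

text \<open>
  The components partition the vertices, and each of them is an edge or a six-cycle, hence a
  hexagon. The assumption on \<open>S\<close> excludes a hexagonal hole: a hexagon whose edges
  all belong to hexagons of \<open>S\<close> without being in \<open>S\<close> itself.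
\<close>

lemma exact_cover_if_clar_cover:
  assumes hexes: "\<And>h. hexagon_edges h \<subseteq> edges (hex_graph S) \<Longrightarrow> h \<in> S"
    and cc: "clar_cover S C"
  shows "\<exists>M T. exact_cover S M T \<and> C = cover_graph S M T"
proof -
  have V: "verts C = verts (hex_graph S)" and E: "edges C \<subseteq> edges (hex_graph S)"
    and type: "\<And>X. X \<in> connected_components C \<Longrightarrow> graph_iso X K2 \<or> graph_iso X C6"
    using cc by (auto simp: clar_cover_def spanning_subgraph_def)
  have EV: "\<Union> (edges C) \<subseteq> verts C"
    unfolding V using E by (auto simp: hex_graph_def)
  define M where "M = {e. (e, {e}) \<in> connected_components C}"
  define T where "T = {h. (hex_verts h, hexagon_edges h) \<in> connected_components C}"
  have wf: "e \<subseteq> verts X"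
    if "X \<in> connected_components C" "e \<in> edges X" for X e
    using that by (auto simp: connected_components_def connected_component_def Let_def)
  have sub: "edges X \<subseteq> edges C" if "X \<in> connected_components C" for X
    using that by (auto simp: connected_components_def connected_component_def Let_def)
  have lattice: "edges C \<subseteq> \<Union> (range hexagon_edges)"
    using E by (auto simp: hex_graph_def)
  have comps: "X \<in> (\<lambda>e. (e, {e})) ` M \<union> (\<lambda>h. (hex_verts h, hexagon_edges h)) ` T"
    if X: "X \<in> connected_components C" for X
    using type[OF X]
  proof
    assume "graph_iso X K2"
    then show ?thesis using graph_iso_K2_iff[of X] wf[OF X] X by (auto simp: M_def)
  next
    assume "graph_iso X C6"
    then obtain h where "X = (hex_verts h, hexagon_edges h)"
      using hexagon_if_graph_iso_C6[of X] wf[OF X] sub[OF X] lattice by blast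
    then show ?thesis using X by (auto simp: T_def)
  qed
  have PV: "M \<union> hex_verts ` T = verts ` connected_components C"
  proof
    show "M \<union> hex_verts ` T \<subseteq> verts ` connected_components C"
      by (auto simp: M_def T_def image_iff) (metis fst_conv)+
    show "verts ` connected_components C \<subseteq> M \<union> hex_verts ` T"
      using comps by fastforce
  qed
  have comps_img: "verts ` connected_components C = (\<lambda>v. verts (connected_component C v)) ` verts C"
    by (simp add: connected_components_def image_image)
  have "partition_on (verts C) (M \<union> hex_verts ` T)"
    unfolding PV comps_img
  proof (rule partition_onI)
    show "(\<Union>v\<in>verts C. verts (connected_component C v)) = verts C"
      using connected_component_subset[OF EV] self_in_connected_component[of _ C] by blast
    show "{} \<notin> (\<lambda>v. verts (connected_component C v)) ` verts C"
      using self_in_connected_component[of _ C] by blast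
    fix p q assume "p \<in> (\<lambda>v. verts (connected_component C v)) ` verts C"
      "q \<in> (\<lambda>v. verts (connected_component C v)) ` verts C" and ne: "p \<noteq> q"
    then obtain v w where vw: "p = verts (connected_component C v)" "q = verts (connected_component C w)"
      by blast
    show "disjnt p q"
      unfolding disjnt_iff
      using connected_component_eq[of _ C v] connected_component_eq[of _ C w] vw ne by metis
  qed
  moreover have "M \<subseteq> edges C"
    using sub by (force simp: M_def)
  moreover have "T \<subseteq> S"
    using sub E hexes by (force simp: T_def)
  ultimately have "exact_cover S M T"
    using E V by (auto simp: exact_cover_def)
  moreover have "edges C = M \<union> \<Union> (hexagon_edges ` T)"
  proof (intro equalityI subsetI)
    fix e assume e: "e \<in> edges C"
    then obtain u v where uv: "e = {u, v}"
      using card_edge_hex_graph[of e S] E by (auto simp: card_2_iff)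
    then have "u \<in> verts C" using EV e by auto
    moreover have "e \<in> edges (connected_component C u)"
      using e uv by (auto simp: connected_component_def Let_def)
    ultimately show "e \<in> M \<union> \<Union> (hexagon_edges ` T)"
      using comps[of "connected_component C u"] by (auto simp: connected_components_def)
  next
    fix e assume "e \<in> M \<union> \<Union> (hexagon_edges ` T)"
    then show "e \<in> edges C" using sub by (force simp: M_def T_def)
  qed
  ultimately show ?thesis
    using V by (metis cover_graph_def prod.collapse)
qed

lemma clar_cover_if_exact_cover:
  assumes "exact_cover S M T"
  shows "clar_cover S (cover_graph S M T)"
proof -
  have "M \<subseteq> edges (hex_graph S)" "T \<subseteq> S" using assms by (auto simp: exact_cover_def)
  then have "spanning_subgraph (cover_graph S M T) (hex_graph S)"
    by (auto simp: spanning_subgraph_def cover_graph_def hex_graph_def)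
  moreover have "graph_iso (e, {e}) K2" if "e \<in> M" for e
    using that \<open>M \<subseteq> edges (hex_graph S)\<close> card_edge_hex_graph graph_iso_K2_iff[of "(e, {e})"] by auto
  ultimately show ?thesis
    unfolding clar_cover_def connected_components_cover_graph[OF assms]
    using graph_iso_C6_hexagon by blast
qed

lemma not_graph_iso_C6_edge: "card e = 2 \<Longrightarrow> \<not> graph_iso (e, {e}) C6"
  by (auto simp: graph_iso_def C6_def dest!: bij_betw_same_card)

lemma clar_order_cover_graph:
  assumes "exact_cover S M T"
  shows "clar_order (cover_graph S M T) = card T"
proof -
  have "card e = 2" if "e \<in> M" for e
    using that assms card_edge_hex_graph by (auto simp: exact_cover_def)
  then have "{X \<in> connected_components (cover_graph S M T). graph_iso X C6} =
      (\<lambda>h. (hex_verts h, hexagon_edges h)) ` T"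
    unfolding connected_components_cover_graph[OF assms]
    using graph_iso_C6_hexagon not_graph_iso_C6_edge by blast
  moreover have "inj_on (\<lambda>h. (hex_verts h, hexagon_edges h)) T"
    using inj_hex_verts by (auto simp: inj_on_def dest: injD)
  ultimately show ?thesis by (simp add: clar_order_def card_image)
qed

text \<open>
  The pair is read off from the components: \<open>M\<close> consists of the edges and \<open>T\<close> of the
  hexagons that are components.
\<close>

lemma inj_on_cover_graph: "inj_on (\<lambda>(M, T). cover_graph S M T) {(M, T). exact_cover S M T}"
proof (rule inj_onI, clarify)
  have *: "M = {e. (e, {e}) \<in> connected_components (cover_graph S M T)} \<and>
      T = {h. (hex_verts h, hexagon_edges h) \<in> connected_components (cover_graph S M T)}"
    if ec: "exact_cover S M T" for M T
  proof -
    have ne: "hex_verts h \<notin> M" for h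
      using ec card_edge_hex_graph[of "hex_verts h" S] card_hex_verts[of h] by (auto simp: exact_cover_def)
    have ne': "(e, {e}) \<noteq> (hex_verts h, hexagon_edges h)" for e h
    proof -
      have "hex_verts h \<notin> hexagon_edges h"
        using card_hexagon_edge[of "hex_verts h" h] card_hex_verts[of h] by auto
      then show ?thesis by blast
    qed
    show ?thesis
      unfolding connected_components_cover_graph[OF ec]
      using ne ne' by (auto simp: image_iff inj_eq[OF inj_hex_verts])
  qed
  fix M T M' T' assume "exact_cover S M T" "exact_cover S M' T'" "cover_graph S M T = cover_graph S M' T'"
  then show "M = M' \<and> T = T'" using * by metis
qed

lemma bij_betw_cover_graph:
  assumes hexes: "\<And>h. hexagon_edges h \<subseteq> edges (hex_graph S) \<Longrightarrow> h \<in> S"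
  shows "bij_betw (\<lambda>(M, T). cover_graph S M T) {(M, T). exact_cover S M T} {C. clar_cover S C}"
proof -
  have "(\<lambda>(M, T). cover_graph S M T) ` {(M, T). exact_cover S M T} = {C. clar_cover S C}"
  proof (intro equalityI subsetI)
    fix C assume "C \<in> {C. clar_cover S C}"
    then obtain M T where "exact_cover S M T" "C = cover_graph S M T"
      using exact_cover_if_clar_cover[OF hexes] by blast
    then show "C \<in> (\<lambda>(M, T). cover_graph S M T) ` {(M, T). exact_cover S M T}" by force
  next
    fix C assume "C \<in> (\<lambda>(M, T). cover_graph S M T) ` {(M, T). exact_cover S M T}"
    then obtain M T where "exact_cover S M T" "C = cover_graph S M T" by auto
    then show "C \<in> {C. clar_cover S C}" using clar_cover_if_exact_cover by simp
  qed
  then show ?thesis using inj_on_cover_graph by (simp add: bij_betw_def)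
qed

definition sextet_edges :: "hexagon \<Rightarrow> vertex set set" where
  "sextet_edges h = {right_edge h, upper_left_edge h, lower_left_edge h}"

definition proper_sextets :: "hexagon set \<Rightarrow> vertex set set \<Rightarrow> hexagon set" where
  "proper_sextets S M = {h \<in> S. sextet_edges h \<subseteq> M}"

lemma partition_on_sextet_edges: "partition_on (hex_verts h) (sextet_edges h)"
proof -
  obtain r x where h: "h = (r, x)" by (cases h)
  have "\<Union> (sextet_edges h) = hex_verts h" by (auto simp: h sextet_edges_def hex_verts_eq)
  moreover have "disjoint (sextet_edges h)"
    by (auto simp: h sextet_edges_def pairwise_insert disjnt_def)
  moreover have "{} \<notin> sextet_edges h" by (simp add: h sextet_edges_def)
  ultimately show ?thesis by (simp add: partition_on_def)
qed

text \<open>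
  An edge of the lattice is the right, upper left or lower left edge of at most one hexagon. Hence
  two proper sextets of one matching have disjoint edge sets and so disjoint vertex sets.
\<close>

lemma sextet_edges_disjoint: "e \<in> sextet_edges h \<Longrightarrow> e \<in> sextet_edges h' \<Longrightarrow> h = h'"
proof -
  assume e: "e \<in> sextet_edges h" and e': "e \<in> sextet_edges h'"
  obtain r x r' x' where h: "h = (r, x)" "h' = (r', x')" by (cases h; cases h')
  have "r = r' \<and> x = x'"
    using e e' unfolding sextet_edges_def h insert_iff empty_iff simp_thms right_edge.simps upper_left_edge.simps
      lower_left_edge.simps
    by - (elim disjE; hypsubst; simp only: doubleton_eq_iff vertex.inject vertex.distinct; arith)
  then show ?thesis using h by simp
qed

lemma sextet_edges_subset: "sextet_edges h \<subseteq> hexagon_edges h"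
  by (auto simp: sextet_edges_def hexagon_edges_def)

lemma Union_sextet_edges: "\<Union> (sextet_edges h) = hex_verts h"
  using partition_onD1[OF partition_on_sextet_edges[of h]] by (rule sym)

lemma partition_on_mem_unique: "partition_on A P \<Longrightarrow> X \<in> P \<Longrightarrow> Y \<in> P \<Longrightarrow> v \<in> X \<Longrightarrow> v \<in> Y \<Longrightarrow> X = Y"
  using partition_onD2[of A P] unfolding disjoint_def by blast

text \<open>
  Each hexagon is replaced by its three proper-sextet edges, which cover the same vertices.
\<close>

lemma exact_cover_refine:
  assumes ec: "exact_cover S M T"
  shows "exact_cover S (M \<union> \<Union> (sextet_edges ` T)) {}" (is "exact_cover S ?K {}")
    and "M \<inter> \<Union> (sextet_edges ` T) = {}"
proof -
  have part: "partition_on (verts (hex_graph S)) (M \<union> hex_verts ` T)"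
    and M: "M \<subseteq> edges (hex_graph S)" and T: "T \<subseteq> S"
    using ec by (auto simp: exact_cover_def)
  note uniq = partition_on_mem_unique[OF part]
  have ne: "hex_verts h \<notin> M" for h
    using M card_edge_hex_graph[of "hex_verts h" S] card_hex_verts[of h] by auto
  have owner: "\<exists>X\<in>M \<union> hex_verts ` T. e \<subseteq> X \<and> (X \<in> M \<longrightarrow> e = X) \<and> (\<forall>h\<in>T. X = hex_verts h \<longrightarrow> e \<in> sextet_edges h)"
    if e: "e \<in> ?K" for e
  proof (cases "e \<in> M")
    case True
    then show ?thesis using ne by blast
  next
    case False
    then obtain h where h: "h \<in> T" "e \<in> sextet_edges h" using e by blast
    have "e \<subseteq> hex_verts h" using h Union_sextet_edges by blast
    moreover have "\<forall>h'\<in>T. hex_verts h = hex_verts h' \<longrightarrow> e \<in> sextet_edges h'"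
      using h injD[OF inj_hex_verts] by blast
    ultimately show ?thesis using h ne[of h] by (intro bexI[of _ "hex_verts h"]) auto
  qed
  have "partition_on (verts (hex_graph S)) ?K"
  proof (rule partition_onI)
    have "\<Union> ?K = \<Union> (M \<union> hex_verts ` T)" unfolding Union_sextet_edges[symmetric] by blast
    then show "\<Union> ?K = verts (hex_graph S)" using partition_onD1[OF part] by simp
    show "{} \<notin> ?K"
      using partition_onD3[OF part] partition_onD3[OF partition_on_sextet_edges] by blast
    fix e e' assume e: "e \<in> ?K" and e': "e' \<in> ?K" and neq: "e \<noteq> e'"
    show "disjnt e e'"
      unfolding disjnt_iff
    proof clarify
      fix v assume v: "v \<in> e" "v \<in> e'"
      obtain X where X: "X \<in> M \<union> hex_verts ` T" "e \<subseteq> X" "X \<in> M \<longrightarrow> e = X" "\<forall>h\<in>T. X = hex_verts h \<longrightarrow> e \<in> sextet_edges h"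
        using owner[OF e] by blast
      obtain Y where Y: "Y \<in> M \<union> hex_verts ` T" "e' \<subseteq> Y" "Y \<in> M \<longrightarrow> e' = Y" "\<forall>h\<in>T. Y = hex_verts h \<longrightarrow> e' \<in> sextet_edges h"
        using owner[OF e'] by blast
      have XY: "X = Y" using uniq[OF X(1) Y(1)] v X(2) Y(2) by blast
      show False
      proof (cases "X \<in> M")
        case True
        then show False using X Y XY neq by blast
      next
        case False
        then obtain h where "h \<in> T" "X = hex_verts h" using X by blast
        then have "e \<in> sextet_edges h" "e' \<in> sextet_edges h" using X Y XY by blast+
        then show False
          using neq v partition_on_mem_unique[OF partition_on_sextet_edges] by blast
      qed
    qed
  qed
  moreover have "?K \<subseteq> edges (hex_graph S)"
    using M T sextet_edges_subset by (fastforce simp: hex_graph_def)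
  ultimately show "exact_cover S ?K {}" by (simp add: exact_cover_def)
  show "M \<inter> \<Union> (sextet_edges ` T) = {}"
  proof (rule ccontr)
    assume "M \<inter> \<Union> (sextet_edges ` T) \<noteq> {}"
    then obtain e h where e: "e \<in> M" "h \<in> T" "e \<in> sextet_edges h" by blast
    have "e \<subseteq> hex_verts h" using e(3) Union_sextet_edges[of h] by blast
    moreover have "e \<noteq> {}" using e(1) partition_onD3[OF part] by blast
    ultimately have "e = hex_verts h" using uniq[of e "hex_verts h"] e by blast
    then show False using ne e by blast
  qed
qed

text \<open>
  The inverse step: the proper-sextet edges of hexagons in \<open>T\<close> are merged into these
  hexagons. The hexagons do not overlap because distinct ones have disjoint sets of sextet edges,
  and these sets are parts of one matching.
\<close>

lemma exact_cover_coarsen: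
  assumes ec: "exact_cover S K {}" and T: "T \<subseteq> proper_sextets S K"
  shows "exact_cover S (K - \<Union> (sextet_edges ` T)) T" (is "exact_cover S ?M T")
proof -
  have part: "partition_on (verts (hex_graph S)) K" and K: "K \<subseteq> edges (hex_graph S)"
    using ec by (auto simp: exact_cover_def)
  note uniq = partition_on_mem_unique[OF part]
  have TK: "sextet_edges h \<subseteq> K" "h \<in> S" if "h \<in> T" for h
    using that T by (auto simp: proper_sextets_def)
  have split: "\<exists>e\<in>K. v \<in> e \<and> (X = e \<and> e \<in> ?M \<or> (\<exists>h\<in>T. X = hex_verts h \<and> e \<in> sextet_edges h))"
    if v: "v \<in> X" and X: "X \<in> ?M \<union> hex_verts ` T" for v X
  proof -
    show ?thesis
    proof (cases "X \<in> ?M")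
      case True
      then show ?thesis using v by blast
    next
      case False
      then obtain h where h: "h \<in> T" "X = hex_verts h" using X by blast
      then obtain e where "e \<in> sextet_edges h" "v \<in> e" using v Union_sextet_edges[of h] by blast
      then show ?thesis using h TK(1)[OF h(1)] by blast
    qed
  qed
  have "partition_on (verts (hex_graph S)) (?M \<union> hex_verts ` T)"
  proof (rule partition_onI)
    have "\<Union> (?M \<union> hex_verts ` T) = \<Union> K" using TK Union_sextet_edges by blast
    then show "\<Union> (?M \<union> hex_verts ` T) = verts (hex_graph S)" using partition_onD1[OF part] by simp
    have "hex_verts h \<noteq> {}" for h using card_hex_verts[of h] by auto
    then show "{} \<notin> ?M \<union> hex_verts ` T" using partition_onD3[OF part] by auto
    fix X Y assume X: "X \<in> ?M \<union> hex_verts ` T" and Y: "Y \<in> ?M \<union> hex_verts ` T" and "X \<noteq> Y"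
    show "disjnt X Y"
      unfolding disjnt_iff
    proof clarify
      fix v assume v: "v \<in> X" "v \<in> Y"
      obtain e where e: "e \<in> K" "v \<in> e" "X = e \<and> e \<in> ?M \<or> (\<exists>h\<in>T. X = hex_verts h \<and> e \<in> sextet_edges h)"
        using split[OF v(1) X] by blast
      obtain e' where e': "e' \<in> K" "v \<in> e'" "Y = e' \<and> e' \<in> ?M \<or> (\<exists>h\<in>T. Y = hex_verts h \<and> e' \<in> sextet_edges h)"
        using split[OF v(2) Y] by blast
      have "e = e'" using uniq e e' by blast
      then show False using e(3) e'(3) sextet_edges_disjoint \<open>X \<noteq> Y\<close> by blast
    qed
  qed
  then show ?thesis using K TK by (auto simp: exact_cover_def)
qed

lemma bij_betw_exact_covers:
  "bij_betw (\<lambda>(M, T). (M \<union> \<Union> (sextet_edges ` T), T)) {(M, T). exact_cover S M T}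
     (SIGMA K:{K. exact_cover S K {}}. Pow (proper_sextets S K))"
proof (rule bij_betw_byWitness[where f' = "\<lambda>(K, T). (K - \<Union> (sextet_edges ` T), T)"])
  have "M \<union> \<Union> (sextet_edges ` T) - \<Union> (sextet_edges ` T) = M" if "exact_cover S M T" for M T
    using exact_cover_refine(2)[OF that] by blast
  then show "\<forall>a\<in>{(M, T). exact_cover S M T}.
     (case case a of (M, T) \<Rightarrow> (M \<union> \<Union> (sextet_edges ` T), T) of
        (K, T) \<Rightarrow> (K - \<Union> (sextet_edges ` T), T)) = a"
    by clarsimp
  have "K - \<Union> (sextet_edges ` T) \<union> \<Union> (sextet_edges ` T) = K" if "T \<subseteq> proper_sextets S K" for K T
    using that unfolding proper_sextets_def by blast
  then show "\<forall>b\<in>SIGMA K:{K. exact_cover S K {}}. Pow (proper_sextets S K).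
     (case case b of (K, T) \<Rightarrow> (K - \<Union> (sextet_edges ` T), T) of
        (M, T) \<Rightarrow> (M \<union> \<Union> (sextet_edges ` T), T)) = b"
    by clarsimp
  show "(\<lambda>(M, T). (M \<union> \<Union> (sextet_edges ` T), T)) ` {(M, T). exact_cover S M T}
     \<subseteq> (SIGMA K:{K. exact_cover S K {}}. Pow (proper_sextets S K))"
  proof (rule image_subsetI)
    fix x assume "x \<in> {(M, T). exact_cover S M T}"
    then obtain M T where x: "x = (M, T)" and ec: "exact_cover S M T" by auto
    have "T \<subseteq> proper_sextets S (M \<union> \<Union> (sextet_edges ` T))"
      using ec unfolding exact_cover_def proper_sextets_def by blast
    then show "(case x of (M, T) \<Rightarrow> (M \<union> \<Union> (sextet_edges ` T), T)) \<in> (SIGMA K:{K. exact_cover S K {}}. Pow (proper_sextets S K))"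
      using exact_cover_refine(1)[OF ec] x by simp
  qed
  show "(\<lambda>(K, T). (K - \<Union> (sextet_edges ` T), T)) ` (SIGMA K:{K. exact_cover S K {}}. Pow (proper_sextets S K))
     \<subseteq> {(M, T). exact_cover S M T}"
    using exact_cover_coarsen by (simp add: image_subset_iff split_def)
qed

text \<open>
  The generating function of the subsets of a finite set by cardinality: a matching with sextet set
  \<open>A\<close> contributes one Clar cover of order \<open>card T\<close> for every \<open>T \<subseteq> A\<close>.
\<close>

lemma sum_monom_Pow:
  assumes "finite A"
  shows "(\<Sum>T\<in>Pow A. monom (1 :: int) (card T)) = [:1, 1:] ^ card A"
  using assms
proof (induction A rule: finite_induct)
  case empty
  then show ?case by simp
next
  case (insert a A)
  have inj: "inj_on (insert a) (Pow A)" using insert by (auto simp: inj_on_def)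
  have card: "card (insert a T) = Suc (card T)" if "T \<in> Pow A" for T
    using that insert by (subst card_insert_disjoint) (auto intro: finite_subset)
  have "(\<Sum>T\<in>Pow (insert a A). monom (1 :: int) (card T)) =
      (\<Sum>T\<in>Pow A. monom 1 (card T)) + (\<Sum>T\<in>insert a ` Pow A. monom 1 (card T))"
    unfolding Pow_insert using insert by (intro sum.union_disjoint) auto
  also have "(\<Sum>T\<in>insert a ` Pow A. monom (1 :: int) (card T)) = (\<Sum>T\<in>Pow A. monom 1 1 * monom 1 (card T))"
    using card by (simp add: sum.reindex[OF inj] mult_monom)
  also have "(\<Sum>T\<in>Pow A. monom (1 :: int) (card T)) + \<dots> = (1 + monom 1 1) * (\<Sum>T\<in>Pow A. monom 1 (card T))"
    by (simp add: sum_distrib_left sum.distrib algebra_simps)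
  also have "1 + monom 1 1 = [:1, 1 :: int:]" by (simp add: monom_Suc one_pCons)
  finally show ?case using insert by simp
qed

lemma finite_edges_hex_graph: "finite S \<Longrightarrow> finite (edges (hex_graph S))"
  by (auto simp: hex_graph_def hexagon_edges_def)

lemma finite_exact_covers:
  assumes "finite S"
  shows "finite {(M, T). exact_cover S M T}"
proof (rule finite_subset)
  show "{(M, T). exact_cover S M T} \<subseteq> Pow (edges (hex_graph S)) \<times> Pow S"
    by (auto simp: exact_cover_def)
  show "finite (Pow (edges (hex_graph S)) \<times> Pow S)"
    using assms finite_edges_hex_graph by blast
qed

lemma finite_perfect_matchings:
  assumes "finite S"
  shows "finite {K. exact_cover S K {}}"
proof (rule finite_subset)
  show "{K. exact_cover S K {}} \<subseteq> Pow (edges (hex_graph S))"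
    by (auto simp: exact_cover_def)
  show "finite (Pow (edges (hex_graph S)))"
    using assms finite_edges_hex_graph by blast
qed

lemma ZZ_eq_sum_exact_covers:
  assumes fin: "finite S" and hexes: "\<And>h. hexagon_edges h \<subseteq> edges (hex_graph S) \<Longrightarrow> h \<in> S"
  shows "ZZ S = (\<Sum>(M, T)\<in>{(M, T). exact_cover S M T}. monom 1 (card T))"
proof -
  note bij = bij_betw_cover_graph[OF hexes]
  have finC: "finite {C. clar_cover S C}"
    using bij_betw_finite[OF bij] finite_exact_covers[OF fin] by blast
  have "(\<Sum>C\<in>{C. clar_cover S C}. monom (1 :: int) (clar_order C)) =
      (\<Sum>k\<in>{0..max_clar_order S}. \<Sum>C\<in>{C \<in> {C. clar_cover S C}. clar_order C = k}. monom 1 (clar_order C))"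
  proof (rule sum.group[symmetric])
    show "clar_order ` {C. clar_cover S C} \<subseteq> {0..max_clar_order S}"
      using finC by (auto simp: max_clar_order_def)
  qed (use finC in auto)
  also have "\<dots> = ZZ S"
  proof -
    have "(\<Sum>C\<in>{C \<in> {C. clar_cover S C}. clar_order C = k}. monom (1 :: int) (clar_order C)) =
        monom (int (num_clar_covers S k)) k" for k
    proof -
      have "(\<Sum>C\<in>{C \<in> {C. clar_cover S C}. clar_order C = k}. monom (1 :: int) (clar_order C)) =
          (\<Sum>C\<in>{C. clar_cover S C \<and> clar_order C = k}. monom 1 k)"
        by (rule sum.cong) auto
      then show ?thesis by (simp add: num_clar_covers_def of_nat_monom mult_monom)
    qed
    then show ?thesis by (simp add: ZZ_def)
  qed
  finally have "ZZ S = (\<Sum>C\<in>{C. clar_cover S C}. monom 1 (clar_order C))" by simp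
  also have "\<dots> = (\<Sum>x\<in>{(M, T). exact_cover S M T}. monom 1 (clar_order ((\<lambda>(M, T). cover_graph S M T) x)))"
    by (rule sum.reindex_bij_betw[OF bij, symmetric])
  also have "\<dots> = (\<Sum>(M, T)\<in>{(M, T). exact_cover S M T}. monom 1 (card T))"
    by (rule sum.cong) (auto simp: clar_order_cover_graph)
  finally show ?thesis .
qed

lemma ZZ_eq_sum_perfect_matchings:
  assumes fin: "finite S" and hexes: "\<And>h. hexagon_edges h \<subseteq> edges (hex_graph S) \<Longrightarrow> h \<in> S"
  shows "ZZ S = (\<Sum>K\<in>{K. exact_cover S K {}}. [:1, 1:] ^ card (proper_sextets S K))"
proof -
  have finP: "finite (proper_sextets S K)" for K
    using fin by (simp add: proper_sextets_def)
  have "ZZ S = (\<Sum>(M, T)\<in>{(M, T). exact_cover S M T}. monom 1 (card T))"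
    by (rule ZZ_eq_sum_exact_covers[OF assms])
  also have "\<dots> = (\<Sum>x\<in>{(M, T). exact_cover S M T}. monom 1 (card (snd ((\<lambda>(M, T). (M \<union> \<Union> (sextet_edges ` T), T)) x))))"
    by (rule sum.cong) auto
  also have "\<dots> = (\<Sum>x\<in>(SIGMA K:{K. exact_cover S K {}}. Pow (proper_sextets S K)). monom 1 (card (snd x)))"
    by (rule sum.reindex_bij_betw[OF bij_betw_exact_covers])
  also have "\<dots> = (\<Sum>K\<in>{K. exact_cover S K {}}. \<Sum>T\<in>Pow (proper_sextets S K). monom 1 (card T))"
    using finP finite_perfect_matchings[OF fin] by (subst sum.Sigma) (auto simp: split_def)
  finally show ?thesis using finP by (simp add: sum_monom_Pow)
qed

lemma num_kekule_eq_card: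
  assumes fin: "finite S" and hexes: "\<And>h. hexagon_edges h \<subseteq> edges (hex_graph S) \<Longrightarrow> h \<in> S"
  shows "num_kekule S k = card {K. exact_cover S K {} \<and> int (card (proper_sextets S K)) = k}"
proof -
  let ?f = "\<lambda>K. cover_graph S K {}"
  have kek: "kekule S C \<longleftrightarrow> (\<exists>K. exact_cover S K {} \<and> C = ?f K)" for C
  proof
    assume "kekule S C"
    then obtain M T where MT: "exact_cover S M T" "C = cover_graph S M T" and "clar_order C = 0"
      using exact_cover_if_clar_cover[OF hexes] unfolding kekule_def by blast
    then have "card T = 0" using clar_order_cover_graph by metis
    moreover have "finite T" using MT(1) fin by (auto simp: exact_cover_def intro: finite_subset)
    ultimately show "\<exists>K. exact_cover S K {} \<and> C = ?f K" using MT by auto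
  next
    assume "\<exists>K. exact_cover S K {} \<and> C = ?f K"
    then show "kekule S C"
      unfolding kekule_def using clar_cover_if_exact_cover clar_order_cover_graph by fastforce
  qed
  have sex: "{h. proper_sextet S (?f K) h} = proper_sextets S K" for K
    by (auto simp: proper_sextet_def proper_sextets_def sextet_edges_def cover_graph_def)
  have "{C. kekule S C \<and> int (card {h. proper_sextet S C h}) = k} =
      ?f ` {K. exact_cover S K {} \<and> int (card (proper_sextets S K)) = k}"
    using kek sex by auto
  moreover have "inj ?f" by (auto simp: inj_def cover_graph_def)
  ultimately show ?thesis
    unfolding num_kekule_def by (simp add: card_image inj_on_subset)
qed

section \<open>Geometry of a regular strip\<close>

text \<open>
  \<open>L k\<close> is the position of the leftmost vertical bond in row \<open>k\<close>, and \<open>w k\<close> is the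
  number of hexagons in this row. Above and below the strip there are virtual rows 0 and
  \<open>m + 1\<close> with \<open>n - 1\<close> hexagons, shorter by half a unit at both ends. They
  contribute no hexagons, but their bond positions are the positions of the topmost and bottommost
  vertices of the strip, and \<open>ord\<close> takes the value 0 on them. This makes the first and the
  last fragment behave like all the others.
\<close>

locale strip =
  fixes m n :: nat and r0 :: int and L :: "nat \<Rightarrow> int" and w :: "nat \<Rightarrow> nat"
  assumes m_pos: "1 \<le> m" and n_pos: "1 \<le> n"
    and w_pos: "k \<in> {1..m} \<Longrightarrow> 1 \<le> w k"
    and left_step: "k \<le> m \<Longrightarrow> \<bar>L (k + 1) - L k\<bar> = 1"
    and right_step: "k \<le> m \<Longrightarrow> \<bar>(L (k + 1) + 2 * int (w (k + 1))) - (L k + 2 * int (w k))\<bar> = 1"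
    and w_0: "w 0 = n - 1" and w_1: "w 1 = n" and w_m: "w m = n" and w_Suc_m: "w (m + 1) = n - 1"
    and parity: "k \<le> m + 1 \<Longrightarrow> odd (r0 + int k + L k)"
begin

definition R :: "nat \<Rightarrow> int" where "R k = L k + 2 * int (w k)"

definition hexes :: "hexagon set" where
  "hexes = {(r0 + int k, x) | k x. k \<in> {1..m} \<and> L k < x \<and> x < R k \<and> even (r0 + int k + x)}"

definition bond_pos :: "nat \<Rightarrow> int set" where
  "bond_pos k = {p. L k \<le> p \<and> p \<le> R k \<and> odd (r0 + int k + p)}"

text \<open>
  The fragment between the rows \<open>k - 1\<close> and \<open>k\<close> is a path with one vertex for each position
  from \<open>first_pos k\<close> to \<open>last_pos k\<close>. Its vertices are alternately upper ends of
  bond positions of row \<open>k\<close> and lower ends of bond positions of row \<open>k - 1\<close>.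
\<close>

definition first_pos :: "nat \<Rightarrow> int" where "first_pos k = min (L (k - 1)) (L k)"
definition last_pos :: "nat \<Rightarrow> int" where "last_pos k = max (R (k - 1)) (R k)"

definition frag_vertex :: "nat \<Rightarrow> int \<Rightarrow> vertex" where
  "frag_vertex k q = (if odd (r0 + int k + q) then Upper (r0 + int k) q else Lower (r0 + int k - 1) q)"

definition bond :: "nat \<Rightarrow> int \<Rightarrow> vertex set" where
  "bond k p = {Upper (r0 + int k) p, Lower (r0 + int k) p}"

definition slant :: "nat \<Rightarrow> int \<Rightarrow> vertex set" where
  "slant k p = {frag_vertex k p, frag_vertex k (p + 1)}"

lemma frag_vertex_eq_iff: "frag_vertex k q = frag_vertex k' q' \<longleftrightarrow> k = k' \<and> q = q'"
  by (auto simp: frag_vertex_def split: if_splits)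

lemma bond_eq_frag_vertices: "odd (r0 + int k + p) \<Longrightarrow> bond k p = {frag_vertex k p, frag_vertex (k + 1) p}"
  by (auto simp: bond_def frag_vertex_def)

lemma bond_eq_iff: "bond k p = bond k' p' \<longleftrightarrow> k = k' \<and> p = p'"
  by (auto simp: bond_def doubleton_eq_iff)

lemma slant_eq_iff: "slant k p = slant k' p' \<longleftrightarrow> k = k' \<and> p = p'"
  by (auto simp: slant_def doubleton_eq_iff frag_vertex_eq_iff)

lemma slant_neq_bond: "odd (r0 + int k' + p') \<Longrightarrow> slant k p \<noteq> bond k' p'"
  by (simp add: slant_def bond_eq_frag_vertices doubleton_eq_iff frag_vertex_eq_iff)

lemma L_step:
  assumes "1 \<le> k" "k \<le> m + 1"
  shows "L k = L (k - 1) + 1 \<or> L k = L (k - 1) - 1"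
proof -
  have "\<bar>L k - L (k - 1)\<bar> = 1" using left_step[of "k - 1"] assms by simp
  then show ?thesis by linarith
qed

lemma R_step:
  assumes "1 \<le> k" "k \<le> m + 1"
  shows "R k = R (k - 1) + 1 \<or> R k = R (k - 1) - 1"
proof -
  have "\<bar>R k - R (k - 1)\<bar> = 1" using right_step[of "k - 1"] assms by (simp add: R_def)
  then show ?thesis by linarith
qed

lemma ends_first: "L 0 = L 1 + 1" "R 0 = R 1 - 1"
  using L_step[of 1] R_step[of 1] w_0 w_1 n_pos by (auto simp: R_def)

lemma ends_last: "L (m + 1) = L m + 1" "R (m + 1) = R m - 1"
  using L_step[of "m + 1"] R_step[of "m + 1"] w_m w_Suc_m n_pos by (auto simp: R_def)

lemma R_ge: "k \<in> {1..m} \<Longrightarrow> R k \<ge> L k + 2"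
  using w_pos[of k] by (auto simp: R_def)

lemma odd_R: "k \<le> m + 1 \<Longrightarrow> odd (r0 + int k + R k)"
  using parity[of k] by (simp add: R_def)

lemma R_neq:
  assumes "k \<le> m + 1" and "odd (r0 + int k + p)"
  shows "p + 1 \<noteq> R k"
proof
  assume "p + 1 = R k"
  then have "p = R k - 1" by simp
  then show False using assms odd_R[of k] by simp
qed

lemma bond_pos_in_fragment:
  "p \<in> bond_pos k \<Longrightarrow> first_pos k \<le> p \<and> p \<le> last_pos k"
  "p \<in> bond_pos k \<Longrightarrow> first_pos (k + 1) \<le> p \<and> p \<le> last_pos (k + 1)"
  by (auto simp: bond_pos_def first_pos_def last_pos_def)

text \<open>
  The slanted edges of a fragment belong to the hexagons of the two adjacent rows. The positions
  covered by these rows overlap because the rows are nonempty and shifted by one half unit only, so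
  there is no gap in the path. The first and the last fragment are covered by one row alone.
\<close>

lemma slant_range_cases:
  assumes "k \<in> {1..m + 1}" "first_pos k \<le> p" "p < last_pos k"
  shows "k \<le> m \<and> L k \<le> p \<and> p < R k \<or> 2 \<le> k \<and> L (k - 1) \<le> p \<and> p < R (k - 1)"
proof -
  consider "k = 1" | "k = m + 1" | "2 \<le> k" "k \<le> m" using assms(1) by fastforce
  then show ?thesis
  proof cases
    case 1
    then show ?thesis using assms ends_first m_pos by (auto simp: first_pos_def last_pos_def)
  next
    case 2
    then show ?thesis using assms ends_last m_pos by (auto simp: first_pos_def last_pos_def)
  next
    case 3
    then show ?thesis
      using assms L_step[of k] R_step[of k] R_ge[of k] R_ge[of "k - 1"]
      by (auto simp: first_pos_def last_pos_def min_def max_def split: if_splits)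
  qed
qed

lemma slanted_edges_eq:
  assumes "even (r0 + int k + x)"
  shows "upper_left_edge (r0 + int k, x) = slant k (x - 1)"
    "upper_right_edge (r0 + int k, x) = slant k x"
    "lower_left_edge (r0 + int k, x) = slant (k + 1) (x - 1)"
    "lower_right_edge (r0 + int k, x) = slant (k + 1) x"
  using assms by (auto simp: slant_def frag_vertex_def)

lemma vertical_edges_eq:
  "left_edge (r0 + int k, x) = bond k (x - 1)" "right_edge (r0 + int k, x) = bond k (x + 1)"
  by (simp_all add: bond_def)

lemma hexes_D: 
  assumes "k \<in> {1..m}" "L k < x" "x < R k" "even (r0 + int k + x)"
  shows "(r0 + int k, x) \<in> hexes"
  using assms unfolding hexes_def by blast

lemma edge_in_hex_graphI: "h \<in> hexes \<Longrightarrow> e \<in> hexagon_edges h \<Longrightarrow> e \<in> edges (hex_graph hexes)"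
  by (auto simp: hex_graph_def)

lemma bond_in_edges:
  assumes "k \<in> {1..m}" and p: "p \<in> bond_pos k"
  shows "bond k p \<in> edges (hex_graph hexes)"
proof (cases "p < R k")
  case True
  have "p + 1 \<noteq> R k" using p R_neq[of k p] assms by (auto simp: bond_pos_def)
  then have "(r0 + int k, p + 1) \<in> hexes"
    using True assms by (intro hexes_D) (auto simp: bond_pos_def)
  then show ?thesis
    using vertical_edges_eq(1)[of k "p + 1"] edge_in_hex_graphI[of "(r0 + int k, p + 1)"]
    by (simp add: hexagon_edges_def)
next
  case False
  then have "(r0 + int k, p - 1) \<in> hexes"
    using assms R_ge[of k] by (intro hexes_D) (auto simp: bond_pos_def)
  then show ?thesis
    using vertical_edges_eq(2)[of k "p - 1"] edge_in_hex_graphI[of "(r0 + int k, p - 1)"]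
    by (simp add: hexagon_edges_def)
qed

lemma slant_of_row:
  assumes "k \<in> {1..m}" "L k \<le> p" "p < R k"
  shows "slant k p \<in> edges (hex_graph hexes)" "slant (k + 1) p \<in> edges (hex_graph hexes)"
proof -
  have "slant k p \<in> edges (hex_graph hexes) \<and> slant (k + 1) p \<in> edges (hex_graph hexes)"
  proof (cases "even (r0 + int k + p)")
    case True
    have "p \<noteq> L k" using True parity[of k] assms by auto
    then have "(r0 + int k, p) \<in> hexes" using assms True by (intro hexes_D) auto
    then show ?thesis
      using slanted_edges_eq(2,4)[OF True] edge_in_hex_graphI[of "(r0 + int k, p)"]
      by (simp add: hexagon_edges_def)
  next
    case False
    then have ev: "even (r0 + int k + (p + 1))" by simp
    have "p + 1 \<noteq> R k" using False R_neq[of k p] assms by auto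
    then have "(r0 + int k, p + 1) \<in> hexes" using assms ev by (intro hexes_D) auto
    then show ?thesis
      using slanted_edges_eq(1,3)[OF ev] edge_in_hex_graphI[of "(r0 + int k, p + 1)"]
      by (simp add: hexagon_edges_def)
  qed
  then show "slant k p \<in> edges (hex_graph hexes)" "slant (k + 1) p \<in> edges (hex_graph hexes)" by blast+
qed

lemma edges_hexes:
  "edges (hex_graph hexes) =
     {bond k p | k p. k \<in> {1..m} \<and> p \<in> bond_pos k} \<union>
     {slant k p | k p. k \<in> {1..m + 1} \<and> p \<in> {first_pos k..<last_pos k}}" (is "_ = ?B \<union> ?Sl")
proof (intro equalityI subsetI)
  fix e assume "e \<in> edges (hex_graph hexes)"
  then obtain h where "h \<in> hexes" and e: "e \<in> hexagon_edges h" by (auto simp: hex_graph_def)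
  then obtain k x where h: "h = (r0 + int k, x)" and k: "k \<in> {1..m}" and x: "L k < x" "x < R k" "even (r0 + int k + x)"
    by (auto simp: hexes_def)
  have *: "x - 1 \<in> bond_pos k" "x + 1 \<in> bond_pos k" using x by (auto simp: bond_pos_def)
  have B: "bond k (x - 1) \<in> ?B" "bond k (x + 1) \<in> ?B" using * k by blast+
  have "x - 1 \<in> {first_pos k..<last_pos k}" "x \<in> {first_pos k..<last_pos k}"
    "x - 1 \<in> {first_pos (k + 1)..<last_pos (k + 1)}" "x \<in> {first_pos (k + 1)..<last_pos (k + 1)}"
    using x by (auto simp: first_pos_def last_pos_def)
  moreover have "k \<in> {1..m + 1}" "k + 1 \<in> {1..m + 1}" using k by auto
  ultimately have Sl: "slant k (x - 1) \<in> ?Sl" "slant k x \<in> ?Sl" "slant (k + 1) (x - 1) \<in> ?Sl" "slant (k + 1) x \<in> ?Sl"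
    by blast+
  show "e \<in> ?B \<union> ?Sl"
    using e B Sl unfolding h hexagon_edges_def vertical_edges_eq slanted_edges_eq[OF x(3)] by blast
next
  fix e assume "e \<in> ?B \<union> ?Sl"
  then consider k p where "e = bond k p" "k \<in> {1..m}" "p \<in> bond_pos k"
    | k p where "e = slant k p" "k \<in> {1..m + 1}" "p \<in> {first_pos k..<last_pos k}"
    by blast
  then show "e \<in> edges (hex_graph hexes)"
  proof cases
    case 1
    then show ?thesis using bond_in_edges by simp
  next
    case 2
    then have "k \<le> m \<and> L k \<le> p \<and> p < R k \<or> 2 \<le> k \<and> L (k - 1) \<le> p \<and> p < R (k - 1)"
      by (intro slant_range_cases) auto
    then show ?thesis
    proof (elim disjE conjE)
      assume "k \<le> m" "L k \<le> p" "p < R k"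
      then show ?thesis using 2 slant_of_row(1)[of k p] by simp
    next
      assume k: "2 \<le> k" "L (k - 1) \<le> p" "p < R (k - 1)"
      then have "k - 1 \<in> {1..m}" "k - 1 + 1 = k" using 2 by auto
      then show ?thesis using 2 slant_of_row(2)[of "k - 1" p] k by simp
    qed
  qed
qed

lemma first_less_last:
  assumes "k \<in> {1..m + 1}"
  shows "first_pos k < last_pos k"
proof (cases "k \<le> m")
  case True
  then have "L k + 2 \<le> R k" using assms R_ge[of k] by simp
  then show ?thesis unfolding first_pos_def last_pos_def by linarith
next
  case False
  then have "k = m + 1" using assms by simp
  moreover have "L m + 2 \<le> R m" using R_ge[of m] m_pos by simp
  ultimately show ?thesis unfolding first_pos_def last_pos_def by simp
qed

lemma verts_hexes:
  "verts (hex_graph hexes) = {frag_vertex k q | k q. k \<in> {1..m + 1} \<and> q \<in> {first_pos k..last_pos k}}" (is "_ = ?V")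
proof -
  have "verts (hex_graph hexes) = \<Union> (edges (hex_graph hexes))" by (simp add: hex_graph_def)
  also have "\<dots> = ?V"
  proof (intro equalityI subsetI)
    fix v assume "v \<in> \<Union> (edges (hex_graph hexes))"
    then consider k p where "v \<in> bond k p" "k \<in> {1..m}" "p \<in> bond_pos k"
      | k p where "v \<in> slant k p" "k \<in> {1..m + 1}" "p \<in> {first_pos k..<last_pos k}"
      unfolding edges_hexes by blast
    then show "v \<in> ?V"
    proof cases
      case 1
      then have "v = frag_vertex k p \<or> v = frag_vertex (k + 1) p"
        using bond_eq_frag_vertices[of k p] by (auto simp: bond_pos_def)
      moreover have "k \<in> {1..m + 1}" "k + 1 \<in> {1..m + 1}" using 1 by auto
      moreover have "p \<in> {first_pos k..last_pos k}" "p \<in> {first_pos (k + 1)..last_pos (k + 1)}"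
        using bond_pos_in_fragment[OF 1(3)] by auto
      ultimately show ?thesis by blast
    next
      case 2
      then have "v = frag_vertex k p \<or> v = frag_vertex k (p + 1)" by (auto simp: slant_def)
      moreover have "p \<in> {first_pos k..last_pos k}" "p + 1 \<in> {first_pos k..last_pos k}" using 2 by auto
      ultimately show ?thesis using 2(2) by blast
    qed
  next
    fix v assume "v \<in> ?V"
    then obtain k q where v: "v = frag_vertex k q" and k: "k \<in> {1..m + 1}" and q: "q \<in> {first_pos k..last_pos k}" by blast
    show "v \<in> \<Union> (edges (hex_graph hexes))"
    proof (cases "q < last_pos k")
      case True
      then have "slant k q \<in> edges (hex_graph hexes)" unfolding edges_hexes using k q by auto
      then show ?thesis using v by (auto simp: slant_def)
    next
      case False
      then have "q - 1 \<in> {first_pos k..<last_pos k}" using q first_less_last[OF k] by auto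
      then have "slant k (q - 1) \<in> edges (hex_graph hexes)" unfolding edges_hexes using k by blast
      then show ?thesis using v by (auto simp: slant_def)
    qed
  qed
  finally show ?thesis .
qed

end

section \<open>Perfect matchings of a strip and its vertical bonds\<close>

lemma exact_cover_empty_iff:
  "exact_cover S K {} \<longleftrightarrow> K \<subseteq> edges (hex_graph S) \<and> (\<forall>v\<in>verts (hex_graph S). \<exists>!e. e \<in> K \<and> v \<in> e)"
proof (intro iffI conjI)
  assume ec: "exact_cover S K {}"
  then show "K \<subseteq> edges (hex_graph S)" by (simp add: exact_cover_def)
  have part: "partition_on (verts (hex_graph S)) K" using ec by (simp add: exact_cover_def)
  show "\<forall>v\<in>verts (hex_graph S). \<exists>!e. e \<in> K \<and> v \<in> e"
  proof
    fix v assume "v \<in> verts (hex_graph S)"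
    then have "v \<in> \<Union> K" using partition_onD1[OF part] by simp
    then show "\<exists>!e. e \<in> K \<and> v \<in> e" using partition_on_mem_unique[OF part] by blast
  qed
next
  assume asm: "K \<subseteq> edges (hex_graph S) \<and> (\<forall>v\<in>verts (hex_graph S). \<exists>!e. e \<in> K \<and> v \<in> e)"
  have V: "verts (hex_graph S) = \<Union> (edges (hex_graph S))" by (simp add: hex_graph_def)
  have "partition_on (verts (hex_graph S)) K"
  proof (rule partition_onI)
    show "\<Union> K = verts (hex_graph S)" using asm V by blast
    show "{} \<notin> K" using asm card_edge_hex_graph[of "{}" S] by auto
    show "disjnt p q" if "p \<in> K" "q \<in> K" "p \<noteq> q" for p q
      using asm that V unfolding disjnt_iff by blast
  qed
  then show "exact_cover S K {}" using asm by (simp add: exact_cover_def)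
qed

lemma ex1_among_four:
  assumes "\<not> (P \<and> Q)" "P \<Longrightarrow> a \<noteq> c \<and> a \<noteq> d" "Q \<Longrightarrow> b \<noteq> c \<and> b \<noteq> d" "c \<noteq> d"
  shows "(\<exists>!e. P \<and> e = a \<or> Q \<and> e = b \<or> X \<and> e = c \<or> Y \<and> e = d) \<longleftrightarrow>
    of_bool (P \<or> Q) + of_bool X + of_bool Y = (1 :: nat)"
  using assms by (cases P; cases Q; cases X; cases Y) auto

context strip
begin

definition bonds_of :: "vertex set set \<Rightarrow> nat \<Rightarrow> int set" where
  "bonds_of K k = {p \<in> bond_pos k. k \<in> {1..m} \<and> bond k p \<in> K}"

definition slants_of :: "vertex set set \<Rightarrow> nat \<Rightarrow> int set" where
  "slants_of K k = {p \<in> {first_pos k..<last_pos k}. slant k p \<in> K}"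

text \<open>
  The vertices of fragment \<open>k\<close> that are matched by vertical bonds, given the bonds
  \<open>D i\<close> used in each row \<open>i\<close>.
\<close>

definition covered :: "(nat \<Rightarrow> int set) \<Rightarrow> nat \<Rightarrow> int set" where
  "covered D k = D k \<union> D (k - 1)"

definition bond_family :: "(nat \<Rightarrow> int set) \<Rightarrow> bool" where
  "bond_family D \<longleftrightarrow> (\<forall>k. D k \<subseteq> bond_pos k \<and> (k \<notin> {1..m} \<longrightarrow> D k = {}))"

text \<open>
  The families of bonds that leave a perfect matching in every fragment, by the criterion of
  \<open>path_matching_iff\<close>.
\<close>

definition balanced :: "(nat \<Rightarrow> int set) \<Rightarrow> bool" where
  "balanced D \<longleftrightarrow> bond_family D \<and> (\<forall>k\<in>{1..m + 1}.
     (\<forall>p. excess (first_pos k) (covered D k) p \<in> {0, 1}) \<and>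
     excess (first_pos k) (covered D k) (last_pos k) = (if even (last_pos k - first_pos k) then 1 else 0))"

definition matching :: "(nat \<Rightarrow> int set) \<Rightarrow> vertex set set" where
  "matching D = {bond k p | k p. k \<in> {1..m} \<and> p \<in> D k} \<union>
     {slant k p | k p. k \<in> {1..m + 1} \<and> p \<in> path_edges (first_pos k) (last_pos k) (covered D k)}"

lemma bond_family_bonds_of: "bond_family (bonds_of K)"
  by (auto simp: bond_family_def bonds_of_def)

lemma covered_subset:
  assumes "bond_family D" "1 \<le> k"
  shows "covered D k \<subseteq> {first_pos k..last_pos k}"
proof -
  have "D k \<subseteq> bond_pos k" "D (k - 1) \<subseteq> bond_pos (k - 1)" using assms by (auto simp: bond_family_def)
  then show ?thesis
    using bond_pos_in_fragment(1)[of _ k] bond_pos_in_fragment(2)[of _ "k - 1"] assms(2)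
    by (fastforce simp: covered_def)
qed

lemma bond_pos_parity: "p \<in> bond_pos k \<Longrightarrow> odd (r0 + int k + p)"
  by (simp add: bond_pos_def)

lemma bond_pos_disjoint: "1 \<le> k \<Longrightarrow> p \<in> bond_pos k \<Longrightarrow> p \<notin> bond_pos (k - 1)"
  by (auto simp: bond_pos_def of_nat_diff)

text \<open>
  A vertex of the lattice has degree 3. In the fragment path its edges are the two path edges and one
  vertical bond, which belongs to row \<open>k\<close> or to row \<open>k - 1\<close> according to the parity of
  the position.
\<close>

lemma incident_edges:
  assumes K: "K \<subseteq> edges (hex_graph hexes)" and k: "k \<in> {1..m + 1}"
  shows "e \<in> K \<and> frag_vertex k q \<in> e \<longleftrightarrow>
    q \<in> bonds_of K k \<and> e = bond k q \<or> q \<in> bonds_of K (k - 1) \<and> e = bond (k - 1) q \<or>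
    q \<in> slants_of K k \<and> e = slant k q \<or> q - 1 \<in> slants_of K k \<and> e = slant k (q - 1)" (is "?l \<longleftrightarrow> ?r")
proof
  assume l: ?l
  then consider k' p where "e = bond k' p" "k' \<in> {1..m}" "p \<in> bond_pos k'"
    | k' p where "e = slant k' p" "k' \<in> {1..m + 1}" "p \<in> {first_pos k'..<last_pos k'}"
    using K unfolding edges_hexes by blast
  then show ?r
  proof cases
    case 1
    then have "frag_vertex k q = frag_vertex k' p \<or> frag_vertex k q = frag_vertex (k' + 1) p"
      using l bond_eq_frag_vertices[OF bond_pos_parity[OF 1(3)]] by auto
    then have "p = q \<and> (k' = k \<or> k' = k - 1)" by (auto simp: frag_vertex_eq_iff)
    then show ?thesis using 1 l by (auto simp: bonds_of_def)
  next
    case 2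
    then have "frag_vertex k q = frag_vertex k' p \<or> frag_vertex k q = frag_vertex k' (p + 1)"
      using l by (auto simp: slant_def)
    then have "k' = k \<and> (p = q \<or> p = q - 1)" by (auto simp: frag_vertex_eq_iff)
    then show ?thesis using 2 l by (auto simp: slants_of_def)
  qed
next
  assume ?r
  then consider "q \<in> bonds_of K k" "e = bond k q" | "q \<in> bonds_of K (k - 1)" "e = bond (k - 1) q"
    | "q \<in> slants_of K k" "e = slant k q" | "q - 1 \<in> slants_of K k" "e = slant k (q - 1)" by blast
  then show ?l
  proof cases
    case 1
    then have "q \<in> bond_pos k" by (simp add: bonds_of_def)
    then show ?thesis
      using 1 bond_eq_frag_vertices[OF bond_pos_parity] by (simp add: bonds_of_def)
  next
    case 2
    then have "q \<in> bond_pos (k - 1)" by (simp add: bonds_of_def)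
    then have "bond (k - 1) q = {frag_vertex (k - 1) q, frag_vertex k q}"
      using bond_eq_frag_vertices[OF bond_pos_parity] k by fastforce
    then show ?thesis using 2 by (simp add: bonds_of_def)
  qed (simp_all add: slants_of_def slant_def)
qed

lemma exact_cover_iff_path_matchings:
  assumes K: "K \<subseteq> edges (hex_graph hexes)"
  shows "exact_cover hexes K {} \<longleftrightarrow>
    (\<forall>k\<in>{1..m + 1}. path_matching (first_pos k) (last_pos k) (covered (bonds_of K) k) (slants_of K k))"
proof -
  have deg: "(\<exists>!e. e \<in> K \<and> frag_vertex k q \<in> e) \<longleftrightarrow>
      of_bool (q \<in> covered (bonds_of K) k) + of_bool (q \<in> slants_of K k) + of_bool (q - 1 \<in> slants_of K k) = (1 :: nat)"
    if k: "k \<in> {1..m + 1}" for k q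
    unfolding incident_edges[OF K k] covered_def Un_iff
  proof (rule ex1_among_four)
    show "\<not> (q \<in> bonds_of K k \<and> q \<in> bonds_of K (k - 1))"
      using bond_pos_disjoint[of k q] k by (auto simp: bonds_of_def)
    show "bond k q \<noteq> slant k q \<and> bond k q \<noteq> slant k (q - 1)" if "q \<in> bonds_of K k"
      using slant_neq_bond[of k q] that by (metis (no_types, lifting) bond_pos_parity bonds_of_def mem_Collect_eq)
    show "bond (k - 1) q \<noteq> slant k q \<and> bond (k - 1) q \<noteq> slant k (q - 1)" if "q \<in> bonds_of K (k - 1)"
      using slant_neq_bond[of "k - 1" q] that by (metis (no_types, lifting) bond_pos_parity bonds_of_def mem_Collect_eq)
    show "slant k q \<noteq> slant k (q - 1)" by (simp add: slant_eq_iff)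
  qed
  have "exact_cover hexes K {} \<longleftrightarrow> (\<forall>v\<in>verts (hex_graph hexes). \<exists>!e. e \<in> K \<and> v \<in> e)"
    using K by (simp add: exact_cover_empty_iff)
  also have "\<dots> \<longleftrightarrow> (\<forall>k\<in>{1..m + 1}. \<forall>q\<in>{first_pos k..last_pos k}. \<exists>!e. e \<in> K \<and> frag_vertex k q \<in> e)"
    unfolding verts_hexes by blast
  also have "\<dots> \<longleftrightarrow> (\<forall>k\<in>{1..m + 1}. path_matching (first_pos k) (last_pos k) (covered (bonds_of K) k) (slants_of K k))"
  proof (intro ball_cong refl)
    fix k assume k: "k \<in> {1..m + 1}"
    show "(\<forall>q\<in>{first_pos k..last_pos k}. \<exists>!e. e \<in> K \<and> frag_vertex k q \<in> e) \<longleftrightarrow>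
        path_matching (first_pos k) (last_pos k) (covered (bonds_of K) k) (slants_of K k)"
      unfolding path_matching_def deg[OF k] by (auto simp: slants_of_def)
  qed
  finally show ?thesis .
qed

lemma path_matchings_iff_balanced:
  assumes D: "bond_family D"
  shows "(\<forall>k\<in>{1..m + 1}. path_matching (first_pos k) (last_pos k) (covered D k) (E k)) \<longleftrightarrow>
    balanced D \<and> (\<forall>k\<in>{1..m + 1}. E k = path_edges (first_pos k) (last_pos k) (covered D k))"
proof -
  have "path_matching (first_pos k) (last_pos k) (covered D k) (E k) \<longleftrightarrow>
      ((\<forall>p. excess (first_pos k) (covered D k) p \<in> {0, 1}) \<and>
      excess (first_pos k) (covered D k) (last_pos k) = (if even (last_pos k - first_pos k) then 1 else 0)) \<and>
      E k = path_edges (first_pos k) (last_pos k) (covered D k)" if "k \<in> {1..m + 1}" for k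
    using path_matching_iff[OF covered_subset[OF D], of k "E k"] first_less_last[OF that] that by simp
  then have "(\<forall>k\<in>{1..m + 1}. path_matching (first_pos k) (last_pos k) (covered D k) (E k)) \<longleftrightarrow>
      (\<forall>k\<in>{1..m + 1}. ((\<forall>p. excess (first_pos k) (covered D k) p \<in> {0, 1}) \<and>
      excess (first_pos k) (covered D k) (last_pos k) = (if even (last_pos k - first_pos k) then 1 else 0)) \<and>
      E k = path_edges (first_pos k) (last_pos k) (covered D k))"
    by (intro ball_cong refl)
  then show ?thesis unfolding balanced_def ball_conj_distrib using D by argo
qed

lemma matching_subset:
  assumes "bond_family D"
  shows "matching D \<subseteq> edges (hex_graph hexes)"
proof
  fix e assume "e \<in> matching D"
  then consider k p where "e = bond k p" "k \<in> {1..m}" "p \<in> D k"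
    | k p where "e = slant k p" "k \<in> {1..m + 1}" "p \<in> {first_pos k..<last_pos k}"
    unfolding matching_def path_edges_def by blast
  then show "e \<in> edges (hex_graph hexes)"
  proof cases
    case 1
    then have "p \<in> bond_pos k" using assms by (auto simp: bond_family_def)
    then show ?thesis using 1 unfolding edges_hexes by blast
  next
    case 2
    then show ?thesis unfolding edges_hexes by blast
  qed
qed

lemma bonds_of_matching:
  assumes "bond_family D"
  shows "bonds_of (matching D) = D"
proof
  fix k
  have D: "D k \<subseteq> bond_pos k" "k \<notin> {1..m} \<Longrightarrow> D k = {}" using assms by (auto simp: bond_family_def)
  have "bond k p \<in> matching D \<longleftrightarrow> p \<in> D k" if k: "k \<in> {1..m}" and "p \<in> bond_pos k" for p
    using that slant_neq_bond[OF bond_pos_parity[OF that(2)]] unfolding matching_def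
    by (auto simp: bond_eq_iff)
  then show "bonds_of (matching D) k = D k"
    using D by (cases "k \<in> {1..m}") (auto simp: bonds_of_def)
qed

lemma slants_of_matching:
  assumes D: "bond_family D" and k: "k \<in> {1..m + 1}"
  shows "slants_of (matching D) k = path_edges (first_pos k) (last_pos k) (covered D k)"
proof -
  have "slant k p \<noteq> bond k' p'" if "p' \<in> D k'" for p k' p'
  proof -
    have "p' \<in> bond_pos k'" using that D by (auto simp: bond_family_def)
    then show ?thesis by (intro slant_neq_bond bond_pos_parity)
  qed
  then have "slant k p \<in> matching D \<longleftrightarrow> p \<in> path_edges (first_pos k) (last_pos k) (covered D k)" for p
    unfolding matching_def using k by (auto simp: slant_eq_iff)
  then show ?thesis by (auto simp: slants_of_def path_edges_def)
qed

lemma matching_bonds_of: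
  assumes K: "K \<subseteq> edges (hex_graph hexes)"
    and E: "\<forall>k\<in>{1..m + 1}. slants_of K k = path_edges (first_pos k) (last_pos k) (covered (bonds_of K) k)"
  shows "matching (bonds_of K) = K"
proof (intro equalityI subsetI)
  fix e assume "e \<in> matching (bonds_of K)"
  then show "e \<in> K"
    using E unfolding matching_def bonds_of_def slants_of_def by blast
next
  fix e assume e: "e \<in> K"
  then have "e \<in> edges (hex_graph hexes)" using K by blast
  then consider k p where "e = bond k p" "k \<in> {1..m}" "p \<in> bond_pos k"
    | k p where "e = slant k p" "k \<in> {1..m + 1}" "p \<in> {first_pos k..<last_pos k}"
    unfolding edges_hexes by blast
  then show "e \<in> matching (bonds_of K)"
  proof cases
    case 1
    then have "p \<in> bonds_of K k" using e by (simp add: bonds_of_def)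
    then show ?thesis using 1 unfolding matching_def by blast
  next
    case 2
    then have "p \<in> slants_of K k" using e by (simp add: slants_of_def)
    then show ?thesis using 2 E unfolding matching_def by blast
  qed
qed

lemma exact_cover_iff_balanced:
  assumes "K \<subseteq> edges (hex_graph hexes)"
  shows "exact_cover hexes K {} \<longleftrightarrow> balanced (bonds_of K) \<and>
    (\<forall>k\<in>{1..m + 1}. slants_of K k = path_edges (first_pos k) (last_pos k) (covered (bonds_of K) k))"
  unfolding exact_cover_iff_path_matchings[OF assms] path_matchings_iff_balanced[OF bond_family_bonds_of] ..

lemma bij_betw_matching: "bij_betw matching {D. balanced D} {K. exact_cover hexes K {}}"
proof (rule bij_betw_byWitness[where f' = bonds_of])
  show "\<forall>D\<in>{D. balanced D}. bonds_of (matching D) = D"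
    using bonds_of_matching by (simp add: balanced_def)
  have sub: "K \<subseteq> edges (hex_graph hexes)" if "exact_cover hexes K {}" for K
    using that by (simp add: exact_cover_def)
  have iff: "balanced (bonds_of K) \<and>
      (\<forall>k\<in>{1..m + 1}. slants_of K k = path_edges (first_pos k) (last_pos k) (covered (bonds_of K) k))"
    if "exact_cover hexes K {}" for K
    using exact_cover_iff_balanced[OF sub[OF that]] that by (rule iffD1)
  show "\<forall>K\<in>{K. exact_cover hexes K {}}. matching (bonds_of K) = K"
    using iff by (auto intro!: matching_bonds_of dest: sub)
  show "matching ` {D. balanced D} \<subseteq> {K. exact_cover hexes K {}}"
  proof (intro image_subsetI CollectI)
    fix D assume "D \<in> {D. balanced D}"
    then have D: "balanced D" "bond_family D" by (auto simp: balanced_def)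
    show "exact_cover hexes (matching D) {}"
      using exact_cover_iff_balanced[OF matching_subset[OF D(2)]] D slants_of_matching[OF D(2)]
        bonds_of_matching[OF D(2)] by simp
  qed
  show "bonds_of ` {K. exact_cover hexes K {}} \<subseteq> {D. balanced D}"
    using iff by (simp add: image_subset_iff)
qed

end

section \<open>Interlacing of the bonds of adjacent rows\<close>

text \<open>
  This translates between the enumeration of a set in increasing order and its counting function,
  in terms of which matchings of a fragment are described.
\<close>

lemma increasing_le_iff:
  fixes x :: "nat \<Rightarrow> int"
  assumes x: "strict_mono_on {1..a} x" and j: "j \<in> {1..a}"
  shows "x j \<le> p \<longleftrightarrow> j \<le> card {q \<in> x ` {1..a}. q \<le> p}"
proof -
  have "{q \<in> x ` {1..a}. q \<le> p} = x ` {i \<in> {1..a}. x i \<le> p}" by auto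
  moreover have "inj_on x {i \<in> {1..a}. x i \<le> p}"
    using strict_mono_on_imp_inj_on[OF x] by (rule inj_on_subset) auto
  ultimately have card: "card {q \<in> x ` {1..a}. q \<le> p} = card {i \<in> {1..a}. x i \<le> p}"
    by (simp add: card_image)
  have less: "x i < x i'" if "i \<in> {1..a}" "i' \<in> {1..a}" "i < i'" for i i'
    using x that by (auto simp: strict_mono_on_def)
  show ?thesis
  proof
    assume "x j \<le> p"
    have "{1..j} \<subseteq> {i \<in> {1..a}. x i \<le> p}"
    proof
      fix i assume i: "i \<in> {1..j}"
      then have "x i \<le> x j" using less[of i j] j by (cases "i = j") auto
      then show "i \<in> {i \<in> {1..a}. x i \<le> p}" using i j \<open>x j \<le> p\<close> by auto
    qed
    then have "card {1..j} \<le> card {i \<in> {1..a}. x i \<le> p}" by (intro card_mono) auto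
    then show "j \<le> card {q \<in> x ` {1..a}. q \<le> p}" using card by simp
  next
    assume le: "j \<le> card {q \<in> x ` {1..a}. q \<le> p}"
    show "x j \<le> p"
    proof (rule ccontr)
      assume "\<not> x j \<le> p"
      have "{i \<in> {1..a}. x i \<le> p} \<subseteq> {1..<j}"
      proof
        fix i assume i: "i \<in> {i \<in> {1..a}. x i \<le> p}"
        then have "\<not> j \<le> i" using less[of j i] j \<open>\<not> x j \<le> p\<close> by (cases "i = j") auto
        then show "i \<in> {1..<j}" using i by auto
      qed
      then have "card {i \<in> {1..a}. x i \<le> p} \<le> card {1..<j}" by (intro card_mono) auto
      also have "\<dots> < j" using j by simp
      finally show False using le card by simp
    qed
  qed
qed

lemma increasing_unique:
  fixes x y :: "nat \<Rightarrow> int"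
  assumes "strict_mono_on {1..a} x" "strict_mono_on {1..a} y" "x ` {1..a} = y ` {1..a}" "j \<in> {1..a}"
  shows "x j = y j"
  using increasing_le_iff[OF assms(1,4), of "x j"] increasing_le_iff[OF assms(1,4), of "y j"]
    increasing_le_iff[OF assms(2,4), of "x j"] increasing_le_iff[OF assms(2,4), of "y j"] assms(3)
  by (intro antisym) simp_all

lemma increasing_enumeration:
  fixes A :: "int set"
  assumes "finite A"
  shows "\<exists>x. strict_mono_on {1..card A} x \<and> x ` {1..card A} = A"
proof (intro exI conjI)
  let ?l = "sorted_list_of_set A"
  let ?x = "\<lambda>j. ?l ! (j - 1)"
  have len: "length ?l = card A" by simp
  have "sorted_wrt (<) ?l" by (rule strict_sorted_list_of_set)
  then have less: "?l ! i < ?l ! j" if "i < j" "j < card A" for i j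
    using that sorted_wrt_nth_less[of "(<)" ?l i j] len by simp
  show "strict_mono_on {1..card A} ?x"
    by (rule strict_mono_onI, rule less) auto
  have "?x ` {1..card A} = (!) ?l ` {..<card A}"
  proof -
    have "(\<lambda>j. j - 1) ` {1..card A} = {..<card A}"
    proof (intro equalityI subsetI)
      fix i assume "i \<in> {..<card A}"
      then show "i \<in> (\<lambda>j. j - 1) ` {1..card A}" by (intro image_eqI[of _ _ "i + 1"]) auto
    qed auto
    then show ?thesis by (metis (no_types, lifting) image_cong image_image)
  qed
  also have "\<dots> = set ?l" by (auto simp: set_conv_nth len)
  finally show "?x ` {1..card A} = A" using assms by simp
qed

text \<open>
  For disjoint finite sets this says that their elements alternate in increasing order, beginning
  with \<open>X\<close>.
\<close>

definition interlaced :: "int set \<Rightarrow> int set \<Rightarrow> bool" where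
  "interlaced X Y \<longleftrightarrow> (\<forall>p. int (card {q \<in> X. q \<le> p}) - int (card {q \<in> Y. q \<le> p}) \<in> {0, 1})"

text \<open>
  In one direction take for \<open>p\<close> the elements of the two sets. In the other direction let
  \<open>i\<close> elements of \<open>X\<close> and \<open>j\<close> elements of \<open>Y\<close> be at most \<open>p\<close>:
  below the \<open>j\<close>-th element of \<open>Y\<close> there is the \<open>j\<close>-th element of \<open>X\<close>, and
  below the \<open>i\<close>-th element of \<open>X\<close> the \<open>(i - 1)\<close>-th element of \<open>Y\<close>.
\<close>

lemma interlaced_iff:
  fixes x y :: "nat \<Rightarrow> int"
  assumes x: "strict_mono_on {1..a} x" and y: "strict_mono_on {1..b} y"
    and ab: "b \<le> a" "a \<le> b + 1"
    and disj: "x ` {1..a} \<inter> y ` {1..b} = {}"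
  shows "interlaced (x ` {1..a}) (y ` {1..b}) \<longleftrightarrow>
    (\<forall>j\<in>{1..b}. x j < y j) \<and> (\<forall>j. 1 \<le> j \<and> j + 1 \<le> a \<longrightarrow> y j < x (j + 1))" (is "?l \<longleftrightarrow> ?r")
proof
  let ?A = "\<lambda>p. card {q \<in> x ` {1..a}. q \<le> p}" and ?B = "\<lambda>p. card {q \<in> y ` {1..b}. q \<le> p}"
  {
    assume l: ?l
    have AB: "?B p \<le> ?A p" "?A p \<le> ?B p + 1" for p
    proof -
      have "int (?A p) - int (?B p) \<in> {0, 1}" using l unfolding interlaced_def by blast
      then show "?B p \<le> ?A p" "?A p \<le> ?B p + 1" by auto
    qed
    show ?r
    proof (intro conjI ballI allI impI)
      fix j assume j: "j \<in> {1..b}"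
      have "j \<le> ?A (y j)" using AB(1)[of "y j"] increasing_le_iff[OF y j, of "y j"] by linarith
      then have "x j \<le> y j" using increasing_le_iff[OF x, of j "y j"] j ab by auto
      moreover have "x j \<in> x ` {1..a}" "y j \<in> y ` {1..b}" using j ab by auto
      then have "x j \<noteq> y j" using disj by (metis disjoint_iff)
      ultimately show "x j < y j" by simp
    next
      fix j assume j: "1 \<le> j \<and> j + 1 \<le> a"
      then have j1: "j + 1 \<in> {1..a}" and jb: "j \<in> {1..b}" using ab by auto
      have "j \<le> ?B (x (j + 1))"
        using AB(2)[of "x (j + 1)"] increasing_le_iff[OF x j1, of "x (j + 1)"] by linarith
      then have "y j \<le> x (j + 1)" using increasing_le_iff[OF y jb, of "x (j + 1)"] by simp
      moreover have "x (j + 1) \<in> x ` {1..a}" "y j \<in> y ` {1..b}" using j1 jb by blast+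
      then have "y j \<noteq> x (j + 1)" using disj by (metis disjoint_iff)
      ultimately show "y j < x (j + 1)" by simp
    qed
  }
  {
    assume r: ?r
    show ?l
      unfolding interlaced_def
    proof
      fix p
      have a: "?A p \<le> a" using card_mono[of "x ` {1..a}" "{q \<in> x ` {1..a}. q \<le> p}"] card_image_le[of "{1..a}" x] by auto
      have b: "?B p \<le> b" using card_mono[of "y ` {1..b}" "{q \<in> y ` {1..b}. q \<le> p}"] card_image_le[of "{1..b}" y] by auto
      have "?B p \<le> ?A p"
      proof (cases "?B p = 0")
        case False
        have j: "?B p \<in> {1..b}" using b False unfolding atLeastAtMost_iff by linarith
        then have "y (?B p) \<le> p" using increasing_le_iff[OF y j, of p] by simp
        moreover have "x (?B p) < y (?B p)" using r j by blast
        ultimately show ?thesis using increasing_le_iff[OF x, of "?B p" p] j ab by auto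
      qed linarith
      moreover have "?A p \<le> ?B p + 1"
      proof (cases "?A p \<le> 1")
        case False
        define j where "j = ?A p - 1"
        have j: "1 \<le> j" "j + 1 \<le> a" "?A p = j + 1" using False a by (auto simp: j_def)
        then have j1: "j + 1 \<in> {1..a}" and jb: "j \<in> {1..b}" using ab by auto
        have "x (j + 1) \<le> p" using increasing_le_iff[OF x j1, of p] j by simp
        moreover have "y j < x (j + 1)" using r j by blast
        ultimately show ?thesis using increasing_le_iff[OF y jb, of p] j by auto
      qed linarith
      ultimately show "int (?A p) - int (?B p) \<in> {0, 1}" by auto
    qed
  }
qed

context strip
begin

lemma finite_bond_pos: "finite (bond_pos k)"
  by (rule finite_subset[of _ "{L k..R k}"]) (auto simp: bond_pos_def)

lemma excess_covered:
  assumes D: "bond_family D" and k: "k \<in> {1..m + 1}"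
  shows "excess (first_pos k) (covered D k) p =
    (if L k < L (k - 1) then int (card {q \<in> D k. q \<le> p}) - int (card {q \<in> D (k - 1). q \<le> p})
     else int (card {q \<in> D (k - 1). q \<le> p}) - int (card {q \<in> D k. q \<le> p}))"
proof -
  have Dk: "even (q - L k)" if "q \<in> D k" for q
  proof -
    have "q \<in> bond_pos k" using that D by (auto simp: bond_family_def)
    then have "odd (r0 + int k + q)" by (rule bond_pos_parity)
    then show ?thesis using parity[of k] k by auto
  qed
  have Dk1: "even (q - L (k - 1))" if "q \<in> D (k - 1)" for q
  proof -
    have "q \<in> bond_pos (k - 1)" using that D by (auto simp: bond_family_def)
    then have "odd (r0 + int (k - 1) + q)" by (rule bond_pos_parity)
    moreover have "odd (r0 + int (k - 1) + L (k - 1))" using k by (intro parity) (unfold atLeastAtMost_iff, linarith)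
    ultimately show ?thesis by auto
  qed
  have step: "L k = L (k - 1) + 1 \<or> L k = L (k - 1) - 1" using L_step[of k] k by auto
  show ?thesis
  proof (cases "L k < L (k - 1)")
    case True
    then have first: "first_pos k = L k" "L (k - 1) = L k + 1" using step by (auto simp: first_pos_def)
    have odd: "odd (q - L k)" if "q \<in> D (k - 1)" for q
      using Dk1[OF that] first(2) by simp
    have "{q \<in> covered D k. q \<le> p \<and> even (q - first_pos k)} = {q \<in> D k. q \<le> p}"
      "{q \<in> covered D k. q \<le> p \<and> odd (q - first_pos k)} = {q \<in> D (k - 1). q \<le> p}"
      unfolding first covered_def using Dk odd by blast+
    then show ?thesis using True unfolding excess_def by simp
  next
    case False
    then have first: "first_pos k = L (k - 1)" "L k = L (k - 1) + 1" using step by (auto simp: first_pos_def)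
    have odd: "odd (q - L (k - 1))" if "q \<in> D k" for q
      using Dk[OF that] first(2) by simp
    have "{q \<in> covered D k. q \<le> p \<and> even (q - first_pos k)} = {q \<in> D (k - 1). q \<le> p}"
      "{q \<in> covered D k. q \<le> p \<and> odd (q - first_pos k)} = {q \<in> D k. q \<le> p}"
      unfolding first(1) covered_def using Dk1 odd by blast+
    then show ?thesis using False unfolding excess_def by simp
  qed
qed

text \<open>
  In fragment \<open>k\<close> the row that reaches further to the left owns the first bond and plays the
  role of \<open>X\<close>. The excess at the right end is the difference of the numbers of bonds; its
  prescribed value, which depends on the row that owns the last bond, is the difference of the
  lengths of the rows.
\<close>

lemma balanced_iff_interlaced:
  assumes D: "bond_family D"
  shows "balanced D \<longleftrightarrow> (\<forall>k\<in>{1..m + 1}.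
     (if L k < L (k - 1) then interlaced (D k) (D (k - 1)) else interlaced (D (k - 1)) (D k)) \<and>
     int (card (D k)) - int (card (D (k - 1))) = int (w k) - int (w (k - 1)))"
proof -
  have "((\<forall>p. excess (first_pos k) (covered D k) p \<in> {0, 1}) \<and>
      excess (first_pos k) (covered D k) (last_pos k) = (if even (last_pos k - first_pos k) then 1 else 0)) \<longleftrightarrow>
     ((if L k < L (k - 1) then interlaced (D k) (D (k - 1)) else interlaced (D (k - 1)) (D k)) \<and>
      int (card (D k)) - int (card (D (k - 1))) = int (w k) - int (w (k - 1)))"
    if k: "k \<in> {1..m + 1}" for k
  proof -
    have "{q \<in> D k. q \<le> last_pos k} = D k" "{q \<in> D (k - 1). q \<le> last_pos k} = D (k - 1)"
      using covered_subset[OF D, of k] k by (auto simp: covered_def)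
    then have last: "excess (first_pos k) (covered D k) (last_pos k) =
        (if L k < L (k - 1) then int (card (D k)) - int (card (D (k - 1)))
         else int (card (D (k - 1))) - int (card (D k)))"
      unfolding excess_covered[OF D k] by simp
    have "L k = L (k - 1) + 1 \<or> L k = L (k - 1) - 1" "R k = R (k - 1) + 1 \<or> R k = R (k - 1) - 1"
      using L_step[of k] R_step[of k] k by auto
    moreover have "R k = L k + 2 * int (w k)" "R (k - 1) = L (k - 1) + 2 * int (w (k - 1))"
      by (simp_all add: R_def)
    ultimately have "(if even (last_pos k - first_pos k) then 1 else 0) =
        (if L k < L (k - 1) then int (w k) - int (w (k - 1)) else int (w (k - 1)) - int (w k))"
      unfolding first_pos_def last_pos_def by (elim disjE) auto
    then have "excess (first_pos k) (covered D k) (last_pos k) = (if even (last_pos k - first_pos k) then 1 else 0) \<longleftrightarrow>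
        int (card (D k)) - int (card (D (k - 1))) = int (w k) - int (w (k - 1))"
      unfolding last by auto
    moreover have "(\<forall>p. excess (first_pos k) (covered D k) p \<in> {0, 1}) \<longleftrightarrow>
        (if L k < L (k - 1) then interlaced (D k) (D (k - 1)) else interlaced (D (k - 1)) (D k))"
      unfolding excess_covered[OF D k] interlaced_def by simp
    ultimately show ?thesis by argo
  qed
  then show ?thesis unfolding balanced_def using D by simp
qed

text \<open>
  The number of used bonds of a row minus its length is the same for all rows, and it is \<open>1 - n\<close>
  on the virtual top row.
\<close>

lemma card_if_balanced:
  assumes "balanced D" and "k \<le> m + 1"
  shows "int (card (D k)) = int (w k) + 1 - int n"
  using assms(2)
proof (induction k)
  case 0
  have "D 0 = {}" using assms(1) by (simp add: balanced_def bond_family_def)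
  then show ?case using w_0 n_pos by simp
next
  case (Suc k)
  have "bond_family D" using assms(1) by (simp add: balanced_def)
  then have "int (card (D (Suc k))) - int (card (D (Suc k - 1))) = int (w (Suc k)) - int (w (Suc k - 1))"
    using balanced_iff_interlaced[THEN iffD1, OF _ assms(1)] Suc.prems by fastforce
  then show ?case using Suc by simp
qed

end

section \<open>The rank function of the poset of a strip\<close>

context strip
begin

lemma finite_hexes: "finite hexes"
proof (rule finite_subset)
  show "hexes \<subseteq> (\<Union>k\<in>{1..m}. (\<lambda>x. (r0 + int k, x)) ` {L k..R k})"
    by (auto simp: hexes_def)
qed auto

lemma row_hexes:
  assumes "k \<in> {1..m}"
  shows "row hexes k = {(r0 + int k, x) | x. L k < x \<and> x < R k \<and> even (r0 + int k + x)}"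
proof -
  have first: "(r0 + int k, L k + 1) \<in> hexes" if "k \<in> {1..m}" for k
    using that R_ge[of k] parity[of k] by (intro hexes_D) auto
  have "Min (fst ` hexes) = r0 + 1"
  proof (rule Min_eqI)
    show "finite (fst ` hexes)" using finite_hexes by simp
    show "r0 + 1 \<le> y" if "y \<in> fst ` hexes" for y using that by (auto simp: hexes_def)
    show "r0 + 1 \<in> fst ` hexes" using first[of 1] m_pos by (force simp: image_iff)
  qed
  then show ?thesis using assms by (auto simp: row_def hexes_def)
qed

lemma iface_hexes:
  assumes k: "k \<in> {1..m}"
  shows "iface hexes k = bond k ` bond_pos k"
proof (intro equalityI subsetI)
  fix e assume "e \<in> iface hexes k"
  then obtain h where "h \<in> row hexes k" and e: "e = left_edge h \<or> e = right_edge h"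
    unfolding iface_def by blast
  then obtain x where h: "h = (r0 + int k, x)" and x: "L k < x" "x < R k" "even (r0 + int k + x)"
    unfolding row_hexes[OF k] by blast
  have "e = bond k (x - 1) \<or> e = bond k (x + 1)"
    using e unfolding h vertical_edges_eq .
  moreover have "x - 1 \<in> bond_pos k" "x + 1 \<in> bond_pos k" using x by (auto simp: bond_pos_def)
  ultimately show "e \<in> bond k ` bond_pos k" by blast
next
  fix e assume "e \<in> bond k ` bond_pos k"
  then obtain p where e: "e = bond k p" and p: "p \<in> bond_pos k" by blast
  show "e \<in> iface hexes k"
  proof (cases "p < R k")
    case True
    then have "(r0 + int k, p + 1) \<in> row hexes k"
      unfolding row_hexes[OF k] using p R_neq[of k p] k by (auto simp: bond_pos_def)
    then have "left_edge (r0 + int k, p + 1) \<in> iface hexes k" unfolding iface_def by blast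
    then show ?thesis using e vertical_edges_eq(1)[of k "p + 1"] by simp
  next
    case False
    then have "(r0 + int k, p - 1) \<in> row hexes k"
      unfolding row_hexes[OF k] using p R_ge[OF k] by (auto simp: bond_pos_def)
    then have "right_edge (r0 + int k, p - 1) \<in> iface hexes k" unfolding iface_def by blast
    then show ?thesis using e vertical_edges_eq(2)[of k "p - 1"] by simp
  qed
qed

lemma bond_pos_eq_image:
  assumes "k \<le> m + 1"
  shows "bond_pos k = (\<lambda>i. L k + 2 * int i) ` {..w k}"
proof (intro equalityI subsetI)
  fix p assume p: "p \<in> bond_pos k"
  then have "even (p - L k)" using parity[OF assms] by (auto simp: bond_pos_def)
  then obtain d where d: "p - L k = 2 * d" by blast
  then have "0 \<le> d" "d \<le> int (w k)" using p by (auto simp: bond_pos_def R_def)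
  then have "p = L k + 2 * int (nat d)" "nat d \<le> w k" using d by auto
  then show "p \<in> (\<lambda>i. L k + 2 * int i) ` {..w k}" by blast
qed (use parity[OF assms] in \<open>auto simp: bond_pos_def R_def\<close>)

lemma card_iface_hexes:
  assumes k: "k \<in> {1..m}"
  shows "card (iface hexes k) = w k + 1"
proof -
  have "card (bond k ` bond_pos k) = card (bond_pos k)"
    by (rule card_image) (simp add: inj_on_def bond_eq_iff)
  also have "\<dots> = card ((\<lambda>i. L k + 2 * int i) ` {..w k})" using k by (subst bond_pos_eq_image) simp_all
  also have "\<dots> = card {..w k}" by (rule card_image) (simp add: inj_on_def)
  finally show ?thesis unfolding iface_hexes[OF k] by simp
qed

lemma hpos_bond: "hpos (bond k p) = p"
  by (simp add: hpos_def bond_def)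

lemma L_in_bond_pos: "k \<le> m + 1 \<Longrightarrow> L k \<in> bond_pos k"
  using parity[of k] by (simp add: bond_pos_def R_def)

lemma bond_in_iface: "k' \<in> {1..m} \<Longrightarrow> bond k p \<in> iface hexes k' \<longleftrightarrow> k = k' \<and> p \<in> bond_pos k'"
  by (auto simp: iface_hexes bond_eq_iff)

lemma first_bond_hexes:
  assumes k: "k \<in> {1..m}" "k - 1 \<in> {1..m}"
  shows "first_bond hexes k = (if L (k - 1) < L k then bond (k - 1) (L (k - 1)) else bond k (L k))" (is "_ = ?b")
proof -
  have step: "L k = L (k - 1) + 1 \<or> L k = L (k - 1) - 1" using L_step[of k] k by simp
  have bonds: "interface_bonds hexes k = bond (k - 1) ` bond_pos (k - 1) \<union> bond k ` bond_pos k"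
    unfolding interface_bonds_def iface_hexes[OF k(1)] iface_hexes[OF k(2)] ..
  have "L k \<in> bond_pos k" "L (k - 1) \<in> bond_pos (k - 1)" using L_in_bond_pos k by auto
  then have mem: "?b \<in> interface_bonds hexes k" unfolding bonds by auto
  have min: "hpos ?b < hpos e" if e: "e \<in> interface_bonds hexes k" "e \<noteq> ?b" for e
  proof -
    obtain k' p where kp: "e = bond k' p" "p \<in> bond_pos k'" "k' = k \<or> k' = k - 1"
      using e(1) unfolding bonds by blast
    then have "L k' \<le> p" by (simp add: bond_pos_def)
    then show ?thesis using kp e(2) step by (auto simp: hpos_bond split: if_splits)
  qed
  show ?thesis
    unfolding first_bond_def arg_min_def is_arg_min_def
  proof (rule some_equality)
    show "?b \<in> interface_bonds hexes k \<and> (\<nexists>y. y \<in> interface_bonds hexes k \<and> hpos y < hpos ?b)"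
    proof (intro conjI notI mem)
      assume "\<exists>y. y \<in> interface_bonds hexes k \<and> hpos y < hpos ?b"
      then obtain y where y: "y \<in> interface_bonds hexes k" "hpos y < hpos ?b" by blast
      then show False using min[of y] by (cases "y = ?b") (simp, linarith)
    qed
    show "e = ?b" if "e \<in> interface_bonds hexes k \<and> (\<nexists>y. y \<in> interface_bonds hexes k \<and> hpos y < hpos e)" for e
    proof (rule ccontr)
      assume "e \<noteq> ?b"
      then show False using that mem min[of e] by blast
    qed
  qed
qed

text \<open>
  The number \<open>ord(i_k)\<close> of poset elements in row \<open>k\<close>, truncated at 0.
\<close>

definition width :: "nat \<Rightarrow> nat" where "width k = w k + 1 - n"

definition elements :: "(nat \<times> nat) set" where
  "elements = {(k, j). k \<in> {1..m} \<and> j \<in> {1..width k}}"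

text \<open>
  The \<open>j\<close>-th bond position of row \<open>k\<close>, that is, the leftmost one which the \<open>j\<close>-th
  selected bond can have.
\<close>

definition rank :: "nat \<times> nat \<Rightarrow> int" where
  "rank s = L (fst s) + 2 * (int (snd s) - 1)"

lemma strip_poset_hexes: "strip_poset m n hexes = elements"
proof -
  have "int j \<le> iface_ord n hexes k \<longleftrightarrow> j \<le> width k" if "k \<in> {1..m}" "1 \<le> j" for k j
    using that card_iface_hexes[of k] by (auto simp: iface_ord_def width_def)
  then show ?thesis unfolding strip_poset_def elements_def by auto
qed

lemma finite_elements: "finite elements"
  by (rule finite_subset[of _ "Sigma {1..m} (\<lambda>k. {1..width k})"]) (auto simp: elements_def)

lemma L_adjacent:
  assumes "k \<in> {1..m}" "k' \<in> {1..m}" and adj: "k' = k + 1 \<or> k = k' + 1"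
  shows "L k' = L k + 1 \<or> L k' = L k - 1"
  using adj
proof
  assume "k' = k + 1"
  then show ?thesis using L_step[of k'] assms by simp
next
  assume "k = k' + 1"
  then have "L k = L k' + 1 \<or> L k = L k' - 1" using L_step[of k] assms by simp
  then show ?thesis by linarith
qed

text \<open>
  The two cases in the definition of the covers are the two possible shifts between adjacent rows:
  if the lower element lies in the row reaching further to the left, then \<open>j' = j\<close>
  moves one half unit to the right; otherwise the shift is by one half unit to the left and has to be
  compensated by \<open>j' = j + 1\<close>, which moves by two.
\<close>

lemma strip_covers_hexes:
  "((k, j), (k', j')) \<in> strip_covers m n hexes \<longleftrightarrow>
    (k, j) \<in> elements \<and> (k', j') \<in> elements \<and> (k' = k + 1 \<or> k = k' + 1) \<and> rank (k', j') = rank (k, j) + 1"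
proof -
  have main: "(let b = first_bond hexes (max k k') in
        (b \<in> iface hexes k \<and> int j' - int j = 0) \<or> (b \<in> iface hexes k' \<and> int j' - int j = 1)) \<longleftrightarrow>
      rank (k', j') = rank (k, j) + 1"
    if k: "k \<in> {1..m}" "k' \<in> {1..m}" and adj: "k' = k + 1 \<or> k = k' + 1"
  proof -
    have L: "L k \<in> bond_pos k" "L k' \<in> bond_pos k'" using L_in_bond_pos k by auto
    have step: "L k' = L k + 1 \<or> L k' = L k - 1"
      by (rule L_adjacent[OF k adj])
    have fb: "first_bond hexes (max k k') = (if L k < L k' then bond k (L k) else bond k' (L k'))"
      using adj
    proof
      assume "k' = k + 1"
      then have kk: "k' - 1 = k" "max k k' = k'" by auto
      show ?thesis unfolding kk(2) by (rule first_bond_hexes[of k', unfolded kk(1), OF k(2) k(1)])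
    next
      assume "k = k' + 1"
      then have kk: "k - 1 = k'" "max k k' = k" by auto
      have "L k' < L k \<longleftrightarrow> \<not> L k < L k'" using step by linarith
      then show ?thesis
        unfolding kk(2) first_bond_hexes[of k, unfolded kk(1), OF k(1) k(2)] by simp
    qed
    have ne: "k \<noteq> k'" using adj by auto
    show ?thesis
    proof (cases "L k < L k'")
      case True
      then have eq: "L k' = L k + 1" using step by linarith
      have "first_bond hexes (max k k') = bond k (L k)" using fb True by simp
      then have "(let b = first_bond hexes (max k k') in
        (b \<in> iface hexes k \<and> int j' - int j = 0) \<or> (b \<in> iface hexes k' \<and> int j' - int j = 1)) \<longleftrightarrow> j' = j"
        using L(1) ne by (simp add: bond_in_iface[OF k(1)] bond_in_iface[OF k(2)])
      then show ?thesis by (auto simp: rank_def eq)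
    next
      case False
      then have eq: "L k = L k' + 1" using step by linarith
      have "first_bond hexes (max k k') = bond k' (L k')" using fb False by simp
      then have "(let b = first_bond hexes (max k k') in
        (b \<in> iface hexes k \<and> int j' - int j = 0) \<or> (b \<in> iface hexes k' \<and> int j' - int j = 1)) \<longleftrightarrow> j' = j + 1"
        using L(2) ne by (auto simp: bond_in_iface[OF k(1)] bond_in_iface[OF k(2)])
      then show ?thesis by (auto simp: rank_def eq)
    qed
  qed
  have adj: "\<bar>int k' - int k\<bar> = 1 \<longleftrightarrow> k' = k + 1 \<or> k = k' + 1" by linarith
  have "((k, j), (k', j')) \<in> strip_covers m n hexes \<longleftrightarrow>
      (k, j) \<in> elements \<and> (k', j') \<in> elements \<and> \<bar>int k' - int k\<bar> = 1 \<and>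
      (let b = first_bond hexes (max k k') in
        (b \<in> iface hexes k \<and> int j' - int j = 0) \<or> (b \<in> iface hexes k' \<and> int j' - int j = 1))"
    unfolding strip_covers_def strip_poset_hexes mem_Collect_eq prod.case ..
  moreover have "k \<in> {1..m}" if "(k, j) \<in> elements" for k j using that by (simp add: elements_def)
  ultimately show ?thesis using main adj by meson
qed

abbreviation less_rel :: "((nat \<times> nat) \<times> (nat \<times> nat)) set" where
  "less_rel \<equiv> strip_less m n hexes"

lemma strip_covers_rank:
  "(s, t) \<in> strip_covers m n hexes \<Longrightarrow> s \<in> elements \<and> t \<in> elements \<and> rank t = rank s + 1"
  by (cases s; cases t) (simp only: strip_covers_hexes simp_thms)

lemma less_rel_rank:
  assumes "(s, t) \<in> less_rel"
  shows "s \<in> elements \<and> t \<in> elements \<and> rank s < rank t"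
  using assms unfolding strip_less_def
proof (induction rule: trancl_induct)
  case (base t)
  then show ?case using strip_covers_rank[of s t] by simp
next
  case (step t u)
  then show ?case using strip_covers_rank[of t u] by simp
qed

lemma trans_less_rel: "trans less_rel"
  by (simp add: strip_less_def)

lemma irrefl_less_rel: "irrefl less_rel"
  using less_rel_rank by (auto simp: irrefl_def)

lemma cover_in_less_rel:
  "(k, j) \<in> elements \<Longrightarrow> (k', j') \<in> elements \<Longrightarrow> k' = k + 1 \<or> k = k' + 1 \<Longrightarrow>
    rank (k', j') = rank (k, j) + 1 \<Longrightarrow> ((k, j), (k', j')) \<in> less_rel"
  unfolding strip_less_def by (intro r_into_trancl) (simp add: strip_covers_hexes)

end

text \<open>
  The condition says that \<open>ord\<close> is nowhere negative. It follows from the existence of a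
  Kekule structure, since \<open>ord(i_k)\<close> is the number of its bonds in row \<open>k\<close>.
\<close>

locale kekulean_strip = strip +
  assumes n_le: "k \<le> m + 1 \<Longrightarrow> n \<le> w k + 1"
begin

lemma width_diff:
  assumes "1 \<le> k" "k \<le> m + 1"
  shows "2 * (int (width k) - int (width (k - 1))) = (R k - R (k - 1)) - (L k - L (k - 1))"
proof -
  have "n \<le> w k + 1" "n \<le> w (k - 1) + 1" using n_le assms by auto
  then show ?thesis by (simp add: width_def R_def)
qed

lemma width_ends: "width 0 = 0" "width (m + 1) = 0"
  using w_0 w_Suc_m n_pos by (auto simp: width_def)

text \<open>
  Between two consecutive elements of a row there is an element of the row above. It exists because
  of two adjacent rows the one reaching further to the left has as many elements as the other or one
  more, and because the virtual row 0 has none.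
\<close>

lemma less_rel_next_in_row:
  assumes "(k, j) \<in> elements" "(k, j + 1) \<in> elements"
  shows "((k, j), (k, j + 1)) \<in> less_rel"
proof -
  have arith1: "j \<le> b" if "r = r' + 1 \<or> r = r' - 1" "2 * (int a - int b) = (r - r') - (l - l')" "l' = l + 1" "j + 1 \<le> a"
    for a b j :: nat and r r' l l' :: int
  proof -
    have "int j + 1 \<le> int a" using that(4) by simp
    then have "int j \<le> int b" using that(1,2,3) by presburger
    then show ?thesis by simp
  qed
  have arith2: "j + 1 \<le> b" if "r = r' + 1 \<or> r = r' - 1" "2 * (int a - int b) = (r - r') - (l - l')" "l = l' + 1" "j + 1 \<le> a"
    for a b j :: nat and r r' l l' :: int
  proof -
    have "int j + 1 \<le> int a" using that(4) by simp
    then have "int j + 1 \<le> int b" using that(1,2,3) by presburger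
    then show ?thesis by simp
  qed
  have k: "k \<in> {1..m}" and j: "1 \<le> j" "j + 1 \<le> width k" using assms by (auto simp: elements_def)
  \<comment> \<open>the index in row \<open>k - 1\<close> of the element whose rank is larger by 1\<close>
  define i where "i = (if L (k - 1) = L k + 1 then j else j + 1)"
  have L: "L k = L (k - 1) + 1 \<or> L k = L (k - 1) - 1" using k by (intro L_step) simp_all
  have R: "R k = R (k - 1) + 1 \<or> R k = R (k - 1) - 1" using k by (intro R_step) simp_all
  have W: "2 * (int (width k) - int (width (k - 1))) = (R k - R (k - 1)) - (L k - L (k - 1))"
    using k by (intro width_diff) simp_all
  have "i \<le> width (k - 1)"
  proof (cases "L (k - 1) = L k + 1")
    case True
    then have "i = j" by (simp add: i_def)
    then show ?thesis using arith1[OF R W True j(2)] by simp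
  next
    case False
    then have "i = j + 1" "L k = L (k - 1) + 1" using L by (simp add: i_def, linarith)
    then show ?thesis using arith2[OF R W _ j(2)] by simp
  qed
  moreover have "1 \<le> i" using j by (simp add: i_def)
  ultimately have i: "1 \<le> i" "i \<le> width (k - 1)" by auto
  then have "k \<noteq> 1" using width_ends by auto
  then have el: "(k - 1, i) \<in> elements" using i k by (auto simp: elements_def)
  have "rank (k - 1, i) = rank (k, j) + 1"
  proof (cases "L (k - 1) = L k + 1")
    case False
    then have "L k = L (k - 1) + 1" using L by linarith
    then show ?thesis by (simp add: rank_def i_def)
  qed (simp add: rank_def i_def)
  moreover have "rank (k, j + 1) = rank (k, j) + 2" by (simp add: rank_def)
  ultimately have "((k, j), (k - 1, i)) \<in> less_rel" "((k - 1, i), (k, j + 1)) \<in> less_rel"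
    using assms el k by (auto intro!: cover_in_less_rel)
  then show ?thesis using trans_less_rel by (meson transD)
qed

lemma less_rel_row:
  assumes "(k, j) \<in> elements" "(k, j + Suc d) \<in> elements"
  shows "((k, j), (k, j + Suc d)) \<in> less_rel"
  using assms(2)
proof (induction d)
  case 0
  then show ?case using less_rel_next_in_row assms(1) by simp
next
  case (Suc d)
  then have "(k, j + Suc d) \<in> elements" by (auto simp: elements_def)
  then have "((k, j), (k, j + Suc d)) \<in> less_rel" "((k, j + Suc d), (k, j + Suc d + 1)) \<in> less_rel"
    using Suc less_rel_next_in_row by auto
  then show ?case using trans_less_rel by (metis Suc_eq_plus1 add_Suc_right transD)
qed

text \<open>
  Within a row and between adjacent rows the order is determined by the rank: go to the other row by
  a cover and then to the right inside that row.
\<close>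

lemma less_rel_if_rank_less:
  assumes s: "(k, j) \<in> elements" and t: "(k', j') \<in> elements"
    and near: "k' = k \<or> k' = k + 1 \<or> k = k' + 1" and less: "rank (k, j) < rank (k', j')"
  shows "((k, j), (k', j')) \<in> less_rel"
proof (cases "k' = k")
  case True
  then have "j < j'" using less by (simp add: rank_def)
  then obtain d where "j' = j + Suc d" using less_imp_Suc_add by auto
  then show ?thesis using less_rel_row s t True by simp
next
  case False
  then have adj: "k' = k + 1 \<or> k = k' + 1" using near by simp
  have k: "k \<in> {1..m}" "k' \<in> {1..m}" using s t by (auto simp: elements_def)
  then have L: "L k' = L k + 1 \<or> L k' = L k - 1"
    using adj by (rule L_adjacent)
  \<comment> \<open>the element of row \<open>k'\<close> that covers \<open>(k, j)\<close>\<close>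
  define i where "i = (if L k' = L k + 1 then j else j + 1)"
  have rank_i: "rank (k', i) = rank (k, j) + 1"
  proof (cases "L k' = L k + 1")
    case False
    then have "L k = L k' + 1" using L by linarith
    then show ?thesis by (simp add: rank_def i_def)
  qed (simp add: rank_def i_def)
  then have i: "i \<le> j'" using less by (simp add: rank_def)
  then have el: "(k', i) \<in> elements" using s t by (auto simp: elements_def i_def)
  have cover: "((k, j), (k', i)) \<in> less_rel"
    using s el adj rank_i by (rule cover_in_less_rel)
  show ?thesis
  proof (cases "i = j'")
    case False
    then obtain d where "j' = i + Suc d" using i less_imp_Suc_add[of i j'] by auto
    then have "((k', i), (k', j')) \<in> less_rel" using less_rel_row el t by simp
    then show ?thesis using cover trans_less_rel by (meson transD)
  qed (use cover in simp)
qed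

end

section \<open>Kekule structures as order-preserving maps\<close>

lemma path_matching_before_covered:
  assumes "path_matching a b C E" "a \<le> x" "x + 1 \<le> b" "x + 1 \<in> C"
  shows "x - 1 \<in> E \<longleftrightarrow> x \<notin> C"
proof -
  have *: "of_bool (p \<in> C) + of_bool (p \<in> E) + of_bool (p - 1 \<in> E) = (1 :: nat)" if "p \<in> {a..b}" for p
    using assms(1) that by (simp add: path_matching_def)
  have "x \<notin> E" using *[of "x + 1"] assms(2-4) by (simp split: if_splits)
  then show ?thesis using *[of x] assms(2,3) by (cases "x \<in> C"; cases "x - 1 \<in> E") simp_all
qed

context strip
begin

text \<open>
  The vertex at \<open>x + 1\<close> is matched by the right edge of the hexagon. So in each of the two
  adjacent fragments the vertex at \<open>x\<close> can only be matched by a vertical bond or by the edge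
  to \<open>x - 1\<close>, which is the upper left or the lower left edge of the hexagon.
\<close>

lemma sextet_iff:
  assumes D: "balanced D" and k: "k \<in> {1..m}"
  shows "(r0 + int k, x) \<in> proper_sextets hexes (matching D) \<longleftrightarrow>
    L k < x \<and> x + 1 \<in> D k \<and> x \<notin> D (k - 1) \<and> x \<notin> D (k + 1)"
proof -
  have fam: "bond_family D" using D by (simp add: balanced_def)
  have D_sub: "D i \<subseteq> bond_pos i" for i using fam by (simp add: bond_family_def)
  have pm: "path_matching (first_pos i) (last_pos i) (covered D i) (slants_of (matching D) i)"
    if "i \<in> {1..m + 1}" for i
    using path_matchings_iff_balanced[OF fam, of "slants_of (matching D)"] D slants_of_matching[OF fam] that
    by blast
  have right: "bond k (x + 1) \<in> matching D \<longleftrightarrow> x + 1 \<in> D k" if "x + 1 \<in> bond_pos k"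
  proof -
    have "x + 1 \<in> D k \<longleftrightarrow> x + 1 \<in> bonds_of (matching D) k" using bonds_of_matching[OF fam] by simp
    then show ?thesis using that k by (simp add: bonds_of_def)
  qed
  have slants: "slant k (x - 1) \<in> matching D \<and> slant (k + 1) (x - 1) \<in> matching D \<longleftrightarrow>
      x \<notin> D (k - 1) \<and> x \<notin> D (k + 1)"
    if x: "L k < x" "x + 1 \<in> D k"
  proof -
    have xb: "x + 1 \<in> bond_pos k" using x D_sub by blast
    then have R: "x + 1 \<le> R k" by (simp add: bond_pos_def)
    have "x \<notin> bond_pos k" using bond_pos_parity[OF xb] bond_pos_parity[of x k] by auto
    then have xk: "x \<notin> D k" using D_sub by blast
    have "slant i (x - 1) \<in> matching D \<longleftrightarrow> x \<notin> covered D i" if i: "i = k \<or> i = k + 1" for i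
    proof -
      have bd: "first_pos i \<le> L k" "R k \<le> last_pos i" using i by (auto simp: first_pos_def last_pos_def)
      have im: "i \<in> {1..m + 1}" using i k by auto
      have cov: "x + 1 \<in> covered D i" using x i by (auto simp: covered_def)
      have "x - 1 \<in> slants_of (matching D) i \<longleftrightarrow> x \<notin> covered D i"
        using bd x R by (intro path_matching_before_covered[OF pm[OF im] _ _ cov]) linarith+
      moreover have "x - 1 \<in> {first_pos i..<last_pos i}" using bd x R by simp
      ultimately show ?thesis by (simp add: slants_of_def)
    qed
    from this[of k] this[of "k + 1"] show ?thesis using xk by (auto simp: covered_def)
  qed
  show ?thesis
  proof (cases "L k < x \<and> x + 1 \<in> bond_pos k")
    case True
    then have ev: "even (r0 + int k + x)" using bond_pos_parity[of "x + 1" k] by auto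
    have "x + 1 \<le> R k" using True by (simp add: bond_pos_def)
    then have "(r0 + int k, x) \<in> hexes"
      using True ev k by (intro hexes_D) simp_all
    then have "(r0 + int k, x) \<in> proper_sextets hexes (matching D) \<longleftrightarrow>
        bond k (x + 1) \<in> matching D \<and> slant k (x - 1) \<in> matching D \<and> slant (k + 1) (x - 1) \<in> matching D"
      by (simp only: proper_sextets_def sextet_edges_def vertical_edges_eq slanted_edges_eq[OF ev]
          mem_Collect_eq insert_subset empty_subsetI simp_thms)
    then show ?thesis using right slants True by blast
  next
    case False
    have "(r0 + int k, x) \<notin> hexes"
    proof
      assume "(r0 + int k, x) \<in> hexes"
      then have "L k < x" "x < R k" "even (r0 + int k + x)" by (auto simp: hexes_def)
      then show False using False by (auto simp: bond_pos_def)
    qed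
    then have "(r0 + int k, x) \<notin> proper_sextets hexes (matching D)" by (simp add: proper_sextets_def)
    then show ?thesis using False D_sub by blast
  qed
qed

end

context kekulean_strip
begin

lemma int_width: "k \<le> m + 1 \<Longrightarrow> int (width k) = int (w k) + 1 - int n"
  using n_le[of k] by (simp add: width_def)

lemma mem_elements: "k \<le> m + 1 \<Longrightarrow> (k, j) \<in> elements \<longleftrightarrow> j \<in> {1..width k}"
  using width_ends by (cases "k = 0"; cases "k = m + 1") (auto simp: elements_def)

text \<open>
  At either end adjacent rows are shifted by half a unit. The left end gives the row that reaches
  further to the left half a hexagon more than the other, the right end adds or removes another half.
\<close>

lemma widths_adjacent:
  assumes "k \<le> m + 1" "k' \<le> m + 1" "k' = k + 1 \<or> k = k' + 1" "L k < L k'"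
  shows "width k' \<le> width k" "width k \<le> width k' + 1" "L k' = L k + 1"
proof -
  have arith: "b \<le> a \<and> a \<le> b + 1 \<and> l' = l + 1"
    if "l' = l + 1 \<or> l' = l - 1" "r' = r + 1 \<or> r' = r - 1" "l < l'"
      "2 * (int b - int a) = (r' - r) - (l' - l)" for a b :: nat and l l' r r' :: int
    using that by presburger
  have "width k' \<le> width k \<and> width k \<le> width k' + 1 \<and> L k' = L k + 1"
    using assms(3)
  proof
    assume eq: "k' = k + 1"
    then have k: "k' - 1 = k" "1 \<le> k'" by auto
    show ?thesis
      using arith[OF L_step[of k', unfolded k(1)] R_step[of k', unfolded k(1)] assms(4)
          width_diff[of k', unfolded k(1)]] k(2) assms(2) by blast
  next
    assume eq: "k = k' + 1"
    then have k: "k - 1 = k'" "1 \<le> k" by auto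
    have 1: "L k' = L k + 1 \<or> L k' = L k - 1" using L_step[of k, unfolded k(1)] k(2) assms(1) by linarith
    have 2: "R k' = R k + 1 \<or> R k' = R k - 1" using R_step[of k, unfolded k(1)] k(2) assms(1) by linarith
    have 3: "2 * (int (width k') - int (width k)) = (R k' - R k) - (L k' - L k)"
      using width_diff[of k, unfolded k(1), OF k(2) assms(1)] by presburger
    show ?thesis by (rule arith[OF 1 2 assms(4) 3])
  qed
  then show "width k' \<le> width k" "width k \<le> width k' + 1" "L k' = L k + 1" by blast+
qed

text \<open>
  The same criterion without reference to which of the two rows is the upper one, as needed for
  covers, which go upwards as well as downwards.
\<close>

lemma balanced_iff_adjacent:
  assumes fam: "bond_family D"
  shows "balanced D \<longleftrightarrow> (\<forall>k\<le>m + 1. card (D k) = width k) \<and>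
    (\<forall>k\<le>m + 1. \<forall>k'\<le>m + 1. (k' = k + 1 \<or> k = k' + 1) \<and> L k < L k' \<longrightarrow> interlaced (D k) (D k'))"
proof (intro iffI conjI allI impI)
  assume bal: "balanced D"
  fix k assume "k \<le> m + 1"
  then show "card (D k) = width k"
    using card_if_balanced[OF bal] int_width by fastforce
next
  assume bal: "balanced D"
  have inter: "if L i < L (i - 1) then interlaced (D i) (D (i - 1)) else interlaced (D (i - 1)) (D i)"
    if "i \<in> {1..m + 1}" for i
    using balanced_iff_interlaced[OF fam] bal that by blast
  fix k k' assume k: "k \<le> m + 1" "k' \<le> m + 1" and adj: "(k' = k + 1 \<or> k = k' + 1) \<and> L k < L k'"
  from adj have "k' = k + 1 \<or> k = k' + 1" by blast
  then show "interlaced (D k) (D k')"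
  proof
    assume "k' = k + 1"
    then show ?thesis using inter[of k'] k adj by simp
  next
    assume "k = k' + 1"
    then show ?thesis using inter[of k] k adj by simp
  qed
next
  assume asm: "(\<forall>k\<le>m + 1. card (D k) = width k) \<and>
    (\<forall>k\<le>m + 1. \<forall>k'\<le>m + 1. (k' = k + 1 \<or> k = k' + 1) \<and> L k < L k' \<longrightarrow> interlaced (D k) (D k'))"
  show "balanced D"
    unfolding balanced_iff_interlaced[OF fam]
  proof (intro ballI conjI)
    fix k assume k: "k \<in> {1..m + 1}"
    then have k1: "k \<le> m + 1" "k - 1 \<le> m + 1" "k = k - 1 + 1" by auto
    have "L k < L (k - 1) \<or> L (k - 1) < L k" using L_step[of k] k by auto
    then show "if L k < L (k - 1) then interlaced (D k) (D (k - 1)) else interlaced (D (k - 1)) (D k)"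
      using asm k1 by auto
    show "int (card (D k)) - int (card (D (k - 1))) = int (w k) - int (w (k - 1))"
      using asm k1 int_width[of k] int_width[of "k - 1"] by simp
  qed
qed

text \<open>
  The factor 2 is the distance of two adjacent bonds of a row.
\<close>

definition position :: "(nat \<times> nat \<Rightarrow> nat) \<Rightarrow> nat \<times> nat \<Rightarrow> int" where
  "position \<psi> s = rank s + 2 * int (\<psi> s)"

text \<open>
  Beyond row \<open>m + 1\<close> the widths are arbitrary, so the family is set to be empty there.
\<close>

definition bonds_at :: "(nat \<times> nat \<Rightarrow> nat) \<Rightarrow> nat \<Rightarrow> int set" where
  "bonds_at \<psi> k = (if k \<le> m + 1 then (\<lambda>j. position \<psi> (k, j)) ` {1..width k} else {})"

lemma position_less:
  assumes \<psi>: "\<psi> \<in> weak_maps elements less_rel n"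
    and "(k, j) \<in> elements" "(k', j') \<in> elements" "k' = k \<or> k' = k + 1 \<or> k = k' + 1" "rank (k, j) < rank (k', j')"
  shows "position \<psi> (k, j) < position \<psi> (k', j')"
proof -
  have "((k, j), (k', j')) \<in> less_rel" using assms(2-5) by (rule less_rel_if_rank_less)
  then have "\<psi> (k, j) \<le> \<psi> (k', j')" using \<psi> assms(2,3) by (auto simp: weak_maps_def)
  then show ?thesis using assms(5) by (simp add: position_def)
qed

lemma strict_mono_position:
  assumes "\<psi> \<in> weak_maps elements less_rel n" "k \<le> m + 1"
  shows "strict_mono_on {1..width k} (\<lambda>j. position \<psi> (k, j))"
  using assms by (intro strict_mono_onI position_less) (simp_all add: mem_elements rank_def)

lemma position_in_bond_pos:
  assumes \<psi>: "\<psi> \<in> weak_maps elements less_rel n" and el: "(k, j) \<in> elements"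
  shows "position \<psi> (k, j) \<in> bond_pos k"
proof -
  have k: "k \<le> m + 1" using el by (simp add: elements_def)
  then have j: "1 \<le> j" "j \<le> width k" using el mem_elements by auto
  have "\<psi> (k, j) \<le> n" using \<psi> el by (auto simp: weak_maps_def)
  then have "L k \<le> position \<psi> (k, j)" "position \<psi> (k, j) \<le> R k"
    using j int_width[OF k] by (simp_all add: position_def rank_def R_def)
  then show ?thesis using parity[OF k] by (simp add: bond_pos_def position_def rank_def)
qed

lemma bond_family_bonds_at:
  assumes "\<psi> \<in> weak_maps elements less_rel n"
  shows "bond_family (bonds_at \<psi>)"
proof -
  have "bonds_at \<psi> k \<subseteq> bond_pos k" for k
    using position_in_bond_pos[OF assms] by (auto simp: bonds_at_def mem_elements)
  moreover have "bonds_at \<psi> k = {}" if "k \<notin> {1..m}" for k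
  proof -
    have "k = 0 \<or> k = m + 1 \<or> \<not> k \<le> m + 1" using that by auto
    then show ?thesis using width_ends by (auto simp: bonds_at_def)
  qed
  ultimately show ?thesis by (simp add: bond_family_def)
qed

lemma adjacent_bonds_disjoint:
  assumes "bond_family D" "k' = k + 1 \<or> k = k' + 1"
  shows "D k \<inter> D k' = {}"
proof -
  have "D k \<subseteq> bond_pos k" "D k' \<subseteq> bond_pos k'" using assms(1) by (auto simp: bond_family_def)
  moreover have "bond_pos k \<inter> bond_pos k' = {}"
    using assms(2) by (auto simp: bond_pos_def)
  ultimately show ?thesis by blast
qed

text \<open>
  For two adjacent rows the ranks of their elements alternate, beginning with the row that reaches
  further to the left. Positions increase with the rank, so the bonds alternate too.
\<close>

lemma balanced_bonds_at:
  assumes \<psi>: "\<psi> \<in> weak_maps elements less_rel n"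
  shows "balanced (bonds_at \<psi>)"
  unfolding balanced_iff_adjacent[OF bond_family_bonds_at[OF \<psi>]]
proof (intro conjI allI impI)
  fix k assume k: "k \<le> m + 1"
  show "card (bonds_at \<psi> k) = width k"
    using k card_image[OF strict_mono_on_imp_inj_on[OF strict_mono_position[OF \<psi> k]]] by (simp add: bonds_at_def)
next
  fix k k' assume k: "k \<le> m + 1" "k' \<le> m + 1" and adj: "(k' = k + 1 \<or> k = k' + 1) \<and> L k < L k'"
  note W = widths_adjacent[OF k adj[THEN conjunct1] adj[THEN conjunct2]]
  have D: "bonds_at \<psi> k = (\<lambda>j. position \<psi> (k, j)) ` {1..width k}"
    "bonds_at \<psi> k' = (\<lambda>j. position \<psi> (k', j)) ` {1..width k'}" using k by (auto simp: bonds_at_def)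
  have disj: "bonds_at \<psi> k \<inter> bonds_at \<psi> k' = {}"
    using adj by (intro adjacent_bonds_disjoint bond_family_bonds_at[OF \<psi>]) blast
  have near: "k' = k \<or> k' = k + 1 \<or> k = k' + 1" "k = k' \<or> k = k' + 1 \<or> k' = k + 1" using adj by auto
  have "position \<psi> (k, j) < position \<psi> (k', j)" if "j \<in> {1..width k'}" for j
    using that W near k by (intro position_less[OF \<psi>]) (auto simp: mem_elements rank_def)
  moreover have "position \<psi> (k', j) < position \<psi> (k, j + 1)" if "1 \<le> j" "j + 1 \<le> width k" for j
    using that W near k by (intro position_less[OF \<psi>]) (auto simp: mem_elements rank_def)
  ultimately show "interlaced (bonds_at \<psi> k) (bonds_at \<psi> k')"
    unfolding D using interlaced_iff[OF strict_mono_position[OF \<psi> k(1)] strict_mono_position[OF \<psi> k(2)] W(1,2)]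
      disj[unfolded D] by blast
qed

lemma inj_on_bonds_at: "inj_on bonds_at (weak_maps elements less_rel n)"
proof (rule inj_onI)
  fix \<psi> \<phi> assume \<psi>: "\<psi> \<in> weak_maps elements less_rel n" and \<phi>: "\<phi> \<in> weak_maps elements less_rel n"
    and eq: "bonds_at \<psi> = bonds_at \<phi>"
  have "\<psi> s = \<phi> s" if s: "s \<in> elements" for s
  proof -
    obtain k j where kj: "s = (k, j)" by (cases s)
    then have k: "k \<le> m + 1" using s by (simp add: elements_def)
    then have j: "j \<in> {1..width k}" using s kj mem_elements by simp
    have "(\<lambda>j. position \<psi> (k, j)) ` {1..width k} = (\<lambda>j. position \<phi> (k, j)) ` {1..width k}"
      using fun_cong[OF eq, of k] k by (simp add: bonds_at_def)
    then have "position \<psi> (k, j) = position \<phi> (k, j)"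
      by (rule increasing_unique[OF strict_mono_position[OF \<psi> k] strict_mono_position[OF \<phi> k] _ j])
    then show ?thesis by (simp add: position_def kj)
  qed
  then show "\<psi> = \<phi>"
    using \<psi> \<phi> by (intro PiE_ext[of \<psi> elements "\<lambda>_. {0..n}" \<phi>]) (auto simp: weak_maps_def)
qed

lemma increasing_in_bond_pos:
  assumes x: "strict_mono_on {1..a} x" "x ` {1..a} \<subseteq> bond_pos k" and "1 \<le> i" "i + d \<le> a"
  shows "x i + 2 * int d \<le> x (i + d)"
  using assms(4)
proof (induction d)
  case (Suc d)
  have "x (i + d) < x (i + Suc d)"
    using x(1) Suc.prems assms(3) by (intro strict_mono_onD[of "{1..a}" x]) auto
  moreover have "x (i + d) \<in> bond_pos k" "x (i + Suc d) \<in> bond_pos k" using x(2) Suc.prems assms(3) by auto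
  then have "even (x (i + Suc d) - x (i + d))"
    using bond_pos_parity[of "x (i + d)" k] bond_pos_parity[of "x (i + Suc d)" k] by auto
  ultimately have "x (i + d) + 2 \<le> x (i + Suc d)" by presburger
  then show ?case using Suc by simp
qed simp

text \<open>
  There are \<open>j - 1\<close> selected bonds to the left of the \<open>j\<close>-th one and
  \<open>width k - j\<close> to its right. They leave exactly \<open>n + 1\<close> possible positions, because
  the row has \<open>width k + n\<close> bond positions.
\<close>

lemma increasing_bounds:
  assumes x: "strict_mono_on {1..width k} x" "x ` {1..width k} \<subseteq> bond_pos k"
    and k: "k \<le> m + 1" and j: "j \<in> {1..width k}"
  shows "rank (k, j) \<le> x j" "x j \<le> rank (k, j) + 2 * int n" "even (x j - rank (k, j))"
proof -
  have mem: "x i \<in> bond_pos k" if "i \<in> {1..width k}" for i using x(2) that by blast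
  have "x 1 + 2 * int (j - 1) \<le> x (1 + (j - 1))" using j by (intro increasing_in_bond_pos[OF x]) auto
  moreover have "L k \<le> x 1" using mem[of 1] j by (simp add: bond_pos_def)
  ultimately show "rank (k, j) \<le> x j" using j by (simp add: rank_def of_nat_diff)
  have "x j + 2 * int (width k - j) \<le> x (j + (width k - j))" using j by (intro increasing_in_bond_pos[OF x]) auto
  moreover have "x (width k) \<le> R k" using mem[of "width k"] j by (simp add: bond_pos_def)
  ultimately show "x j \<le> rank (k, j) + 2 * int n" using j int_width[OF k] by (simp add: rank_def R_def of_nat_diff)
  have "odd (r0 + int k + x j)" using mem[OF j] by (rule bond_pos_parity)
  then show "even (x j - rank (k, j))" using parity[OF k] by (auto simp: rank_def)
qed

text \<open>
  Enumerate the bonds of every row from left to right and take for \<open>\<psi>\<close> half of the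
  distance to the leftmost possible position. Interlacing of adjacent rows makes the positions
  strictly increasing along covers; as the rank increases by 1 there, \<open>\<psi>\<close> does not decrease.
\<close>

lemma bonds_at_surj:
  assumes bal: "balanced D"
  shows "\<exists>\<psi>\<in>weak_maps elements less_rel n. bonds_at \<psi> = D"
proof -
  have fam: "bond_family D" using bal by (simp add: balanced_def)
  have card: "card (D k) = width k" if "k \<le> m + 1" for k
    using balanced_iff_adjacent[OF fam] bal that by blast
  have inter: "interlaced (D k) (D k')"
    if "k \<le> m + 1" "k' \<le> m + 1" "k' = k + 1 \<or> k = k' + 1" "L k < L k'" for k k'
    using balanced_iff_adjacent[OF fam] bal that by blast
  have "\<exists>x. strict_mono_on {1..width k} x \<and> x ` {1..width k} = D k" if "k \<le> m + 1" for k
  proof -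
    have "finite (D k)" using fam finite_bond_pos[of k] by (auto simp: bond_family_def intro: finite_subset)
    then show ?thesis using increasing_enumeration[of "D k"] card[OF that] by simp
  qed
  then obtain X where mono: "strict_mono_on {1..width k} (X k)" and X: "X k ` {1..width k} = D k"
    if "k \<le> m + 1" for k by metis
  have X_sub: "X k ` {1..width k} \<subseteq> bond_pos k" if "k \<le> m + 1" for k
    using X[OF that] fam by (simp add: bond_family_def)
  define \<psi> where "\<psi> = (\<lambda>s\<in>elements. nat ((X (fst s) (snd s) - rank s) div 2))"
  have pos: "position \<psi> (k, j) = X k j" and le: "\<psi> (k, j) \<le> n" if el: "(k, j) \<in> elements" for k j
  proof -
    have k: "k \<le> m + 1" using el by (simp add: elements_def)
    then have j: "j \<in> {1..width k}" using el mem_elements by simp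
    note b = increasing_bounds[OF mono[OF k] X_sub[OF k] k j]
    obtain d where d: "X k j - rank (k, j) = 2 * d" using b(3) by blast
    then have "0 \<le> d" "d \<le> int n" using b by auto
    moreover have "\<psi> (k, j) = nat d" using d el by (simp add: \<psi>_def)
    ultimately show "position \<psi> (k, j) = X k j" "\<psi> (k, j) \<le> n" using d by (auto simp: position_def)
  qed
  have cover: "\<psi> (k, j) \<le> \<psi> (k', j')" if c: "((k, j), (k', j')) \<in> strip_covers m n hexes" for k j k' j'
  proof -
    have el: "(k, j) \<in> elements" "(k', j') \<in> elements" and adj: "k' = k + 1 \<or> k = k' + 1"
      and rk: "rank (k', j') = rank (k, j) + 1"
      using c strip_covers_hexes by auto
    have k: "k \<in> {1..m}" "k' \<in> {1..m}" and km: "k \<le> m + 1" "k' \<le> m + 1" using el by (auto simp: elements_def)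
    have j: "j \<in> {1..width k}" "j' \<in> {1..width k'}" using el km mem_elements by auto
    have disj: "X k ` {1..width k} \<inter> X k' ` {1..width k'} = {}"
      unfolding X[OF km(1)] X[OF km(2)] using fam adj by (rule adjacent_bonds_disjoint)
    have L: "L k' = L k + 1 \<or> L k' = L k - 1" using L_adjacent[OF k adj] .
    have "X k j < X k' j'"
    proof (cases "L k < L k'")
      case True
      have "j' = j" using rk L True by (auto simp: rank_def)
      moreover have "interlaced (X k ` {1..width k}) (X k' ` {1..width k'})"
        unfolding X[OF km(1)] X[OF km(2)] using km adj True by (rule inter)
      then have "\<forall>j\<in>{1..width k'}. X k j < X k' j"
        using interlaced_iff[OF mono[OF km(1)] mono[OF km(2)] widths_adjacent(1,2)[OF km adj True] disj] by blast
      ultimately show ?thesis using j by blast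
    next
      case False
      then have less: "L k' < L k" using L by linarith
      have "j' = j + 1" using rk L False by (auto simp: rank_def)
      moreover have "interlaced (X k' ` {1..width k'}) (X k ` {1..width k})"
        unfolding X[OF km(1)] X[OF km(2)] using km adj less by (intro inter) auto
      then have "\<forall>j. 1 \<le> j \<and> j + 1 \<le> width k' \<longrightarrow> X k j < X k' (j + 1)"
        using interlaced_iff[OF mono[OF km(2)] mono[OF km(1)] widths_adjacent(1,2)[OF km(2,1) _ less]] disj adj
        by (metis inf_commute)
      ultimately show ?thesis using j by auto
    qed
    then have "position \<psi> (k, j) < position \<psi> (k', j')" using pos el by simp
    then show ?thesis using rk by (simp add: position_def)
  qed
  have weak: "\<psi> s \<le> \<psi> t" if "(s, t) \<in> less_rel" for s t
    using that unfolding strip_less_def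
  proof (induction rule: trancl_induct)
    case (base t)
    then show ?case using cover by (cases s; cases t) simp
  next
    case (step t u)
    then have "\<psi> t \<le> \<psi> u" using cover by (cases t; cases u) simp
    then show ?case using step by simp
  qed
  have "\<psi> \<in> weak_maps elements less_rel n"
  proof -
    have "\<psi> \<in> extensional elements" unfolding \<psi>_def by (rule restrict_extensional)
    then show ?thesis using weak le by (auto simp: weak_maps_def PiE_iff)
  qed
  moreover have "bonds_at \<psi> = D"
  proof
    fix k
    show "bonds_at \<psi> k = D k"
    proof (cases "k \<le> m + 1")
      case True
      have "(\<lambda>j. position \<psi> (k, j)) ` {1..width k} = X k ` {1..width k}"
        using pos True mem_elements by (intro image_cong) auto
      then show ?thesis using True X by (simp add: bonds_at_def)
    next
      case False
      then show ?thesis using fam by (auto simp: bonds_at_def bond_family_def)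
    qed
  qed
  ultimately show ?thesis by blast
qed

lemma bij_betw_bonds_at: "bij_betw bonds_at (weak_maps elements less_rel n) {D. balanced D}"
proof -
  have "bonds_at ` weak_maps elements less_rel n = {D. balanced D}"
    using balanced_bonds_at bonds_at_surj by blast
  then show ?thesis using inj_on_bonds_at by (simp add: bij_betw_def)
qed

end

section \<open>Counting Kekule structures and Clar covers\<close>

context strip
begin

lemma vertical_edge_in_hexes:
  assumes "{Upper r y, Lower r y} \<in> edges (hex_graph hexes)"
  shows "\<exists>k\<in>{1..m}. r = r0 + int k \<and> y \<in> bond_pos k"
proof -
  have "{Upper r y, Lower r y} \<noteq> slant k p" for k p
    by (auto simp: slant_def frag_vertex_def doubleton_eq_iff)
  then obtain k p where "k \<in> {1..m}" "p \<in> bond_pos k" "{Upper r y, Lower r y} = bond k p"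
    using assms unfolding edges_hexes by blast
  then show ?thesis by (auto simp: bond_def doubleton_eq_iff)
qed

text \<open>
  The strip has no holes: the two vertical edges of the hexagon already place it inside a row.
\<close>

lemma hexagon_in_hexes:
  assumes "hexagon_edges h \<subseteq> edges (hex_graph hexes)"
  shows "h \<in> hexes"
proof -
  obtain r x where h: "h = (r, x)" by (cases h)
  have "left_edge h \<in> edges (hex_graph hexes)" "right_edge h \<in> edges (hex_graph hexes)"
    using assms by (auto simp: hexagon_edges_def)
  then have "{Upper r (x - 1), Lower r (x - 1)} \<in> edges (hex_graph hexes)"
    "{Upper r (x + 1), Lower r (x + 1)} \<in> edges (hex_graph hexes)"
    by (simp_all add: h)
  then obtain k k' where k: "k \<in> {1..m}" "r = r0 + int k" "x - 1 \<in> bond_pos k"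
    and k': "r = r0 + int k'" "x + 1 \<in> bond_pos k'"
    using vertical_edge_in_hexes by meson
  then have "x + 1 \<in> bond_pos k" by simp
  then show ?thesis
    unfolding h k(2) using k by (intro hexes_D) (auto simp: bond_pos_def)
qed

end

context kekulean_strip
begin

text \<open>
  The bond of \<open>(k, j)\<close> can move to the left iff it is not the leftmost position of its row and
  the position one half unit to the left is free in the adjacent rows. A bond at that half unit
  would belong to a lower cover with the same value of \<open>\<psi>\<close>; the first bond of a
  row can be at the left end only if \<open>\<psi>\<close> vanishes there.
\<close>

lemma jump_iff:
  assumes \<psi>: "\<psi> \<in> weak_maps elements less_rel n" and t: "(k, j) \<in> elements"
  shows "(k, j) \<in> jumps elements less_rel \<psi> \<longleftrightarrow> L k < position \<psi> (k, j) - 1 \<and>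
    position \<psi> (k, j) - 1 \<notin> bonds_at \<psi> (k - 1) \<and> position \<psi> (k, j) - 1 \<notin> bonds_at \<psi> (k + 1)"
    (is "?jump \<longleftrightarrow> ?free")
proof
  have k: "k \<in> {1..m}" using t by (simp add: elements_def)
  have j: "1 \<le> j" using t by (simp add: elements_def)
  {
    assume jump: ?jump
    have "1 \<le> \<psi> (k, j)" using jump by (simp add: jumps_def)
    then have "L k < position \<psi> (k, j) - 1" using j by (simp add: position_def rank_def)
    moreover have "position \<psi> (k, j) - 1 \<notin> bonds_at \<psi> k'" if k': "k' = k + 1 \<or> k = k' + 1" for k'
    proof
      assume "position \<psi> (k, j) - 1 \<in> bonds_at \<psi> k'"
      then obtain j' where km': "k' \<le> m + 1" and j': "j' \<in> {1..width k'}"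
        and eq: "position \<psi> (k, j) - 1 = position \<psi> (k', j')"
        by (auto simp: bonds_at_def split: if_splits)
      then have s: "(k', j') \<in> elements" using mem_elements by simp
      have "rank (k', j') \<noteq> rank (k, j)" using eq unfolding position_def by presburger
      then consider "rank (k', j') < rank (k, j)" | "rank (k, j) < rank (k', j')" by linarith
      then show False
      proof cases
        case 1
        then have "((k', j'), (k, j)) \<in> less_rel" using k' by (intro less_rel_if_rank_less s t) auto
        then have "\<psi> (k', j') < \<psi> (k, j)" using jump s by (simp add: jumps_def)
        then show False using 1 eq by (simp add: position_def)
      next
        case 2
        then have "position \<psi> (k, j) < position \<psi> (k', j')" using k' by (intro position_less \<psi> s t) auto
        then show False using eq by simp
      qed
    qed
    ultimately show ?free using k by auto
  }
  {
    assume free: ?free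
    have cover: "\<psi> s < \<psi> (k, j)" if c: "(s, (k, j)) \<in> strip_covers m n hexes" for s
    proof -
      obtain k' j' where s: "s = (k', j')" by (cases s)
      have el: "(k', j') \<in> elements" and adj: "k = k' + 1 \<or> k' = k + 1" and rk: "rank (k, j) = rank (k', j') + 1"
        using c strip_covers_hexes[of k' j' k j] unfolding s by auto
      have "((k', j'), (k, j)) \<in> less_rel" using c s by (auto simp: strip_less_def)
      then have "\<psi> (k', j') \<le> \<psi> (k, j)" using \<psi> el t by (auto simp: weak_maps_def)
      moreover have "\<psi> (k', j') \<noteq> \<psi> (k, j)"
      proof
        assume "\<psi> (k', j') = \<psi> (k, j)"
        then have pos: "position \<psi> (k, j) - 1 = position \<psi> (k', j')" using rk by (simp add: position_def)
        have km': "k' \<le> m + 1" using el by (simp add: elements_def)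
        then have "position \<psi> (k, j) - 1 \<in> bonds_at \<psi> k'"
          unfolding pos using el mem_elements by (simp add: bonds_at_def)
        then show False using free adj by auto
      qed
      ultimately show ?thesis using s by simp
    qed
    have below: "\<psi> s < \<psi> (k, j)" if less: "(s, (k, j)) \<in> less_rel" for s
    proof -
      obtain u where "(s, u) \<in> (strip_covers m n hexes)\<^sup>*" and u2: "(u, (k, j)) \<in> strip_covers m n hexes"
        using tranclD2[OF less[unfolded strip_less_def]] by blast
      then have u: "s = u \<or> (s, u) \<in> less_rel" unfolding strip_less_def by (metis rtranclD)
      have "\<psi> s \<le> \<psi> u"
      proof (cases "s = u")
        case False
        then have "(s, u) \<in> less_rel" using u by simp
        then show ?thesis using less_rel_rank[of s u] \<psi> by (auto simp: weak_maps_def)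
      qed simp
      then show ?thesis using cover[OF u2] by simp
    qed
    have "0 < \<psi> (k, j)"
    proof (cases "j = 1")
      case True
      then show ?thesis using free by (simp add: position_def rank_def)
    next
      case False
      then have "(k, j - 1) \<in> elements" using t by (auto simp: elements_def)
      then have "((k, j - 1), (k, j)) \<in> less_rel" using less_rel_next_in_row[of k "j - 1"] t j by simp
      then show ?thesis using below by fastforce
    qed
    then show ?jump using below t by (simp add: jumps_def)
  }
qed

lemma card_proper_sextets_matching:
  assumes \<psi>: "\<psi> \<in> weak_maps elements less_rel n"
  shows "card (proper_sextets hexes (matching (bonds_at \<psi>))) = card (jumps elements less_rel \<psi>)"
proof -
  let ?f = "\<lambda>s. (r0 + int (fst s), position \<psi> s - 1)"
  note sextet = sextet_iff[OF balanced_bonds_at[OF \<psi>]]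
  have "proper_sextets hexes (matching (bonds_at \<psi>)) = ?f ` jumps elements less_rel \<psi>"
  proof (intro equalityI subsetI)
    fix h assume h: "h \<in> proper_sextets hexes (matching (bonds_at \<psi>))"
    then have "h \<in> hexes" by (simp add: proper_sextets_def)
    then obtain k x where k: "k \<in> {1..m}" and hx: "h = (r0 + int k, x)" by (auto simp: hexes_def)
    have s: "L k < x" "x + 1 \<in> bonds_at \<psi> k" "x \<notin> bonds_at \<psi> (k - 1)" "x \<notin> bonds_at \<psi> (k + 1)"
      using h sextet[OF k] unfolding hx by blast+
    then obtain j where j: "j \<in> {1..width k}" and x: "x = position \<psi> (k, j) - 1"
      by (auto simp: bonds_at_def split: if_splits)
    then have t: "(k, j) \<in> elements" using k by (simp add: elements_def)
    have "(k, j) \<in> jumps elements less_rel \<psi>"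
      unfolding jump_iff[OF \<psi> t] using s x by blast
    then show "h \<in> ?f ` jumps elements less_rel \<psi>" using hx x by force
  next
    fix h assume "h \<in> ?f ` jumps elements less_rel \<psi>"
    then obtain k j where h: "h = (r0 + int k, position \<psi> (k, j) - 1)" and jump: "(k, j) \<in> jumps elements less_rel \<psi>"
      by auto
    then have t: "(k, j) \<in> elements" by (simp add: jumps_def)
    then have k: "k \<in> {1..m}" and "j \<in> {1..width k}" by (auto simp: elements_def)
    then have "position \<psi> (k, j) \<in> bonds_at \<psi> k" by (simp add: bonds_at_def)
    then show "h \<in> proper_sextets hexes (matching (bonds_at \<psi>))"
      unfolding h sextet[OF k] using jump jump_iff[OF \<psi> t] by simp
  qed
  moreover have "inj_on ?f (jumps elements less_rel \<psi>)"
  proof (rule inj_onI, clarify)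
    fix k j k' j'
    assume "(k, j) \<in> jumps elements less_rel \<psi>" "(k', j') \<in> jumps elements less_rel \<psi>"
      and eq: "r0 + int (fst (k, j)) = r0 + int (fst (k', j'))" "position \<psi> (k, j) - 1 = position \<psi> (k', j') - 1"
    then have el: "(k, j) \<in> elements" "(k, j') \<in> elements" and kk: "k = k'" by (auto simp: jumps_def)
    then have k: "k \<le> m + 1" by (simp add: elements_def)
    have "position \<psi> (k, j) = position \<psi> (k, j')" using eq(2) kk by simp
    then have "j = j'"
      using inj_onD[OF strict_mono_on_imp_inj_on[OF strict_mono_position[OF \<psi> k]], of j j'] el mem_elements[OF k]
      by simp
    then show "k = k' \<and> j = j'" using kk by simp
  qed
  ultimately show ?thesis by (simp add: card_image)
qed

text \<open>
  With the indicator function of a number for \<open>g\<close> this counts the matchings with a given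
  number of proper sextets, with \<open>c \<mapsto> (1 + x) ^ c\<close> it gives the Zhang-Zhang polynomial.
\<close>

lemma sum_perfect_matchings:
  fixes g :: "nat \<Rightarrow> 'b::comm_semiring_1"
  shows "(\<Sum>K\<in>{K. exact_cover hexes K {}}. g (card (proper_sextets hexes K))) =
    (\<Sum>A\<in>Pow elements. of_nat (strict_order_poly A less_rel n) * g (card A))"
proof -
  have "bij_betw (matching \<circ> bonds_at) (weak_maps elements less_rel n) {K. exact_cover hexes K {}}"
    using bij_betw_bonds_at bij_betw_matching by (rule bij_betw_trans)
  then have "(\<Sum>K\<in>{K. exact_cover hexes K {}}. g (card (proper_sextets hexes K))) =
      (\<Sum>\<psi>\<in>weak_maps elements less_rel n. g (card (proper_sextets hexes ((matching \<circ> bonds_at) \<psi>))))"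
    by (rule sum.reindex_bij_betw[symmetric])
  also have "\<dots> = (\<Sum>\<psi>\<in>weak_maps elements less_rel n. g (card (jumps elements less_rel \<psi>)))"
    by (rule sum.cong) (simp_all add: card_proper_sextets_matching)
  also have "\<dots> = (\<Sum>A\<in>Pow elements. of_nat (strict_order_poly A less_rel n) * g (card A))"
    by (rule sum_weak_maps[OF finite_elements trans_less_rel irrefl_less_rel])
  finally show ?thesis .
qed

lemma num_kekule_hexes:
  "num_kekule hexes k = (\<Sum>A | A \<subseteq> elements \<and> int (card A) = k. strict_order_poly A less_rel n)"
proof -
  let ?g = "\<lambda>c. if int c = k then 1 else 0 :: nat"
  have "num_kekule hexes k = card {K \<in> {K. exact_cover hexes K {}}. int (card (proper_sextets hexes K)) = k}"
    using num_kekule_eq_card[OF finite_hexes hexagon_in_hexes] by simp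
  also have "\<dots> = (\<Sum>K\<in>{K. exact_cover hexes K {}}. ?g (card (proper_sextets hexes K)))"
    using finite_perfect_matchings[OF finite_hexes] by (simp only: card_eq_sum sum.inter_filter)
  also have "\<dots> = (\<Sum>A\<in>Pow elements. strict_order_poly A less_rel n * ?g (card A))"
    using sum_perfect_matchings[of ?g] by simp
  also have "\<dots> = (\<Sum>A\<in>Pow elements. if int (card A) = k then strict_order_poly A less_rel n else 0)"
    by (rule sum.cong) simp_all
  also have "\<dots> = (\<Sum>A\<in>{A \<in> Pow elements. int (card A) = k}. strict_order_poly A less_rel n)"
    using finite_elements by (intro sum.inter_filter[symmetric]) simp
  finally show ?thesis by simp
qed

lemma pcompose_monom: "pcompose (monom c k) p = smult c (p ^ k)"
  by (induction k) (simp_all add: monom_0 monom_Suc pcompose_pCons)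

lemma ZZ_hexes: "ZZ hexes = pcompose (ext_strict_order_poly elements less_rel n) [:1, 1:]"
proof -
  have "ZZ hexes = (\<Sum>K\<in>{K. exact_cover hexes K {}}. [:1, 1:] ^ card (proper_sextets hexes K))"
    by (rule ZZ_eq_sum_perfect_matchings[OF finite_hexes hexagon_in_hexes])
  also have "\<dots> = (\<Sum>A\<in>Pow elements. of_nat (strict_order_poly A less_rel n) * [:1, 1:] ^ card A)"
    by (rule sum_perfect_matchings[where g = "\<lambda>c. [:1, 1:] ^ c"])
  also have "\<dots> = (\<Sum>A\<in>Pow elements. pcompose (monom (int (strict_order_poly A less_rel n)) (card A)) [:1, 1:])"
    by (simp add: pcompose_monom of_nat_poly)
  also have "\<dots> = pcompose (ext_strict_order_poly elements less_rel n) [:1, 1:]"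
    by (simp add: ext_strict_order_poly_def pcompose_sum)
  finally show ?thesis .
qed

end

text \<open>
  The tiers are supplemented by the virtual rows. The leftmost bond of a tier is one half unit to
  the left of the centre of its first hexagon.
\<close>

lemma regular_strip_is_strip:
  assumes "regular_strip m n S"
  shows "\<exists>r0 L w. strip m n r0 L w \<and> S = strip.hexes m r0 L w"
proof -
  have m: "1 \<le> m" using assms by (simp add: regular_strip_def)
  obtain r0 :: int and l :: "nat \<Rightarrow> int" and len :: "nat \<Rightarrow> nat" where
    tiers_all: "\<forall>k\<in>{1..m}. len k \<ge> 1 \<and> tier (r0 + int k) (l k) (len k) \<subseteq> lattice_hexagons"
    and steps_all: "\<forall>k\<in>{1..<m}. \<bar>l (k + 1) - l k\<bar> = 1 \<and>
           \<bar>(l (k + 1) + 2 * (int (len (k + 1)) - 1)) - (l k + 2 * (int (len k) - 1))\<bar> = 1"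
    and ends: "len 1 = n" "len m = n"
    and S: "S = (\<Union>k\<in>{1..m}. tier (r0 + int k) (l k) (len k))"
    using assms unfolding regular_strip_def by blast
  have tiers: "1 \<le> len k \<and> tier (r0 + int k) (l k) (len k) \<subseteq> lattice_hexagons" if "k \<in> {1..m}" for k
    using tiers_all that by blast
  have left: "\<bar>l (k + 1) - l k\<bar> = 1"
    and right: "\<bar>(l (k + 1) + 2 * (int (len (k + 1)) - 1)) - (l k + 2 * (int (len k) - 1))\<bar> = 1"
    if "k \<in> {1..<m}" for k
    using steps_all that by blast+
  have par: "even (r0 + int k + l k)" if "k \<in> {1..m}" for k
  proof -
    have "(r0 + int k, l k) \<in> tier (r0 + int k) (l k) (len k)"
      using tiers[OF that] unfolding tier_def by (intro CollectI exI[of _ 0]) auto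
    then show ?thesis using tiers[OF that] by (auto simp: lattice_hexagons_def)
  qed
  define L where "L = (\<lambda>k. if k = 0 then l 1 else if k = m + 1 then l m else l k - 1)"
  define w where "w = (\<lambda>k. if k = 0 \<or> k = m + 1 then n - 1 else len k)"
  have inner: "L k = l k - 1" "w k = len k" if "k \<in> {1..m}" for k
    using that by (auto simp: L_def w_def)
  have outer: "L 0 = l 1" "w 0 = n - 1" "L (m + 1) = l m" "w (m + 1) = n - 1"
    by (simp_all add: L_def w_def)
  have n: "1 \<le> n" using tiers[of 1] m ends by simp
  have strip: "strip m n r0 L w"
  proof
    show "1 \<le> m" "1 \<le> n" by fact+
    show "1 \<le> w k" if "k \<in> {1..m}" for k using that tiers inner by simp
    show "w 0 = n - 1" "w (m + 1) = n - 1" by (rule outer)+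
    show "w 1 = n" "w m = n" using inner[of 1] inner[of m] m ends by auto
    show "odd (r0 + int k + L k)" if k: "k \<le> m + 1" for k
    proof -
      consider "k = 0" | "k = m + 1" | "k \<in> {1..m}" using k by fastforce
      then show ?thesis
        using outer inner[of k] par[of 1] par[of m] par[of k] m by cases auto
    qed
    fix k assume "k \<le> m"
    then consider "k = 0" | "k = m" "k \<noteq> 0" | "k \<in> {1..<m}" by fastforce
    then have "\<bar>L (k + 1) - L k\<bar> = 1 \<and> \<bar>(L (k + 1) + 2 * int (w (k + 1))) - (L k + 2 * int (w k))\<bar> = 1"
    proof cases
      case 1
      then show ?thesis using outer inner[of 1] m n ends by simp
    next
      case 2
      then show ?thesis using outer inner[of m] m n ends by simp
    next
      case 3
      then have "k \<in> {1..m}" "k + 1 \<in> {1..m}" by auto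
      then show ?thesis using inner[of k] inner[of "k + 1"] left[OF 3] right[OF 3] by simp
    qed
    then show "\<bar>L (k + 1) - L k\<bar> = 1" "\<bar>(L (k + 1) + 2 * int (w (k + 1))) - (L k + 2 * int (w k))\<bar> = 1"
      by blast+
  qed
  interpret strip m n r0 L w by (rule strip)
  have tier_eq: "tier (r0 + int k) (l k) (len k) = {(r0 + int k, x) | x. L k < x \<and> x < R k \<and> even (r0 + int k + x)}"
    if k: "k \<in> {1..m}" for k
  proof (intro equalityI subsetI)
    fix h assume "h \<in> tier (r0 + int k) (l k) (len k)"
    then obtain i where "h = (r0 + int k, l k + 2 * int i)" "i < len k" by (auto simp: tier_def)
    then show "h \<in> {(r0 + int k, x) | x. L k < x \<and> x < R k \<and> even (r0 + int k + x)}"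
      using inner[OF k] par[OF k] by (auto simp: R_def)
  next
    fix h assume "h \<in> {(r0 + int k, x) | x. L k < x \<and> x < R k \<and> even (r0 + int k + x)}"
    then obtain x where h: "h = (r0 + int k, x)" and x: "L k < x" "x < R k" "even (r0 + int k + x)" by blast
    have "even (x - l k)" using x(3) par[OF k] by presburger
    then obtain d where d: "x - l k = 2 * d" by blast
    have "0 \<le> d" "d < int (len k)" using x d inner[OF k] unfolding R_def by presburger+
    then have "x = l k + 2 * int (nat d)" "nat d < len k" using d by auto
    then show "h \<in> tier (r0 + int k) (l k) (len k)" unfolding tier_def h by blast
  qed
  have "S = hexes"
    unfolding S hexes_def using tier_eq by auto
  then show ?thesis using strip by blast
qed

theorem theorem24:
  fixes m n :: nat and S :: "hexagon set" and k :: int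
  assumes "regular_strip m n S"
    and "\<exists>K. kekule S K"
  shows "num_kekule S k =
           (\<Sum>A | A \<subseteq> strip_poset m n S \<and> int (card A) = k.
              strict_order_poly A (strip_less m n S) n)
       \<and> ZZ S = pcompose (ext_strict_order_poly (strip_poset m n S) (strip_less m n S) n) [:1, 1:]"
proof -
  obtain r0 L w where "strip m n r0 L w" and S: "S = strip.hexes m r0 L w"
    using regular_strip_is_strip[OF assms(1)] by blast
  then interpret strip m n r0 L w by simp
  obtain M T where "exact_cover hexes M T"
    using assms(2) exact_cover_if_clar_cover[OF hexagon_in_hexes] unfolding S kekule_def by blast
  then have "exact_cover hexes (M \<union> \<Union> (sextet_edges ` T)) {}" by (rule exact_cover_refine(1))
  then obtain D where D: "balanced D"
    using bij_betw_matching unfolding bij_betw_def by blast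
  \<comment> \<open>the family of a perfect matching has \<open>w k + 1 - n\<close> bonds in row \<open>k\<close>, so this number is not negative\<close>
  interpret kekulean_strip m n r0 L w
  proof
    show "n \<le> w k + 1" if "k \<le> m + 1" for k using card_if_balanced[OF D that] by linarith
  qed
  show ?thesis
    unfolding S strip_poset_hexes using num_kekule_hexes ZZ_hexes by blast
qed

end
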